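(* Let $n\geq 2$, $m\geq 1$ be integers, let $F_n$ and $F_m$ be free groups of ranks $n$ and $m$, and let $w_1\in F_n$, $w_2\in F_m$ be nontrivial elements. Let $G=F_n*_{w_1=w_2}F_m$ be the amalgamated free product of $F_n$ and $F_m$ identifying the infinite cyclic subgroups $\langle w_1\rangle\subseteq F_n$ and $\langle w_2\rangle\subseteq F_m$ via $w_1\mapsto w_2$. Then every representation $\rho:G\to \mathrm{Homeo}_+(\mathbb{R})$ without global fixed points is flexible.
   Context: $\mathrm{Homeo}_+(\mathbb{R})$ is the group of orientation preserving homeomorphisms of $\mathbb{R}$, with the compact-open topology (uniform convergence on compact sets). For a countable discrete group $G$, $\mathrm{Rep}(G,\mathrm{Homeo}_+(\mathbb{R}))$ is the set of group homomorphisms $G\to\mathrm{Homeo}_+(\mathbb{R})$ with the topology of pointwise convergence: $\rho_n\to\rho$ iff $\rho_n(g)\to\rho(g)$ in the compact-open topology for every $g\in G$. A global fixed point of $\rho$ is a point $x$ with $\rho(g)(x)=x$ for all $g\in G$. $\mathrm{Rep}_\#(G,\mathrm{Homeo}_+(\mathbb{R}))$ is the subspace of representations without global fixed points. A non-decreasing map $c:\mathbb{R}\to\mathbb{R}$ (not necessarily continuous) is called proper if preimages of compact sets are bounded; equivalently, $c(\mathbb{R})$ is unbounded in both directions. Two representations $\rho_1,\rho_2:G\to\mathrm{Homeo}_+(\mathbb{R})$ are semi-conjugated if there is a non-decreasing proper map $c:\mathbb{R}\to\mathbb{R}$ with $c\circ\rho_1(g)=\rho_2(g)\circ c$ for all $g\in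 G$ (this is an equivalence relation). A representation $\rho\in\mathrm{Rep}_\#(G,\mathrm{Homeo}_+(\mathbb{R}))$ is locally rigid if there is a neighbourhood $U$ of $\rho$ such that every $\rho'\in U\cap\mathrm{Rep}_\#(G,\mathrm{Homeo}_+(\mathbb{R}))$ is semi-conjugated to $\rho$. It is flexible if it is not locally rigid. *)

theory Defs
  imports "HOL-Analysis.Analysis" "HOL-Algebra.Elementary_Groups"
begin

section \<open>Groups given by generators and relations\<close>

inductive_set word_cong :: "'a set \<Rightarrow> ('a list \<times> 'a list) set \<Rightarrow> ('a list \<times> 'a list) set"
  for X R where
  rel: "(u, v) \<in> R \<Longrightarrow> (u, v) \<in> word_cong X R"
| refl: "u \<in> lists X \<Longrightarrow> (u, u) \<in> word_cong X R"
| sym: "(u, v) \<in> word_cong X R \<Longrightarrow> (v, u) \<in> word_cong X R"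
| trans: "(u, v) \<in> word_cong X R \<Longrightarrow> (v, w) \<in> word_cong X R \<Longrightarrow> (u, w) \<in> word_cong X R"
| append: "(u, v) \<in> word_cong X R \<Longrightarrow> (u', v') \<in> word_cong X R
            \<Longrightarrow> (u @ u', v @ v') \<in> word_cong X R"

text \<open>The quotient of the free monoid on \<open>X\<close> by the congruence generated by \<open>R\<close>.\<close>

definition presented_monoid :: "'a set \<Rightarrow> ('a list \<times> 'a list) set \<Rightarrow> 'a list set monoid" where
  "presented_monoid X R =
     \<lparr>carrier = lists X // word_cong X R,
      monoid.mult = (\<lambda>A B. \<Union>u\<in>A. \<Union>v\<in>B. word_cong X R `` {u @ v}),
      one = word_cong X R `` {[]}\<rparr>"

text \<open>A letter \<open>(x, True)\<close> stands for the generator \<open>x\<close>, and \<open>(x, False)\<close> for its inverse.\<close>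

definition free_group_rels :: "'a set \<Rightarrow> (('a \<times> bool) list \<times> ('a \<times> bool) list) set" where
  "free_group_rels X = {([(x, b), (x, \<not> b)], []) | x b. x \<in> X}"

definition free_group :: "'a set \<Rightarrow> ('a \<times> bool) list set monoid" where
  "free_group X = presented_monoid (X \<times> UNIV) (free_group_rels X)"

text \<open>The amalgamated free product of \<open>A\<close> and \<open>B\<close> along homomorphisms \<open>i : C \<rightarrow> A\<close> and
  \<open>j : C \<rightarrow> B\<close>: words in the elements of \<open>A\<close> and \<open>B\<close>, modulo the multiplication of each factor
  and the identification of \<open>i c\<close> with \<open>j c\<close>.\<close>

definition amalgam_rels ::
    "('c, 'm) monoid_scheme \<Rightarrow> ('a, 'k) monoid_scheme \<Rightarrow> ('b, 'l) monoid_scheme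
      \<Rightarrow> ('c \<Rightarrow> 'a) \<Rightarrow> ('c \<Rightarrow> 'b) \<Rightarrow> (('a + 'b) list \<times> ('a + 'b) list) set" where
  "amalgam_rels C A B i j =
     {([Inl a, Inl a'], [Inl (a \<otimes>\<^bsub>A\<^esub> a')]) | a a'. a \<in> carrier A \<and> a' \<in> carrier A}
   \<union> {([Inr b, Inr b'], [Inr (b \<otimes>\<^bsub>B\<^esub> b')]) | b b'. b \<in> carrier B \<and> b' \<in> carrier B}
   \<union> {([Inl \<one>\<^bsub>A\<^esub>], []), ([Inr \<one>\<^bsub>B\<^esub>], [])}
   \<union> {([Inl (i c)], [Inr (j c)]) | c. c \<in> carrier C}"

definition amalgamated_product ::
    "('c, 'm) monoid_scheme \<Rightarrow> ('a, 'k) monoid_scheme \<Rightarrow> ('b, 'l) monoid_scheme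
      \<Rightarrow> ('c \<Rightarrow> 'a) \<Rightarrow> ('c \<Rightarrow> 'b) \<Rightarrow> ('a + 'b) list set monoid" where
  "amalgamated_product C A B i j =
     presented_monoid (carrier A <+> carrier B) (amalgam_rels C A B i j)"

text \<open>\<open>A *\<^bsub>a = b\<^esub> B\<close>. When \<open>a\<close> and \<open>b\<close> have infinite order, the two homomorphisms
  from the integers are isomorphisms onto the subgroups generated by \<open>a\<close> and \<open>b\<close>.\<close>

definition cyclic_amalgam ::
    "('a, 'k) monoid_scheme \<Rightarrow> 'a \<Rightarrow> ('b, 'l) monoid_scheme \<Rightarrow> 'b \<Rightarrow> ('a + 'b) list set monoid" where
  "cyclic_amalgam A a B b =
     amalgamated_product integer_group A B
       (\<lambda>k::int. a [^]\<^bsub>A\<^esub> k) (\<lambda>k::int. b [^]\<^bsub>B\<^esub> k)"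

subsection \<open>The constructions yield groups\<close>

lemma word_cong_subset:
  assumes "R \<subseteq> lists X \<times> lists X" "(u, v) \<in> word_cong X R"
  shows "u \<in> lists X \<and> v \<in> lists X"
  using assms(2) by (induction rule: word_cong.induct) (use assms(1) in auto)

lemma equiv_word_cong:
  assumes "R \<subseteq> lists X \<times> lists X"
  shows "equiv (lists X) (word_cong X R)"
proof (intro equivI refl_onI symI transI)
  show "word_cong X R \<subseteq> lists X \<times> lists X"
    using word_cong_subset[OF assms] by auto
qed (fact word_cong.refl word_cong.sym word_cong.trans)+

lemma presented_monoid_mult:
  assumes R: "R \<subseteq> lists X \<times> lists X" and "u \<in> lists X" "v \<in> lists X"
  shows "word_cong X R `` {u} \<otimes>\<^bsub>presented_monoid X R\<^esub> word_cong X R `` {v}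
         = word_cong X R `` {u @ v}"
proof -
  have "congruent2 (word_cong X R) (word_cong X R) (\<lambda>u v. word_cong X R `` {u @ v})"
    by (auto intro!: congruent2I' equiv_class_eq[OF equiv_word_cong[OF R]] word_cong.append)
  from UN_equiv_class2[OF equiv_word_cong[OF R] equiv_word_cong[OF R] this assms(2,3)]
  show ?thesis by (simp add: presented_monoid_def)
qed

lemma carrier_presented_monoid:
  "carrier (presented_monoid X R) = (\<lambda>u. word_cong X R `` {u}) ` lists X"
  by (auto simp: presented_monoid_def quotient_def)

lemma one_presented_monoid: "\<one>\<^bsub>presented_monoid X R\<^esub> = word_cong X R `` {[]}"
  by (simp add: presented_monoid_def)

lemma group_presented_monoid:
  assumes R: "R \<subseteq> lists X \<times> lists X"
    and inv: "\<And>x. x \<in> X \<Longrightarrow> \<exists>y\<in>X. ([y, x], []) \<in> word_cong X R"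
  shows "group (presented_monoid X R)"
proof -
  let ?G = "presented_monoid X R" and ?cl = "\<lambda>u. word_cong X R `` {u}"
  note mult = presented_monoid_mult[OF R]
  have word_inv: "\<exists>v\<in>lists X. (v @ u, []) \<in> word_cong X R" if "u \<in> lists X" for u
    using that
  proof (induction u)
    case Nil
    then show ?case by (auto intro!: bexI[of _ "[]"] word_cong.refl)
  next
    case (Cons x u)
    then obtain v where v: "v \<in> lists X" "(v @ u, []) \<in> word_cong X R" by auto
    from Cons inv obtain y where y: "y \<in> X" "([y, x], []) \<in> word_cong X R" by blast
    have "(v @ ([y, x] @ u), v @ ([] @ u)) \<in> word_cong X R"
      by (intro word_cong.append[OF word_cong.refl] word_cong.append[OF _ word_cong.refl])
        (use v y Cons in auto)
    then have "((v @ [y]) @ x # u, []) \<in> word_cong X R"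
      using v(2) word_cong.trans by fastforce
    with v y show ?case by (intro bexI[of _ "v @ [y]"]) auto
  qed
  have carrierI: "?cl u \<in> carrier ?G" if "u \<in> lists X" for u
    using that unfolding carrier_presented_monoid by (rule imageI)
  have carrierE: "\<exists>u\<in>lists X. a = ?cl u" if "a \<in> carrier ?G" for a
    using that unfolding carrier_presented_monoid by blast
  show ?thesis
  proof (rule groupI)
    fix a b assume "a \<in> carrier ?G" "b \<in> carrier ?G"
    then obtain u v where uv: "u \<in> lists X" "a = ?cl u" "v \<in> lists X" "b = ?cl v"
      using carrierE by meson
    then have "u @ v \<in> lists X" by simp
    from carrierI[OF this] uv show "a \<otimes>\<^bsub>?G\<^esub> b \<in> carrier ?G"
      by (simp only: mult)
  next
    fix a b c assume "a \<in> carrier ?G" "b \<in> carrier ?G" "c \<in> carrier ?G"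
    then obtain u v w where uvw: "u \<in> lists X" "a = ?cl u" "v \<in> lists X" "b = ?cl v"
      "w \<in> lists X" "c = ?cl w"
      using carrierE by meson
    then have "u @ v \<in> lists X" "v @ w \<in> lists X" by simp_all
    with uvw show "a \<otimes>\<^bsub>?G\<^esub> b \<otimes>\<^bsub>?G\<^esub> c = a \<otimes>\<^bsub>?G\<^esub> (b \<otimes>\<^bsub>?G\<^esub> c)"
      by (simp only: mult append_assoc)
  next
    show "\<one>\<^bsub>?G\<^esub> \<in> carrier ?G"
      unfolding one_presented_monoid by (rule carrierI) simp
  next
    fix a assume "a \<in> carrier ?G"
    then obtain u where u: "u \<in> lists X" "a = ?cl u"
      using carrierE by meson
    have "[] \<in> lists X" by simp
    with u show "\<one>\<^bsub>?G\<^esub> \<otimes>\<^bsub>?G\<^esub> a = a"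
      by (simp only: mult one_presented_monoid append_Nil)
    from word_inv u obtain v where v: "v \<in> lists X" "(v @ u, []) \<in> word_cong X R" by blast
    show "\<exists>y\<in>carrier ?G. y \<otimes>\<^bsub>?G\<^esub> a = \<one>\<^bsub>?G\<^esub>"
    proof (rule bexI)
      show "?cl v \<otimes>\<^bsub>?G\<^esub> a = \<one>\<^bsub>?G\<^esub>"
        using u v by (simp only: mult one_presented_monoid
            equiv_class_eq[OF equiv_word_cong[OF R]])
    qed (fact carrierI[OF v(1)])
  qed
qed

lemma group_free_group: "group (free_group X)"
  unfolding free_group_def
proof (rule group_presented_monoid)
  show "free_group_rels X \<subseteq> lists (X \<times> UNIV) \<times> lists (X \<times> UNIV)"
    by (auto simp: free_group_rels_def)
  fix z :: "'a \<times> bool" assume "z \<in> X \<times> UNIV"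
  then obtain x b where z: "z = (x, \<not> b)" "x \<in> X"
    by (intro that[of "fst z" "\<not> snd z"]) auto
  then have "([(x, b), z], []) \<in> free_group_rels X"
    unfolding free_group_rels_def by blast
  with z show "\<exists>y\<in>X \<times> UNIV. ([y, z], []) \<in> word_cong (X \<times> UNIV) (free_group_rels X)"
    by (blast intro: word_cong.rel)
qed

lemma group_amalgamated_product:
  assumes "group A" "group B" "i \<in> carrier C \<rightarrow> carrier A" "j \<in> carrier C \<rightarrow> carrier B"
  shows "group (amalgamated_product C A B i j)"
  unfolding amalgamated_product_def
proof (rule group_presented_monoid)
  interpret A: group A by fact
  interpret B: group B by fact
  let ?X = "carrier A <+> carrier B"
  show "amalgam_rels C A B i j \<subseteq> lists ?X \<times> lists ?X"
    using assms(3,4) by (auto simp: amalgam_rels_def)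
  fix z assume "z \<in> ?X"
  then consider a where "z = Inl a" "a \<in> carrier A" | b where "z = Inr b" "b \<in> carrier B"
    by auto
  then show "\<exists>y\<in>?X. ([y, z], []) \<in> word_cong ?X (amalgam_rels C A B i j)"
  proof cases
    case 1
    have "([Inl (inv\<^bsub>A\<^esub> a), Inl a], [Inl (inv\<^bsub>A\<^esub> a \<otimes>\<^bsub>A\<^esub> a)]) \<in> amalgam_rels C A B i j"
      using 1 unfolding amalgam_rels_def by blast
    moreover have "([Inl \<one>\<^bsub>A\<^esub>], []) \<in> amalgam_rels C A B i j"
      by (simp add: amalgam_rels_def)
    ultimately show ?thesis
      using 1 by (intro bexI[of _ "Inl (inv\<^bsub>A\<^esub> a)"])
        (auto intro: word_cong.trans word_cong.rel)
  next
    case 2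
    have "([Inr (inv\<^bsub>B\<^esub> b), Inr b], [Inr (inv\<^bsub>B\<^esub> b \<otimes>\<^bsub>B\<^esub> b)]) \<in> amalgam_rels C A B i j"
      using 2 unfolding amalgam_rels_def by blast
    moreover have "([Inr \<one>\<^bsub>B\<^esub>], []) \<in> amalgam_rels C A B i j"
      by (simp add: amalgam_rels_def)
    ultimately show ?thesis
      using 2 by (intro bexI[of _ "Inr (inv\<^bsub>B\<^esub> b)"])
        (auto intro: word_cong.trans word_cong.rel)
  qed
qed

lemma group_cyclic_amalgam:
  assumes "group A" "group B" "a \<in> carrier A" "b \<in> carrier B"
  shows "group (cyclic_amalgam A a B b)"
  unfolding cyclic_amalgam_def
  using assms by (intro group_amalgamated_product) (auto intro: group.int_pow_closed)

section \<open>Homeomorphisms of the real line and representations\<close>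

definition homeo_plus :: "(real \<Rightarrow> real) monoid" where
  "homeo_plus =
     \<lparr>carrier = {f. (\<exists>g. homeomorphism UNIV UNIV f g) \<and> strict_mono f},
      monoid.mult = (\<circ>), one = id\<rparr>"

definition homeo_plus_topology :: "(real \<Rightarrow> real) topology" where
  "homeo_plus_topology =
     topology_generated_by {{f \<in> carrier homeo_plus. f ` K \<subseteq> U} | K U. compact K \<and> open U}"

text \<open>Representations are taken extensional (\<open>undefined\<close> off \<open>carrier G\<close>), so that they are
  points of the product space whose topology is that of pointwise convergence.\<close>

definition Rep :: "('g, 'm) monoid_scheme \<Rightarrow> ('g \<Rightarrow> real \<Rightarrow> real) set" where
  "Rep G = hom G homeo_plus \<inter> extensional (carrier G)"

definition Rep_topology :: "('g, 'm) monoid_scheme \<Rightarrow> ('g \<Rightarrow> real \<Rightarrow> real) topology" where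
  "Rep_topology G = subtopology (product_topology (\<lambda>_. homeo_plus_topology) (carrier G)) (Rep G)"

definition global_fixed_point ::
    "('g, 'm) monoid_scheme \<Rightarrow> ('g \<Rightarrow> real \<Rightarrow> real) \<Rightarrow> real \<Rightarrow> bool" where
  "global_fixed_point G \<rho> x \<longleftrightarrow> (\<forall>g\<in>carrier G. \<rho> g x = x)"

definition Rep_sharp :: "('g, 'm) monoid_scheme \<Rightarrow> ('g \<Rightarrow> real \<Rightarrow> real) set" where
  "Rep_sharp G = {\<rho> \<in> Rep G. \<nexists>x. global_fixed_point G \<rho> x}"

definition proper_map_real :: "(real \<Rightarrow> real) \<Rightarrow> bool" where
  "proper_map_real c \<longleftrightarrow> (\<forall>K. compact K \<longrightarrow> bounded (c -` K))"

definition semi_conjugated ::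
    "('g, 'm) monoid_scheme \<Rightarrow> ('g \<Rightarrow> real \<Rightarrow> real) \<Rightarrow> ('g \<Rightarrow> real \<Rightarrow> real) \<Rightarrow> bool" where
  "semi_conjugated G \<rho>1 \<rho>2 \<longleftrightarrow>
     (\<exists>c. mono c \<and> proper_map_real c \<and> (\<forall>g\<in>carrier G. c \<circ> \<rho>1 g = \<rho>2 g \<circ> c))"

definition locally_rigid :: "('g, 'm) monoid_scheme \<Rightarrow> ('g \<Rightarrow> real \<Rightarrow> real) \<Rightarrow> bool" where
  "locally_rigid G \<rho> \<longleftrightarrow>
     (\<exists>U. openin (Rep_topology G) U \<and> \<rho> \<in> U \<and> (\<forall>\<rho>'\<in>U \<inter> Rep_sharp G. semi_conjugated G \<rho>' \<rho>))"

definition flexible :: "('g, 'm) monoid_scheme \<Rightarrow> ('g \<Rightarrow> real \<Rightarrow> real) \<Rightarrow> bool" where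
  "flexible G \<rho> \<longleftrightarrow> \<rho> \<in> Rep_sharp G \<and> \<not> locally_rigid G \<rho>"

lemma group_homeo_plus: "group homeo_plus"
proof (rule groupI)
  fix f assume "f \<in> carrier homeo_plus"
  then obtain g where g: "homeomorphism UNIV UNIV f g" and f: "strict_mono f"
    by (auto simp: homeo_plus_def)
  have fg: "f (g x) = x" "g (f x) = x" for x
    using g by (auto simp: homeomorphism_def)
  have "strict_mono g"
    by (rule strict_monoI) (metis f fg(1) strict_mono_less)
  with g have "g \<in> carrier homeo_plus"
    by (auto simp: homeo_plus_def dest: homeomorphism_symD)
  moreover have "g \<otimes>\<^bsub>homeo_plus\<^esub> f = \<one>\<^bsub>homeo_plus\<^esub>"
    using fg by (simp add: homeo_plus_def fun_eq_iff)
  ultimately show "\<exists>h\<in>carrier homeo_plus. h \<otimes>\<^bsub>homeo_plus\<^esub> f = \<one>\<^bsub>homeo_plus\<^esub>"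
    by blast
next
  fix f g assume "f \<in> carrier homeo_plus" "g \<in> carrier homeo_plus"
  then obtain f' g' where *: "homeomorphism UNIV UNIV f f'" "homeomorphism UNIV UNIV g g'"
    "strict_mono f" "strict_mono g"
    by (auto simp: homeo_plus_def)
  have "\<exists>h. homeomorphism UNIV UNIV (f \<circ> g) h"
    using homeomorphism_compose[OF *(2,1)] by blast
  moreover have "strict_mono (f \<circ> g)"
    using * by (simp add: strict_mono_def)
  ultimately show "f \<otimes>\<^bsub>homeo_plus\<^esub> g \<in> carrier homeo_plus"
    by (simp add: homeo_plus_def)
next
  have "homeomorphism UNIV UNIV id (id :: real \<Rightarrow> real)"
    by (simp add: homeomorphism_def)
  then show "\<one>\<^bsub>homeo_plus\<^esub> \<in> carrier homeo_plus"
    by (auto simp: homeo_plus_def strict_mono_def)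
qed (simp_all add: homeo_plus_def o_assoc)

lemma topspace_homeo_plus_topology: "topspace homeo_plus_topology = carrier homeo_plus"
  unfolding homeo_plus_topology_def topology_generated_by_topspace by blast

lemma topspace_Rep_topology: "topspace (Rep_topology G) = Rep G"
  unfolding Rep_topology_def
  by (auto simp: topspace_homeo_plus_topology Rep_def hom_def PiE_def)

end

theory Submission
  imports Defs
begin

text \<open>
  A representation of the amalgam consists of two families of homeomorphisms, the images \<open>a\<close> and \<open>b\<close> of
  bases of the two free groups, subject to the single condition that the words \<open>w1\<close> and \<open>w2\<close> have the
  same value \<open>f\<close> in them. The proof rests on an invariant and on the freedom in choosing families.

  The invariant is the direction in which an element moves the points near \<open>+\<infinity>\<close>. If it moves all points
  far to the right upward in one representation, then it does so in every representation to which the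
  first is semi-conjugated, and likewise for downward (\<open>moves_end_semiconjugate\<close>). Therefore a
  representation is flexible if it can be approximated, without global fixed points, by
  representations in which one and the same element moves the end upward and downward,
  respectively. Since convergence is uniform on compact sets, it is enough to find such perturbations
  that agree with the given families on a prescribed compact interval (\<open>perturbations_exist\<close>).

  On a side with at least two generators, the family can be redesigned beyond some point: one
  generator is made fixed point free there, which rules out global fixed points, and another one
  becomes a translation up or down (\<open>perturb_pair\<close>). This changes \<open>f\<close> beyond some point \<open>p\<close>, and the
  other family has to be extended beyond \<open>p\<close> so that its word takes the new value
  (\<open>word_extension\<close>). After a change of basis its word is cyclically reduced (\<open>adapted_basis\<close>). If the
  word moves \<open>p\<close>, say upward, then the trajectory of \<open>p\<close> under endless repetition of the word leaves the
  part of the line where the family is already fixed; from there on consecutive letters do not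
  cancel, so that the trajectory can be made to climb to infinity (\<open>escaping_path\<close>). The value of
  the word then has no fixed point above \<open>p\<close>, and any two maps with this property that agree up to \<open>p\<close>
  are conjugate by a map that is the identity up to \<open>p\<close>. This produces the desired value as far as its
  next fixed point, and beyond a fixed point any homeomorphism is a value of the word
  (\<open>word_realization\<close>). The extension is equally possible if all generators of the other
  side fix \<open>p\<close>.

  It remains to choose the side and a suitable \<open>p\<close> far to the right, where \<open>p\<close> must not be fixed by the
  whole family that is redesigned. If \<open>f\<close> is not the identity near the end, a point moved by \<open>f\<close> is
  suitable. If the second family is trivial near the end, every point is suitable, as there are no
  global fixed points. If \<open>f\<close> is the identity near the end, but the second family is not trivial there, then the second side has at least two generators and is the one to be redesigned;
  a common fixed point of the first family is suitable, and one can be created by conjugating that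
  family into a half-line.
\<close>

section \<open>Increasing bijections of the line\<close>

text \<open>Orientation-preserving homeomorphisms in the form in which they are built below: an
  increasing bijection of the line is continuous in both directions (\<open>carrier_homeo_plus\<close>).\<close>

definition incr_homeo :: "(real \<Rightarrow> real) \<Rightarrow> bool" where
  "incr_homeo f \<longleftrightarrow> strict_mono f \<and> (\<forall>y. \<exists>x. f x = y)"

lemma incr_homeoI: "strict_mono f \<Longrightarrow> (\<And>y. \<exists>x. f x = y) \<Longrightarrow> incr_homeo f"
  by (simp add: incr_homeo_def)

lemma incr_homeo_surj: "incr_homeo f \<Longrightarrow> surj f"
  unfolding incr_homeo_def by (metis surj_def)

lemma incr_homeo_strict_mono: "incr_homeo f \<Longrightarrow> strict_mono f"
  by (simp add: incr_homeo_def)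

text \<open>The inverse as a map; the symbol \<open>inv\<close> stands for inverses in a group.\<close>

abbreviation finv :: "(real \<Rightarrow> real) \<Rightarrow> real \<Rightarrow> real" where
  "finv f \<equiv> inv_into UNIV f"

lemma incr_homeo_less: "incr_homeo f \<Longrightarrow> f x < f y \<longleftrightarrow> x < y"
  by (simp add: incr_homeo_def strict_mono_less)

lemma incr_homeo_le: "incr_homeo f \<Longrightarrow> f x \<le> f y \<longleftrightarrow> x \<le> y"
  by (simp add: incr_homeo_def strict_mono_less_eq)

lemma incr_homeo_eq: "incr_homeo f \<Longrightarrow> f x = f y \<longleftrightarrow> x = y"
  by (simp add: incr_homeo_def strict_mono_eq)

lemma incr_homeo_inv_inv: "incr_homeo f \<Longrightarrow> f (finv f y) = y" "incr_homeo f \<Longrightarrow> finv f (f x) = x"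
  by (auto simp: incr_homeo_surj surj_f_inv_f intro!: inv_f_f strict_mono_imp_inj_on incr_homeo_strict_mono)

lemma incr_homeo_inv_le:
  assumes "incr_homeo f"
  shows "finv f y \<le> x \<longleftrightarrow> y \<le> f x" "x \<le> finv f y \<longleftrightarrow> f x \<le> y"
    "finv f y < x \<longleftrightarrow> y < f x" "x < finv f y \<longleftrightarrow> f x < y"
    "finv f y = x \<longleftrightarrow> y = f x" "x = finv f y \<longleftrightarrow> f x = y"
  using incr_homeo_le[OF assms, of "finv f y" x] incr_homeo_le[OF assms, of x "finv f y"]
    incr_homeo_less[OF assms, of "finv f y" x] incr_homeo_less[OF assms, of x "finv f y"]
    incr_homeo_eq[OF assms, of "finv f y" x] assms
  by (auto simp: incr_homeo_inv_inv)

lemma incr_homeo_inv: assumes "incr_homeo f" shows "incr_homeo (finv f)"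
proof -
  have "strict_mono (finv f)"
    by (rule strict_monoI) (simp add: incr_homeo_inv_le incr_homeo_inv_inv assms)
  then show ?thesis
  proof (rule incr_homeoI)
    show "\<exists>x. finv f x = y" for y using assms by (intro exI[of _ "f y"]) (rule incr_homeo_inv_inv)
  qed
qed

lemma incr_homeo_comp: "incr_homeo f \<Longrightarrow> incr_homeo g \<Longrightarrow> incr_homeo (f \<circ> g)"
  unfolding incr_homeo_def comp_def strict_mono_def by metis

lemma incr_homeo_id: "incr_homeo id"
  by (simp add: incr_homeo_def strict_mono_def)

lemma incr_homeo_continuous: assumes "incr_homeo f" shows "continuous_on UNIV f"
proof (rule continuous_onI_mono)
  show "open (f ` UNIV)" using assms by (simp add: incr_homeo_surj)
qed (use assms in \<open>simp add: incr_homeo_le\<close>)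

lemma carrier_homeo_plus: "carrier homeo_plus = Collect incr_homeo"
proof (intro equalityI subsetI)
  fix f assume "f \<in> carrier homeo_plus"
  then show "f \<in> Collect incr_homeo"
    by (auto simp: homeo_plus_def homeomorphism_def intro!: incr_homeoI)
next
  fix f :: "real \<Rightarrow> real" assume "f \<in> Collect incr_homeo"
  then have f: "incr_homeo f" by simp
  have "homeomorphism UNIV UNIV f (finv f)"
    using f incr_homeo_continuous[OF f] incr_homeo_continuous[OF incr_homeo_inv[OF f]]
      incr_homeo_inv[OF f]
    by (auto simp: homeomorphism_def incr_homeo_inv_inv incr_homeo_surj)
  then show "f \<in> carrier homeo_plus"
    using f by (auto simp: homeo_plus_def incr_homeo_strict_mono)
qed

lemma homeo_plus_simps [simp]:
  "f \<otimes>\<^bsub>homeo_plus\<^esub> g = f \<circ> g" "\<one>\<^bsub>homeo_plus\<^esub> = id"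
  by (simp_all add: homeo_plus_def)

lemma incr_homeo_glue:
  assumes f: "incr_homeo f" and g: "incr_homeo g" and pq: "p < q" and fg: "f p < g q"
  shows "\<exists>h. incr_homeo h \<and> (\<forall>x\<le>p. h x = f x) \<and> (\<forall>x\<ge>q. h x = g x)"
proof -
  define k where "k = (g q - f p) / (q - p)"
  define l where "l x = f p + (x - p) * k" for x
  define h where "h x = (if x \<le> p then f x else if x \<ge> q then g x else l x)" for x
  have slope: "k > 0" using pq fg by (simp add: k_def)
  have l: "l x < l y" if "x < y" for x y
    using mult_strict_right_mono[of "x - p" "y - p", OF _ slope] that by (simp add: l_def)
  have lp: "l p = f p" "l q = g q" using pq by (simp_all add: l_def k_def)
  have fm: "f x < f y" if "x < y" for x y using f that by (simp add: incr_homeo_less)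
  have gm: "g x < g y" if "x < y" for x y using g that by (simp add: incr_homeo_less)
  have fm': "f x \<le> f y" if "x \<le> y" for x y using f that by (simp add: incr_homeo_le)
  have gm': "g x \<le> g y" if "x \<le> y" for x y using g that by (simp add: incr_homeo_le)
  have "strict_mono h"
  proof (rule strict_monoI)
    fix x y :: real assume xy: "x < y"
    show "h x < h y"
    proof (cases "x \<le> p")
      case True
      then have "h x \<le> f p" by (simp add: h_def fm')
      moreover have "h y = f y" if "y \<le> p" using that by (simp add: h_def)
      moreover have "h y > f p" if "y > p"
        using that l[of p y] lp fg gm'[of q y] by (auto simp: h_def)
      moreover have "h x = f x" using True by (simp add: h_def)
      ultimately show ?thesis using fm[OF xy] by (cases "y \<le> p") auto
    next
      case xp: False
      show ?thesis
      proof (cases "x \<ge> q")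
        case True
        then show ?thesis using xp xy gm[OF xy] by (simp add: h_def)
      next
        case False
        then have "h x = l x" "l x < g q" using xp l[of x q] lp by (auto simp: h_def)
        then show ?thesis using xp xy l[OF xy] gm'[of q y] by (auto simp: h_def)
      qed
    qed
  qed
  moreover have "\<exists>x. h x = y" for y
  proof -
    consider "y \<le> f p" | "y \<ge> g q" | "f p < y" "y < g q" by linarith
    then show ?thesis
    proof cases
      case 1
      then have "finv f y \<le> p" using f by (simp add: incr_homeo_inv_le)
      then show ?thesis using f by (intro exI[of _ "finv f y"]) (simp add: h_def incr_homeo_inv_inv)
    next
      case 2
      then have "finv g y \<ge> q" using g by (simp add: incr_homeo_inv_le)
      then show ?thesis using g pq by (intro exI[of _ "finv g y"]) (simp add: h_def incr_homeo_inv_inv)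
    next
      case 3
      define x where "x = p + (y - f p) / k"
      have lx: "l x = y" using slope by (simp add: l_def x_def)
      have "p < x" using 3 slope by (simp add: x_def)
      moreover have "x < q" using l[of q x] lp lx 3 by (cases x q rule: linorder_cases) auto
      ultimately show ?thesis using lx by (intro exI[of _ x]) (simp add: h_def)
    qed
  qed
  ultimately have "incr_homeo h" by (rule incr_homeoI)
  moreover have "\<forall>x\<le>p. h x = f x" "\<forall>x\<ge>q. h x = g x"
    using pq by (auto simp: h_def)
  ultimately show ?thesis by blast
qed

lemma incr_homeo_glue_at:
  assumes f: "incr_homeo f" and g: "incr_homeo g" and fg: "f p = g p"
  shows "incr_homeo (\<lambda>x. if x \<le> p then f x else g x)"
proof -
  have "strict_mono (\<lambda>x. if x \<le> p then f x else g x)"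
  proof (rule strict_monoI)
    fix x y :: real assume "x < y"
    moreover have "f x \<le> f p" if "x \<le> p" using that f by (simp add: incr_homeo_le)
    moreover have "g p < g y" if "\<not> y \<le> p" using that g by (simp add: incr_homeo_less)
    ultimately show "(if x \<le> p then f x else g x) < (if y \<le> p then f y else g y)"
      using f g fg by (cases "x \<le> p"; cases "y \<le> p") (auto simp: incr_homeo_less intro: le_less_trans)
  qed
  moreover have "\<exists>x. (if x \<le> p then f x else g x) = y" for y
  proof (cases "y \<le> f p")
    case True
    then have "finv f y \<le> p" using f by (simp add: incr_homeo_inv_le)
    then show ?thesis using f by (intro exI[of _ "finv f y"]) (simp add: incr_homeo_inv_inv)
  next
    case False
    then have "finv g y > p" using g fg by (simp add: incr_homeo_inv_le)
    then show ?thesis using g by (intro exI[of _ "finv g y"]) (simp add: incr_homeo_inv_inv)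
  qed
  ultimately show ?thesis by (rule incr_homeoI)
qed

lemma incr_homeo_translation: "incr_homeo (\<lambda>x. x + t)"
proof (rule incr_homeoI)
  show "\<exists>x. x + t = y" for y by (rule exI[of _ "y - t"]) simp
qed (simp add: strict_mono_def)

section \<open>Words acting on the line\<close>

definition letter_map :: "('i \<Rightarrow> real \<Rightarrow> real) \<Rightarrow> 'i \<times> bool \<Rightarrow> real \<Rightarrow> real" where
  "letter_map c l = (if snd l then c (fst l) else finv (c (fst l)))"

text \<open>The last letter of a word acts first.\<close>

primrec word_map :: "('i \<Rightarrow> real \<Rightarrow> real) \<Rightarrow> ('i \<times> bool) list \<Rightarrow> real \<Rightarrow> real" where
  "word_map c [] = id"
| "word_map c (l # w) = letter_map c l \<circ> word_map c w"

definition flip :: "'i \<times> bool \<Rightarrow> 'i \<times> bool" where "flip l = (fst l, \<not> snd l)"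

definition inv_word :: "('i \<times> bool) list \<Rightarrow> ('i \<times> bool) list" where
  "inv_word w = rev (map flip w)"

lemma flip_flip [simp]: "flip (flip l) = l"
  by (simp add: flip_def)

lemma letter_map_simps [simp]:
  "letter_map c (j, True) = c j" "letter_map c (j, False) = finv (c j)"
  by (simp_all add: letter_map_def)

lemma word_map_append: "word_map c (u @ v) = word_map c u \<circ> word_map c v"
  by (induction u) (auto simp: comp_assoc)

locale homeo_family =
  fixes c :: "'i \<Rightarrow> real \<Rightarrow> real"
  assumes homeo: "incr_homeo (c j)"
begin

lemma letter: "incr_homeo (letter_map c l)"
  using homeo by (simp add: letter_map_def incr_homeo_inv)

lemma word: "incr_homeo (word_map c w)"
  by (induction w) (simp_all only: word_map.simps letter incr_homeo_comp incr_homeo_id)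

lemma letter_flip: "letter_map c (flip l) (letter_map c l x) = x"
  using homeo by (simp add: letter_map_def flip_def incr_homeo_inv_inv)

lemma word_inv: "word_map c (inv_word w) (word_map c w x) = x"
  by (induction w arbitrary: x) (auto simp: inv_word_def word_map_append letter_flip)

lemma inv_word_map: "word_map c (inv_word w) = finv (word_map c w)"
proof
  fix x
  have "word_map c (inv_word w) (word_map c w (finv (word_map c w) x)) = finv (word_map c w) x"
    by (rule word_inv)
  then show "word_map c (inv_word w) x = finv (word_map c w) x"
    by (simp add: incr_homeo_inv_inv(1)[OF word])
qed

lemma letter_eq_iff: "letter_map c l x = y \<longleftrightarrow> (if snd l then c (fst l) x = y else c (fst l) y = x)"
  using homeo by (auto simp: letter_map_def incr_homeo_inv_inv)

lemma word_fixed: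
  assumes "\<And>j b. (j, b) \<in> set w \<Longrightarrow> c j x = x" shows "word_map c w x = x"
  using assms
proof (induction w)
  case (Cons l w)
  then have "letter_map c l x = x" by (cases l) (auto simp: letter_eq_iff)
  moreover have "word_map c w x = x" using Cons.prems by (intro Cons.IH) (metis list.set_intros(2))
  ultimately show ?case by simp
qed simp

end

text \<open>The map \<open>h\<close> need not be onto: \<open>d\<close> is then a copy of \<open>c\<close> on an invariant interval.\<close>

lemma word_map_equivariant:
  assumes "homeo_family c" "homeo_family d" and eq: "\<And>j x. (j \<in> fst ` set w) \<Longrightarrow> d j (h x) = h (c j x)"
  shows "word_map d w (h x) = h (word_map c w x)"
  using eq
proof (induction w arbitrary: x)
  case (Cons l w)
  interpret c: homeo_family c by fact
  interpret d: homeo_family d by fact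
  have "letter_map d l (h y) = h (letter_map c l y)" for y
    unfolding d.letter_eq_iff using Cons.prems[of "fst l"] c.homeo
    by (auto simp: letter_map_def incr_homeo_inv_inv)
  with Cons show ?case by simp
qed simp

lemma word_map_conjugate:
  assumes "homeo_family c" "incr_homeo h"
  shows "homeo_family (\<lambda>j. finv h \<circ> c j \<circ> h)"
    and "word_map (\<lambda>j. finv h \<circ> c j \<circ> h) w = finv h \<circ> word_map c w \<circ> h"
proof -
  interpret c: homeo_family c by fact
  show *: "homeo_family (\<lambda>j. finv h \<circ> c j \<circ> h)"
    by standard (intro incr_homeo_comp incr_homeo_inv c.homeo assms)
  have "h (word_map (\<lambda>j. finv h \<circ> c j \<circ> h) w x) = word_map c w (h x)" for x
    using assms by (intro word_map_equivariant[symmetric] *) (simp_all add: incr_homeo_inv_inv)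
  then show "word_map (\<lambda>j. finv h \<circ> c j \<circ> h) w = finv h \<circ> word_map c w \<circ> h"
    using assms by (auto simp: fun_eq_iff incr_homeo_inv_le)
qed

text \<open>Every step of the trajectory of \<open>x\<close> leads from a point below \<open>Q\<close> to a point below \<open>Q\<close>, so
  it uses a generator (or the inverse of one) only where both argument and value are below \<open>Q\<close>.\<close>

lemma word_map_cong_below:
  assumes c: "homeo_family c" and d: "homeo_family d"
    and agree: "\<And>j x. x \<le> Q \<Longrightarrow> c j x \<le> Q \<Longrightarrow> d j x = c j x"
    and traj: "\<And>i. i \<le> length w \<Longrightarrow> word_map c (drop i w) x \<le> Q"
  shows "word_map d w x = word_map c w x"
  using traj
proof (induction w)
  case (Cons l w)
  interpret c: homeo_family c by fact
  interpret d: homeo_family d by fact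
  have "word_map d w x = word_map c w x"
    using Cons.prems[of "Suc _"] by (intro Cons.IH) fastforce
  moreover have "letter_map d l (word_map c w x) = letter_map c l (word_map c w x)"
  proof -
    have 1: "word_map c w x \<le> Q" using Cons.prems[of 1] by simp
    have 2: "letter_map c l (word_map c w x) \<le> Q" using Cons.prems[of 0] by simp
    show ?thesis
      unfolding d.letter_eq_iff using 1 2 agree c.homeo[of "fst l"]
      by (auto simp: letter_map_def incr_homeo_inv_inv)
  qed
  ultimately show ?case by simp
qed simp


section \<open>Charts of the moved intervals\<close>

text \<open>Piecewise linear maps and equivariant charts are both of this form: pieces over the unit
  intervals, of which only the values \<open>u\<close> at the integers have to fit together.\<close>

lemma staircase:
  fixes u :: "int \<Rightarrow> real" and G :: "int \<Rightarrow> real \<Rightarrow> real"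
  assumes mono: "\<And>i s t. 0 \<le> s \<Longrightarrow> s < t \<Longrightarrow> t < 1 \<Longrightarrow> G i s < G i t"
    and bounds: "\<And>i t. 0 \<le> t \<Longrightarrow> t < 1 \<Longrightarrow> u i \<le> G i t \<and> G i t < u (i + 1)"
    and onto: "\<And>i y. u i \<le> y \<Longrightarrow> y < u (i + 1) \<Longrightarrow> \<exists>t. 0 \<le> t \<and> t < 1 \<and> G i t = y"
  shows "strict_mono (\<lambda>x. G \<lfloor>x\<rfloor> (frac x))"
    and "range (\<lambda>x. G \<lfloor>x\<rfloor> (frac x)) = {y. (\<exists>i. u i \<le> y) \<and> (\<exists>j. y < u j)}"
proof -
  have bnd: "u \<lfloor>x\<rfloor> \<le> G \<lfloor>x\<rfloor> (frac x)" "G \<lfloor>x\<rfloor> (frac x) < u (\<lfloor>x\<rfloor> + 1)" for x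
    using bounds[of "frac x" "\<lfloor>x\<rfloor>"] by (simp_all add: frac_lt_1)
  have step: "u i \<le> u (i + 1)" for i using bounds[of 0 i] by linarith
  have u: "u i \<le> u j" if "i \<le> j" for i j
    using that by (induction j rule: int_ge_induct) (auto intro: order_trans step)
  show "strict_mono (\<lambda>x. G \<lfloor>x\<rfloor> (frac x))"
  proof (rule strict_monoI)
    fix x y :: real assume xy: "x < y"
    show "G \<lfloor>x\<rfloor> (frac x) < G \<lfloor>y\<rfloor> (frac y)"
    proof (cases "\<lfloor>x\<rfloor> = \<lfloor>y\<rfloor>")
      case True
      then have "frac x < frac y" using xy by (simp add: frac_def)
      then show ?thesis using True mono[of "frac x" "frac y"] by (simp add: frac_lt_1)
    next
      case False
      then have "\<lfloor>x\<rfloor> + 1 \<le> \<lfloor>y\<rfloor>" using floor_mono[of x y] xy by linarith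
      then show ?thesis using bnd(2)[of x] bnd(1)[of y] u by (meson le_less_trans less_le_trans)
    qed
  qed
  show "range (\<lambda>x. G \<lfloor>x\<rfloor> (frac x)) = {y. (\<exists>i. u i \<le> y) \<and> (\<exists>j. y < u j)}"
  proof (intro equalityI subsetI)
    fix y assume "y \<in> range (\<lambda>x. G \<lfloor>x\<rfloor> (frac x))"
    then show "y \<in> {y. (\<exists>i. u i \<le> y) \<and> (\<exists>j. y < u j)}" using bnd by auto
  next
    fix y assume "y \<in> {y. (\<exists>i. u i \<le> y) \<and> (\<exists>j. y < u j)}"
    then obtain i j where ij: "u i \<le> y" "y < u j" by auto
    then have "i \<le> j" using u[of j i] by linarith
    then have "\<exists>k. u k \<le> y \<and> y < u (k + 1)"
      using ij(2)
    proof (induction j rule: int_ge_induct)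
      case base
      then show ?case using ij(1) by linarith
    next
      case (step j)
      then show ?case by (cases "y < u j") (auto intro: exI[of _ j])
    qed
    then obtain k where "u k \<le> y" "y < u (k + 1)" by auto
    with onto obtain t where t: "0 \<le> t" "t < 1" "G k t = y" by blast
    have "\<lfloor>of_int k + t\<rfloor> = k" using t by linarith
    then have "frac (of_int k + t) = t" by (simp add: frac_def)
    with t \<open>\<lfloor>of_int k + t\<rfloor> = k\<close> have "G \<lfloor>of_int k + t\<rfloor> (frac (of_int k + t)) = y" by simp
    then show "y \<in> range (\<lambda>x. G \<lfloor>x\<rfloor> (frac x))" by blast
  qed
qed

abbreviation iter :: "(real \<Rightarrow> real) \<Rightarrow> int \<Rightarrow> real \<Rightarrow> real" where
  "iter f i \<equiv> f [^]\<^bsub>homeo_plus\<^esub> i"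

context
  fixes f assumes f: "incr_homeo f"
begin

interpretation H: group homeo_plus by (rule group_homeo_plus)

lemma in_homeo_plus: "f \<in> carrier homeo_plus"
  using f by (simp add: carrier_homeo_plus)

lemma iter_0: "iter f 0 x = x"
  by (simp add: homeo_plus_simps)

lemma iter_1: "iter f 1 x = f x"
  using in_homeo_plus by (simp add: H.int_pow_1)

lemma iter_add: "iter f (i + j) x = iter f i (iter f j x)"
  using H.int_pow_mult[OF in_homeo_plus, of i j] by (simp add: homeo_plus_simps)

lemma iter_Suc: "iter f (i + 1) x = f (iter f i x)"
  using iter_add[of 1 i] by (simp add: iter_1 add.commute)

lemma incr_homeo_iter: "incr_homeo (iter f i)"
  using H.int_pow_closed[OF in_homeo_plus, of i] by (simp add: carrier_homeo_plus)

lemma iter_inverse: "iter (finv f) i x = iter f (- i) x"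
proof -
  have "finv f \<in> carrier homeo_plus" using incr_homeo_inv[OF f] by (simp add: carrier_homeo_plus)
  moreover have "finv f \<otimes>\<^bsub>homeo_plus\<^esub> f = \<one>\<^bsub>homeo_plus\<^esub>"
    using f by (simp add: homeo_plus_simps fun_eq_iff incr_homeo_inv_inv)
  ultimately have "finv f = inv\<^bsub>homeo_plus\<^esub> f"
    using in_homeo_plus by (simp add: H.inv_equality)
  then show ?thesis using in_homeo_plus by (simp add: H.int_pow_inv H.int_pow_neg)
qed

lemma iter_fixed: assumes "f x = x" shows "iter f i x = x"
proof -
  have pos: "iter f (int n) x = x" for n
    by (induction n) (simp_all add: iter_0 iter_Suc assms add.commute[of 1])
  show ?thesis
  proof (cases "i \<ge> 0")
    case True
    then show ?thesis using pos[of "nat i"] by simp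
  next
    case False
    have "iter f (i + int (nat (- i))) x = iter f i x" using pos[of "nat (- i)"] by (simp only: iter_add)
    then show ?thesis using False by (simp add: iter_0)
  qed
qed

text \<open>The supremum of the orbit is fixed, because \<open>f\<close> permutes the orbit.\<close>

lemma fixed_point_above_orbit:
  assumes "\<And>i. iter f i c \<le> y" shows "\<exists>t. c \<le> t \<and> t \<le> y \<and> f t = t"
proof -
  define L where "L = Sup (range (\<lambda>i. iter f i c))"
  have bdd: "bdd_above (range (\<lambda>i. iter f i c))" by (rule bdd_aboveI[of _ y]) (use assms in auto)
  have ub: "iter f i c \<le> L" for i unfolding L_def by (rule cSUP_upper[OF UNIV_I bdd])
  have lub: "L \<le> z" if "\<And>i. iter f i c \<le> z" for z
    unfolding L_def using that by (auto intro: cSUP_least)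
  have "L \<le> f L"
  proof (rule lub)
    fix i
    have "iter f i c = f (iter f (i - 1) c)" using iter_Suc[of "i - 1"] by simp
    then show "iter f i c \<le> f L" using ub f by (simp add: incr_homeo_le)
  qed
  moreover have "L \<le> finv f L"
    by (rule lub) (use ub iter_Suc in \<open>simp add: incr_homeo_inv_le[OF f] flip: iter_Suc\<close>)
  ultimately have "f L = L" using incr_homeo_inv_le(2)[OF f, of L L] by simp
  moreover have "c \<le> L" using ub[of 0] by (simp add: iter_0)
  ultimately show ?thesis using lub assms by blast
qed

lemma fixed_point_below_orbit:
  assumes "\<And>i. y \<le> iter f i c" shows "\<exists>t. y \<le> t \<and> t \<le> c \<and> f t = t"
proof -
  define L where "L = Inf (range (\<lambda>i. iter f i c))"
  have bdd: "bdd_below (range (\<lambda>i. iter f i c))" by (rule bdd_belowI[of _ y]) (use assms in auto)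
  have lb: "L \<le> iter f i c" for i unfolding L_def by (rule cINF_lower[OF bdd UNIV_I])
  have glb: "z \<le> L" if "\<And>i. z \<le> iter f i c" for z
    unfolding L_def using that by (auto intro: cINF_greatest)
  have "f L \<le> L"
  proof (rule glb)
    fix i
    have "iter f i c = f (iter f (i - 1) c)" using iter_Suc[of "i - 1"] by simp
    then show "f L \<le> iter f i c" using lb f by (simp add: incr_homeo_le)
  qed
  moreover have "finv f L \<le> L"
    by (rule glb) (use lb iter_Suc in \<open>simp add: incr_homeo_inv_le[OF f] flip: iter_Suc\<close>)
  ultimately have "f L = L" using incr_homeo_inv_le(1)[OF f, of L L] by simp
  moreover have "L \<le> c" using lb[of 0] by (simp add: iter_0)
  ultimately show ?thesis using glb assms by blast
qed

end

text \<open>For a moved point \<open>c\<close> this is the component of \<open>c\<close> in the set of points moved by \<open>f\<close>; for a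
  fixed point it is \<open>{c}\<close>.\<close>

definition orbit_hull :: "(real \<Rightarrow> real) \<Rightarrow> real \<Rightarrow> real set" where
  "orbit_hull f c = {y. (\<exists>i. iter f i c \<le> y) \<and> (\<exists>j. y \<le> iter f j c)}"

text \<open>An inverse of an Abel function of \<open>f\<close>: it conjugates the unit translation to \<open>f\<close> on the hull
  of the orbit of \<open>c\<close>, and it maps \<open>[0, 1]\<close> affinely to the fundamental domain between \<open>c\<close> and \<open>f c\<close>.\<close>

definition abel :: "(real \<Rightarrow> real) \<Rightarrow> real \<Rightarrow> real \<Rightarrow> real" where
  "abel f c x = iter f \<lfloor>x\<rfloor> (c + frac x * (f c - c))"

lemma abel_Suc: "incr_homeo f \<Longrightarrow> abel f c (x + 1) = f (abel f c x)"
  by (simp add: abel_def iter_Suc frac_def)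

lemma abel_unit: assumes "incr_homeo f" "0 \<le> x" "x \<le> 1" shows "abel f c x = c + x * (f c - c)"
proof (cases "x = 1")
  case True
  then show ?thesis using assms by (simp add: abel_def iter_1)
next
  case False
  then have "\<lfloor>x\<rfloor> = 0" using assms by linarith
  then show ?thesis using assms by (simp add: abel_def iter_0 frac_def)
qed

lemma abel_chart:
  assumes f: "incr_homeo f" and c: "c < f c"
  shows "strict_mono (abel f c)" and "range (abel f c) = orbit_hull f c"
proof -
  let ?u = "\<lambda>i. iter f i c" and ?G = "\<lambda>i t. iter f i (c + t * (f c - c))"
  note mono = incr_homeo_less[OF incr_homeo_iter[OF f]] incr_homeo_le[OF incr_homeo_iter[OF f]]
  have G: "?G i s < ?G i t" if "s < t" for i s t
    using that c by (simp add: mono)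
  have bnd: "?u i \<le> ?G i t \<and> ?G i t < ?u (i + 1)" if "0 \<le> t" "t < 1" for i t
  proof -
    have "t * (f c - c) < 1 * (f c - c)" using that c by (intro mult_strict_right_mono) auto
    then have "t * (f c - c) < f c - c" by (simp only: mult_1)
    then have "c + t * (f c - c) < f c" by (simp only: less_diff_eq add.commute)
    then show ?thesis using that c by (simp add: mono iter_add[OF f, of i 1] iter_1[OF f])
  qed
  have onto: "\<exists>t. 0 \<le> t \<and> t < 1 \<and> ?G i t = y" if "?u i \<le> y" "y < ?u (i + 1)" for i y
  proof -
    define z where "z = iter f (- i) y"
    have y: "y = iter f i z" using iter_add[OF f, of i "- i" y] by (simp add: z_def iter_0[OF f])
    then have "c \<le> z" "z < f c" using that by (simp_all add: mono iter_add[OF f, of i 1] iter_1[OF f])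
    moreover have "(z - c) / (f c - c) * (f c - c) = z - c" using c by simp
    ultimately show ?thesis using c y by (intro exI[of _ "(z - c) / (f c - c)"]) simp
  qed
  have abel: "abel f c = (\<lambda>x. ?G \<lfloor>x\<rfloor> (frac x))" by (simp add: abel_def fun_eq_iff)
  show "strict_mono (abel f c)"
    unfolding abel by (rule staircase(1)[of ?G ?u]) (use G bnd onto in blast)+
  have "range (abel f c) = {y. (\<exists>i. ?u i \<le> y) \<and> (\<exists>j. y < ?u j)}"
    unfolding abel by (rule staircase(2)[of ?G ?u]) (use G bnd onto in blast)+
  also have "\<dots> = orbit_hull f c"
  proof -
    have "y < iter f (j + 1) c" if "y \<le> iter f j c" for y j
    proof -
      have "iter f j c < iter f (j + 1) c" using c by (simp add: mono iter_add[OF f, of j 1] iter_1[OF f])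
      with that show ?thesis by linarith
    qed
    then show ?thesis unfolding orbit_hull_def by (auto intro: less_imp_le)
  qed
  finally show "range (abel f c) = orbit_hull f c" .
qed

text \<open>If \<open>f\<close> moves \<open>c\<close> downward, the chart of the inverse of \<open>f\<close> is used with the line reversed.\<close>

lemma component_chart:
  assumes f: "incr_homeo f" and c: "f c \<noteq> c"
  shows "\<exists>h :: real \<Rightarrow> real. (strict_mono h \<or> strict_mono (\<lambda>x. h (- x))) \<and> range h = orbit_hull f c
    \<and> (\<forall>t. h (t + 1) = f (h t))"
proof (cases "c < f c")
  case True
  show ?thesis
    by (rule exI[of _ "abel f c"]) (simp add: abel_chart[OF f True] abel_Suc[OF f])
next
  case False
  let ?g = "finv f"
  have g: "incr_homeo ?g" using f by (rule incr_homeo_inv)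
  have "c < ?g c" using c False f by (simp add: incr_homeo_inv_le)
  note chart = abel_chart[OF g this]
  have "orbit_hull ?g c = orbit_hull f c"
    unfolding orbit_hull_def iter_inverse[OF f] by (auto, metis minus_minus, metis minus_minus)
  moreover have "range (\<lambda>t. abel ?g c (- t)) = range (abel ?g c)"
    by (auto simp: image_iff) (metis minus_minus)
  moreover have "abel ?g c (- (t + 1)) = f (abel ?g c (- t))" for t
  proof -
    have "abel ?g c (- t) = ?g (abel ?g c (- (t + 1)))"
      using abel_Suc[OF g, of c "- (t + 1)"] by simp
    then show ?thesis using incr_homeo_inv_inv(1)[OF f] by simp
  qed
  ultimately show ?thesis using chart by (intro exI[of _ "\<lambda>t. abel ?g c (- t)"]) (simp add: minus_minus)
qed

lemma orbit_hull_self: "incr_homeo f \<Longrightarrow> x \<in> orbit_hull f x"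
  by (auto simp: orbit_hull_def intro!: exI[of _ 0] simp: iter_0)

lemma orbit_hull_convex:
  "x \<in> orbit_hull f c \<Longrightarrow> y \<in> orbit_hull f c \<Longrightarrow> x \<le> z \<Longrightarrow> z \<le> y \<Longrightarrow> z \<in> orbit_hull f c"
  unfolding orbit_hull_def by (auto intro: order_trans)

lemma orbit_hull_eq:
  assumes f: "incr_homeo f" and y: "y \<in> orbit_hull f x" shows "orbit_hull f y = orbit_hull f x"
proof -
  note mono = incr_homeo_le[OF incr_homeo_iter[OF f]]
  from y obtain i j where ij: "iter f i x \<le> y" "y \<le> iter f j x" by (auto simp: orbit_hull_def)
  have 1: "iter f (k + i) x \<le> iter f k y" "iter f k y \<le> iter f (k + j) x" for k
    using ij by (simp_all add: iter_add[OF f] mono)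
  have 2: "iter f (k - j) y \<le> iter f k x" "iter f k x \<le> iter f (k - i) y" for k
    using 1[of "k - j"] 1[of "k - i"] by simp_all
  show ?thesis unfolding orbit_hull_def using 1 2 by (blast intro: order_trans)
qed

lemma orbit_hull_moved:
  assumes f: "incr_homeo f" and x: "f x \<noteq> x" and y: "y \<in> orbit_hull f x" shows "f y \<noteq> y"
proof
  assume "f y = y"
  then have "orbit_hull f y = {y}"
    by (auto simp: orbit_hull_def iter_fixed[OF f])
  then have "x = y" using orbit_hull_self[OF f, of x] orbit_hull_eq[OF f y] by auto
  with x \<open>f y = y\<close> show False by simp
qed


section \<open>Prescribing the value of a cyclically reduced word\<close>

text \<open>The letter that acts at time \<open>i\<close> if \<open>v\<close> is repeated without end in both directions; as the
  last letter acts first, it belongs to time \<open>0\<close>.\<close>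

definition step_letter :: "('i \<times> bool) list \<Rightarrow> int \<Rightarrow> 'i \<times> bool" where
  "step_letter v i = v ! nat ((- i - 1) mod int (length v))"

text \<open>There is no cancellation in the bi-infinite repetition of \<open>v\<close>. This comprises that \<open>v\<close> is
  reduced and that its first letter does not cancel with its last one.\<close>

definition cyclically_reduced :: "('i \<times> bool) list \<Rightarrow> bool" where
  "cyclically_reduced v \<longleftrightarrow> v \<noteq> [] \<and> (\<forall>i. step_letter v (i + 1) \<noteq> flip (step_letter v i))"

lemma step_letter_in: assumes "v \<noteq> []" shows "step_letter v i \<in> set v"
proof -
  have "nat ((- i - 1) mod int (length v)) < length v"
    using assms by (simp add: nat_less_iff)
  then show ?thesis by (simp add: step_letter_def)
qed

text \<open>A new copy of \<open>v\<close> begins at the multiples of its length.\<close>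

lemma word_map_along:
  assumes v: "v \<noteq> []" and start: "int (length v) dvd i"
    and step: "\<And>k. i \<le> k \<Longrightarrow> k < i + int (length v) \<Longrightarrow> z (k + 1) = letter_map c (step_letter v k) (z k)"
  shows "k \<le> length v \<Longrightarrow> word_map c (drop (length v - k) v) (z i) = z (i + int k)"
proof (induction k)
  case (Suc k)
  let ?l = "length v" and ?m = "length v - Suc k"
  from start obtain q where q: "i = int ?l * q" by auto
  have "- (i + int k) - 1 = int ?m + (- q - 1) * int ?l"
    using Suc.prems by (simp add: q of_nat_diff algebra_simps)
  then have "(- (i + int k) - 1) mod int ?l = int ?m mod int ?l"
    by (metis mod_mult_self1)
  also have "\<dots> = int ?m" using v by (simp add: mod_pos_pos_trivial)
  finally have "step_letter v (i + int k) = v ! ?m"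
    unfolding step_letter_def by simp
  moreover have "drop ?m v = v ! ?m # drop (?l - k) v"
    using Cons_nth_drop_Suc[of ?m v] Suc.prems v by (simp add: Suc_diff_Suc)
  ultimately show ?case
    using Suc step[of "i + int k"] by (simp add: ac_simps)
qed simp

text \<open>The aim is an action on the line in which the letter at time \<open>i\<close> takes the integer \<open>i\<close> to
  \<open>i + 1\<close>, for all \<open>i\<close>. This forces the displacement of \<open>i\<close> under the generator \<open>j\<close> to be \<open>1\<close> if \<open>j\<close>
  is the letter at time \<open>i\<close>, and \<open>- 1\<close> if its inverse is the letter at time \<open>i - 1\<close>. The other values
  merely have to keep the images of the integers in order. A third of a unit is enough to stay clear
  of a neighbour that is forced to move, and two such shifts toward each other do not meet.\<close>

definition displacement :: "('i \<times> bool) list \<Rightarrow> 'i \<Rightarrow> int \<Rightarrow> real" where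
  "displacement v j i =
    (if step_letter v i = (j, True) then 1
     else if step_letter v (i - 1) = (j, False) then - 1
     else if step_letter v (i - 1) = (j, True) then 1/3
     else if step_letter v i = (j, False) then - 1/3
     else 0)"

definition lattice_action :: "('i \<times> bool) list \<Rightarrow> 'i \<Rightarrow> real \<Rightarrow> real" where
  "lattice_action v j x =
     (let u = \<lambda>i. of_int i + displacement v j i in u \<lfloor>x\<rfloor> + frac x * (u (\<lfloor>x\<rfloor> + 1) - u \<lfloor>x\<rfloor>))"

lemma lattice_action_of_int: "lattice_action v j (of_int i) = of_int i + displacement v j i"
  by (simp add: lattice_action_def)

text \<open>Images of neighbouring integers could only come in the wrong order if two consecutive
  letters cancelled.\<close>

lemma displacement_less:
  assumes "cyclically_reduced v"
  shows "displacement v j i < 1 + displacement v j (i + 1)"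
proof -
  have "step_letter v (i + 1) \<noteq> flip (step_letter v i)" "step_letter v i \<noteq> flip (step_letter v (i - 1))"
    using assms by (auto simp: cyclically_reduced_def dest: spec[of _ "i - 1"])
  then show ?thesis by (auto simp: displacement_def flip_def)
qed

lemma displacement_bounds: "- 1 \<le> displacement v j i" "displacement v j i \<le> 1"
  by (auto simp: displacement_def)

lemma lattice_action_homeo: assumes v: "cyclically_reduced v" shows "homeo_family (lattice_action v)"
proof
  fix j
  define u where "u i = of_int i + displacement v j i" for i
  let ?G = "\<lambda>i t. u i + t * (u (i + 1) - u i)"
  have u: "u i < u (i + 1)" for i using displacement_less[OF v, of j i] by (simp add: u_def)
  have G: "?G i s < ?G i t" if "s < t" for i s t using that u[of i] by simp
  have bnd: "u i \<le> ?G i t \<and> ?G i t < u (i + 1)" if "0 \<le> t" "t < 1" for i t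
  proof -
    define k where "k = u (i + 1) - u i"
    have k: "k > 0" "u (i + 1) = u i + k" using u[of i] by (simp_all add: k_def)
    then have "0 \<le> t * k" "t * k < k" using that by simp_all
    then show ?thesis unfolding k(2) by simp
  qed
  have onto: "\<exists>t. 0 \<le> t \<and> t < 1 \<and> ?G i t = y" if "u i \<le> y" "y < u (i + 1)" for i y
    using that u[of i] by (intro exI[of _ "(y - u i) / (u (i + 1) - u i)"]) simp
  have act: "lattice_action v j = (\<lambda>x. ?G \<lfloor>x\<rfloor> (frac x))"
    by (simp add: lattice_action_def u_def fun_eq_iff)
  show "incr_homeo (lattice_action v j)"
  proof (rule incr_homeoI)
    show "strict_mono (lattice_action v j)"
      unfolding act by (rule staircase(1)[of ?G u]) (use G bnd onto in blast)+
    have "range (lattice_action v j) = {y. (\<exists>i. u i \<le> y) \<and> (\<exists>j. y < u j)}"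
      unfolding act by (rule staircase(2)[of ?G u]) (use G bnd onto in blast)+
    moreover have "u (\<lfloor>y\<rfloor> - 1) \<le> y" "y < u (\<lfloor>y\<rfloor> + 3)" for y
      using displacement_bounds(2)[of v j "\<lfloor>y\<rfloor> - 1"] displacement_bounds(1)[of v j "\<lfloor>y\<rfloor> + 3"]
      unfolding u_def by linarith+
    ultimately have "y \<in> range (lattice_action v j)" for y by blast
    then show "\<exists>x. lattice_action v j x = y" for y by (metis imageE)
  qed
qed

lemma lattice_action_step:
  assumes v: "cyclically_reduced v"
  shows "letter_map (lattice_action v) (step_letter v i) (of_int i) = of_int (i + 1)"
proof -
  interpret homeo_family "lattice_action v" by (rule lattice_action_homeo[OF v])
  obtain j b where jb: "step_letter v i = (j, b)" by fastforce
  have "step_letter v (i + 1) \<noteq> flip (step_letter v i)" using v by (simp add: cyclically_reduced_def)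
  then have *: "step_letter v (i + 1) \<noteq> (j, \<not> b)" by (simp add: jb flip_def)
  show ?thesis
  proof (cases b)
    case True
    then show ?thesis
      unfolding letter_eq_iff by (simp add: jb lattice_action_of_int displacement_def)
  next
    case False
    have "lattice_action v j (of_int (i + 1)) = of_int i"
      unfolding lattice_action_of_int using False * by (simp add: jb displacement_def)
    then show ?thesis using False unfolding letter_eq_iff by (simp add: jb)
  qed
qed

text \<open>In the lattice action the word \<open>v\<close> takes each multiple of its length to the next one. Hence it
  has no fixed point and is conjugate to a translation.\<close>

lemma word_translation:
  assumes v: "cyclically_reduced v"
  shows "\<exists>c. homeo_family c \<and> word_map c v = (\<lambda>x. x + 1)"
proof -
  let ?c = "lattice_action v" and ?l = "length v"
  interpret homeo_family ?c by (rule lattice_action_homeo[OF v])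
  let ?g = "word_map ?c v"
  have v0: "v \<noteq> []" using v by (simp add: cyclically_reduced_def)
  have lat: "?g (of_int (int ?l * k)) = of_int (int ?l * (k + 1))" for k
    using word_map_along[OF v0, of "int ?l * k" of_int ?c ?l] lattice_action_step[OF v]
    by (simp add: algebra_simps)
  have "x < ?g x" for x
  proof -
    define k where "k = \<lfloor>x / ?l\<rfloor>"
    have "of_int k \<le> x / ?l" "x / ?l < of_int k + 1" by (simp_all add: k_def)
    then have k: "of_int (int ?l * k) \<le> x" "x < of_int (int ?l * (k + 1))"
      using v0 by (simp_all add: field_simps)
    have "?g (of_int (int ?l * k)) \<le> ?g x" using k(1) word by (simp only: incr_homeo_le)
    then show ?thesis using k(2) lat[of k] by linarith
  qed
  note moved = this
  note g = word[of v]
  let ?h = "abel ?g 0"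
  note h = abel_chart[OF g, of 0, OF moved]
  have "y \<in> orbit_hull ?g 0" for y
  proof -
    have "\<exists>j. y \<le> iter ?g j 0"
      using fixed_point_above_orbit[OF g, of 0 y] moved by (metis less_irrefl linear)
    moreover have "\<exists>j. iter ?g j 0 \<le> y"
      using fixed_point_below_orbit[OF g, of y 0] moved by (metis less_irrefl linear)
    ultimately show ?thesis by (simp add: orbit_hull_def)
  qed
  then have hh: "incr_homeo ?h" using h by (intro incr_homeoI) (blast, metis imageE)
  let ?d = "\<lambda>j. finv ?h \<circ> ?c j \<circ> ?h"
  have "word_map ?d v = finv ?h \<circ> ?g \<circ> ?h"
    by (rule word_map_conjugate(2)[OF homeo_family_axioms hh])
  moreover have "finv ?h (?g (?h x)) = x + 1" for x
    using abel_Suc[OF g, of 0 x] by (simp add: incr_homeo_inv_le[OF hh])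
  ultimately have "word_map ?d v = (\<lambda>x. x + 1)" by (simp add: fun_eq_iff)
  then show ?thesis using word_map_conjugate(1)[OF homeo_family_axioms hh] by blast
qed

text \<open>On each component of the set of moved points, \<open>f\<close> is conjugate to the unit translation, which
  is the value of \<open>v\<close> in some action. That action is copied into all these components, and the
  generators fix all remaining points.\<close>

lemma word_realization:
  assumes v: "cyclically_reduced v" and f: "incr_homeo f"
  shows "\<exists>b. homeo_family b \<and> word_map b v = f \<and> (\<forall>j x. f x = x \<longrightarrow> b j x = x)"
proof -
  obtain c where c: "homeo_family c" and cv: "word_map c v = (\<lambda>x. x + 1)"
    using word_translation[OF v] by blast
  interpret c: homeo_family c by (rule c)
  define H where "H C = (SOME h :: real \<Rightarrow> real. (strict_mono h \<or> strict_mono (\<lambda>x. h (- x))) \<and> range h = C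
    \<and> (\<forall>t. h (t + 1) = f (h t)))" for C
  define chart where "chart x = H (orbit_hull f x)" for x
  have chart: "strict_mono (chart x) \<or> strict_mono (\<lambda>t. chart x (- t))" "range (chart x) = orbit_hull f x"
    "chart x (t + 1) = f (chart x t)" if "f x \<noteq> x" for x t
    using someI_ex[OF component_chart[OF f that]] unfolding chart_def H_def by blast+
  have inj: "chart x s = chart x t \<longleftrightarrow> s = t" if "f x \<noteq> x" for x s t
    using chart(1)[OF that] strict_mono_eq[of "\<lambda>t. chart x (- t)" "- s" "- t"]
    by (auto simp: strict_mono_eq)
  have conj_less: "chart x (c j s) < chart x (c j t) \<longleftrightarrow> chart x s < chart x t" if "f x \<noteq> x" for x s t j
    using chart(1)[OF that]
  proof
    assume "strict_mono (\<lambda>t. chart x (- t))"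
    then have "chart x a < chart x b \<longleftrightarrow> b < a" for a b
      using strict_mono_less[of "\<lambda>t. chart x (- t)" "- a" "- b"] by simp
    then show ?thesis by (simp add: incr_homeo_less[OF c.homeo])
  qed (simp add: strict_mono_less incr_homeo_less[OF c.homeo])
  define b where "b j x = (if f x = x then x else chart x (c j (inv_into UNIV (chart x) x)))" for j x
  have b_chart: "b j (chart x t) = chart x (c j t)" if x: "f x \<noteq> x" for j x t
  proof -
    have y: "chart x t \<in> orbit_hull f x" using chart(2)[OF x] by auto
    have "chart z = chart x" if "orbit_hull f z = orbit_hull f x" for z
      using that by (simp add: chart_def)
    then have "chart (chart x t) = chart x" using orbit_hull_eq[OF f y] .
    moreover have "inv_into UNIV (chart x) (chart x t) = t"
      by (rule inv_into_f_f) (auto simp: inj_on_def inj[OF x])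
    ultimately show ?thesis using orbit_hull_moved[OF f x y] by (simp add: b_def)
  qed
  have chart_point: "\<exists>t. z = chart x t" if "f x \<noteq> x" "z \<in> orbit_hull f x" for x z
    using chart(2)[OF that(1)] that(2) by (metis imageE)
  have b_hull: "b j x \<in> orbit_hull f x" for j x
  proof (cases "f x = x")
    case True
    then show ?thesis using orbit_hull_self[OF f] by (simp add: b_def)
  next
    case False
    then show ?thesis using chart(2)[OF False] by (auto simp: b_def)
  qed
  \<comment> \<open>Hulls are convex, disjoint or equal, and preserved, so that only points of one hull could change their order.\<close>
  have b_homeo: "incr_homeo (b j)" for j
  proof (rule incr_homeoI)
    show "strict_mono (b j)"
    proof (rule strict_monoI, rule ccontr)
      fix x y :: real assume xy: "x < y" and "\<not> b j x < b j y"
      then have le: "b j y \<le> b j x" by simp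
      have same: "y \<in> orbit_hull f x"
      proof (cases "b j y \<le> x")
        case True
        then have "x \<in> orbit_hull f y"
          using orbit_hull_convex[OF b_hull orbit_hull_self[OF f]] xy by fastforce
        then show ?thesis using orbit_hull_eq[OF f] orbit_hull_self[OF f] by metis
      next
        case False
        then have "b j y \<in> orbit_hull f x"
          using orbit_hull_convex[OF orbit_hull_self[OF f] b_hull, of x "b j y"] le by fastforce
        then show ?thesis using orbit_hull_eq[OF f] orbit_hull_self[OF f] b_hull[of j y] by metis
      qed
      show False
      proof (cases "f x = x")
        case True
        then show False using same xy by (auto simp: orbit_hull_def iter_fixed[OF f])
      next
        case False
        obtain s t where "x = chart x s" "y = chart x t"
          using chart_point[OF False] same orbit_hull_self[OF f] by metis
        then show False using le xy b_chart[OF False] conj_less[OF False] by (metis not_le)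
      qed
    qed
    show "\<exists>x. b j x = y" for y
    proof (cases "f y = y")
      case True
      then show ?thesis by (intro exI[of _ y]) (simp add: b_def)
    next
      case False
      obtain t where t: "y = chart y t" using chart_point[OF False orbit_hull_self[OF f]] by blast
      have "b j (chart y (finv (c j) t)) = y"
        using b_chart[OF False] t by (simp add: incr_homeo_inv_inv[OF c.homeo])
      then show ?thesis by blast
    qed
  qed
  have fam: "homeo_family b" by standard (rule b_homeo)
  have "word_map b v x = f x" for x
  proof (cases "f x = x")
    case True
    then show ?thesis using homeo_family.word_fixed[OF fam, of v x] by (simp add: b_def)
  next
    case False
    obtain t where t: "x = chart x t" using chart_point[OF False orbit_hull_self[OF f]] by blast
    have "word_map b v (chart x t) = chart x (word_map c v t)"
      by (rule word_map_equivariant[OF c fam]) (rule b_chart[OF False])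
    then show ?thesis using t chart(3)[OF False] by (simp add: cv)
  qed
  then show ?thesis using fam by (intro exI[of _ b]) (auto simp: b_def)
qed


section \<open>Extending an action along a word\<close>

primrec traj :: "('i \<Rightarrow> real \<Rightarrow> real) \<Rightarrow> ('i \<times> bool) list \<Rightarrow> real \<Rightarrow> nat \<Rightarrow> real" where
  "traj c v x 0 = x"
| "traj c v x (Suc i) = letter_map c (step_letter v (int i)) (traj c v x i)"

lemma word_map_drop_traj:
  assumes "v \<noteq> []" "k \<le> length v"
  shows "word_map c (drop (length v - k) v) x = traj c v x k"
proof -
  have "traj c v x (nat (i + 1)) = letter_map c (step_letter v i) (traj c v x (nat i))" if "0 \<le> i" for i
    using that by (simp add: nat_add_distrib)
  then show ?thesis
    using word_map_along[OF assms(1), of 0 "\<lambda>i. traj c v x (nat i)" c k] assms(2) by simp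
qed

lemma step_letter_periodic: "step_letter v (i + int (length v)) = step_letter v i"
proof -
  have "- (i + int (length v)) - 1 = (- i - 1) + (- 1) * int (length v)" by simp
  then show ?thesis unfolding step_letter_def by (metis mod_mult_self1)
qed

lemma traj_add_period: "traj c v x (length v + i) = traj c v (traj c v x (length v)) i"
proof (induction i)
  case (Suc i)
  have "step_letter v (int (length v + i)) = step_letter v (int i)"
    using step_letter_periodic[of v "int i"] by (simp add: add.commute)
  with Suc show ?case by simp
qed simp

lemma incr_homeo_traj: assumes "homeo_family c" shows "incr_homeo (\<lambda>x. traj c v x i)"
proof (induction i)
  case 0
  show ?case using incr_homeo_id by (simp add: id_def)
next
  case (Suc i)
  then show ?case using incr_homeo_comp[OF homeo_family.letter[OF assms] Suc] by (simp add: comp_def)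
qed

text \<open>Let the letters of \<open>v\<close>, repeated without end, act on \<open>p\<close>, and let \<open>Q\<close> be the largest point met
  during the first copy of \<open>v\<close>. As \<open>v\<close> moves \<open>p\<close> upward, the corresponding point of the second copy
  is larger than \<open>Q\<close>; let \<open>M\<close> be the first time at which \<open>Q\<close> is exceeded. The generators are kept
  where argument and value are at most \<open>Q\<close>, which determines \<open>v\<close> up to \<open>p\<close>, and also in the step that
  leads to time \<open>M\<close>. The point reached then lies above everything prescribed, except that it can be
  led back by the inverse of the last letter. The next letter is not that inverse, and so its value may
  be chosen at will: from time \<open>M\<close> on, the trajectory climbs along a lattice as in \<open>lattice_action\<close>.
  Thus the iterates of \<open>p\<close> under \<open>v\<close> tend to infinity, and there is no fixed point above \<open>p\<close>.\<close>

lemma escaping_path: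
  assumes c: "homeo_family c" and v: "cyclically_reduced v" and up: "p < word_map c v p"
  shows "\<exists>d. homeo_family d \<and> (\<forall>j x. x \<le> p \<longrightarrow> c j x \<le> p \<longrightarrow> d j x = c j x)
    \<and> (\<forall>x\<le>p. word_map d v x = word_map c v x) \<and> (\<forall>x\<ge>p. x < word_map d v x)"
proof -
  interpret c: homeo_family c by (rule c)
  interpret lat: homeo_family "lattice_action v" by (rule lattice_action_homeo[OF v])
  define l where "l = length v"
  have v0: "v \<noteq> []" using v by (simp add: cyclically_reduced_def)
  then have l0: "l > 0" by (simp add: l_def)
  define X where "X = traj c v p"
  have word_X: "word_map c v x = traj c v x l" for x c
    using word_map_drop_traj[OF v0, of l c x] by (simp add: l_def)
  define Q where "Q = Max (X ` {..l})"
  have Q: "X i \<le> Q" if "i \<le> l" for i using that by (auto simp: Q_def intro: Max_ge)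
  have "Q \<in> X ` {..l}" unfolding Q_def by (rule Max_in) auto
  then obtain i0 where "X i0 = Q" by auto
  moreover have "X i0 < X (l + i0)"
    using up incr_homeo_less[OF incr_homeo_traj[OF c]]
    by (simp add: X_def l_def traj_add_period word_X)
  ultimately have ex: "Q < X (l + i0)" by simp
  define M where "M = (LEAST i. Q < X i)"
  have M: "Q < X M" unfolding M_def using ex by (rule LeastI)
  have less_M: "X i \<le> Q" if "i < M" for i using not_less_Least[of i] that by (force simp: M_def)
  obtain m where m: "M = Suc m" using M Q[of 0] by (cases M) auto
  define s where "s = step_letter v (int m)"
  have Xm: "X m \<le> Q" using less_M m by simp
  have X_step: "X M = letter_map c s (X m)" by (simp add: m X_def s_def)
  \<comment> \<open>The lattice is placed with step \<open>\<mu>\<close>, its points \<open>M\<close> and \<open>M - 1\<close> at \<open>X M\<close> and \<open>Q\<close>.\<close>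
  define \<mu> where "\<mu> = X M - Q"
  have mu: "\<mu> > 0" using M by (simp add: \<mu>_def)
  define A where "A t = X M + \<mu> * (t - real M)" for t
  have A_less: "A s < A t \<longleftrightarrow> s < t" and A_le: "A s \<le> A t \<longleftrightarrow> s \<le> t" for s t
    using mu by (auto simp: A_def)
  have A_homeo: "incr_homeo A"
  proof (rule incr_homeoI)
    show "\<exists>x. A x = y" for y using mu by (intro exI[of _ "(y - X M) / \<mu> + M"]) (simp add: A_def)
  qed (simp add: strict_mono_def A_less)
  have A_vals: "A (real M) = X M" "A (real M - 1) = Q" by (simp_all add: A_def \<mu>_def)
  define L where "L j = A \<circ> lattice_action v j \<circ> finv A" for j
  have L_homeo: "incr_homeo (L j)" for j
    unfolding L_def by (intro incr_homeo_comp A_homeo lat.homeo incr_homeo_inv)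
  have L_A: "L j (A t) = A (lattice_action v j t)" for j t
    by (simp add: L_def incr_homeo_inv_inv(2)[OF A_homeo])
  have L_A_nat: "L j (A (real i)) = A (real i + displacement v j (int i))" for j i
    using lattice_action_of_int[of v j "int i"] by (simp add: L_A)
  interpret L: homeo_family L by standard (rule L_homeo)
  have L_step: "letter_map L (step_letter v (int i)) (A (real i)) = A (real (Suc i))" for i
  proof -
    have "word_map L [step_letter v (int i)] (A (real i)) = A (word_map (lattice_action v) [step_letter v (int i)] (real i))"
      by (rule word_map_equivariant) (simp_all add: L_A lat.homeo_family_axioms L.homeo_family_axioms)
    then show ?thesis using lattice_action_step[OF v, of "int i"] by (simp add: add.commute)
  qed
  have sM: "step_letter v (int M) \<noteq> flip s"
    using v by (auto simp: cyclically_reduced_def s_def m add.commute)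
  define good where "good j g \<longleftrightarrow> incr_homeo g \<and> (\<forall>x. x \<le> Q \<longrightarrow> c j x \<le> Q \<longrightarrow> g x = c j x)
      \<and> (s = (j, True) \<longrightarrow> g (X m) = X M) \<and> (s = (j, False) \<longrightarrow> g (X M) = X m)
      \<and> (s \<noteq> (j, False) \<longrightarrow> (\<forall>x\<ge>X M. g x = L j x)) \<and> (\<forall>x\<ge>A (real (Suc M)). g x = L j x)" for j g
  \<comment> \<open>The step that leads to time \<open>M\<close> prescribes one more value of its generator \<open>fst s\<close>.\<close>
  have "\<exists>g. good j g" for j
  proof -
    have after: "X M \<le> A (real (Suc M))" unfolding A_vals(1)[symmetric] A_le by simp
    consider "s = (j, True)" | "s = (j, False)" | "s \<noteq> (j, True)" "s \<noteq> (j, False)" by blast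
    then show ?thesis
    proof cases
      case 1
      then have cm: "c j (X m) = X M" using X_step by simp
      have "X M < L j (X M)"
        unfolding A_vals(1)[symmetric] L_A_nat A_less using 1 sM by (auto simp: displacement_def s_def m)
      then obtain g where "incr_homeo g" "\<forall>x\<le>X m. g x = c j x" "\<forall>x\<ge>X M. g x = L j x"
        using incr_homeo_glue[OF c.homeo[of j] L_homeo[of j], of "X m" "X M"] cm Xm M by auto
      moreover have "x \<le> X m" if "c j x \<le> Q" for x
      proof -
        have "c j x < c j (X m)" using that cm M by simp
        then show ?thesis by (simp add: incr_homeo_less[OF c.homeo])
      qed
      ultimately show ?thesis using 1 cm after by (intro exI[of _ g]) (auto simp: good_def)
    next
      case 2
      then have cm: "c j (X M) = X m" using X_step by (simp add: incr_homeo_inv_inv(1)[OF c.homeo])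
      have "A (real M) \<le> A (real (Suc M) + displacement v j (int (Suc M)))"
        unfolding A_le using displacement_bounds(1)[of v j "int (Suc M)"] by simp
      then have "X m < L j (A (real (Suc M)))" unfolding L_A_nat A_vals(1) using Xm M by linarith
      moreover have "X M < A (real (Suc M))" unfolding A_vals(1)[symmetric] A_less by simp
      ultimately obtain g where "incr_homeo g" "\<forall>x\<le>X M. g x = c j x" "\<forall>x\<ge>A (real (Suc M)). g x = L j x"
        using incr_homeo_glue[OF c.homeo[of j] L_homeo[of j], of "X M" "A (real (Suc M))"] cm by auto
      then show ?thesis using 2 cm M by (intro exI[of _ g]) (auto simp: good_def)
    next
      case 3
      define P where "P = min Q (finv (c j) Q)"
      have P: "P \<le> Q" "c j P \<le> Q"
        using incr_homeo_inv_le(2)[OF c.homeo, of P j Q] by (auto simp: P_def)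
      have "real M - 1 < real M + displacement v j (int M)"
        using 3 by (auto simp: displacement_def s_def m)
      then have "Q < L j (X M)" unfolding A_vals(1)[symmetric] L_A_nat A_vals(2)[symmetric] A_less .
      then obtain g where "incr_homeo g" "\<forall>x\<le>P. g x = c j x" "\<forall>x\<ge>X M. g x = L j x"
        using incr_homeo_glue[OF c.homeo[of j] L_homeo[of j], of P "X M"] P M by auto
      moreover have "x \<le> P" if "x \<le> Q" "c j x \<le> Q" for x
        using that by (simp add: P_def incr_homeo_inv_le[OF c.homeo])
      ultimately show ?thesis using 3 after by (intro exI[of _ g]) (auto simp: good_def)
    qed
  qed
  then obtain d where good: "\<And>j. good j (d j)" by metis
  have d_homeo: "incr_homeo (d j)" for j
    using good by (simp add: good_def)
  have d_c: "d j x = c j x" if "x \<le> Q" "c j x \<le> Q" for j x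
    using good[of j] that by (simp add: good_def)
  have d_pos: "d j (X m) = X M" if "s = (j, True)" for j
    using good[of j] that by (simp add: good_def)
  have d_neg: "d j (X M) = X m" if "s = (j, False)" for j
    using good[of j] that by (simp add: good_def)
  have d_L: "d j x = L j x" if "s \<noteq> (j, False)" "x \<ge> X M" for j x
    using good[of j] that by (simp add: good_def)
  have d_L': "d j x = L j x" if "x \<ge> A (real (Suc M))" for j x
    using good[of j] that unfolding good_def by blast
  interpret d: homeo_family d by standard (rule d_homeo)
  have below: "word_map d v x = word_map c v x" if "x \<le> p" for x
  proof (rule word_map_cong_below[OF c d.homeo_family_axioms d_c])
    fix i assume "i \<le> length v"
    then have "word_map c (drop i v) p \<le> Q"
      using word_map_drop_traj[OF v0, of "l - i" c p] Q[of "l - i"] by (simp add: X_def l_def)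
    moreover have "word_map c (drop i v) x \<le> word_map c (drop i v) p"
      using that by (simp add: incr_homeo_le[OF c.word])
    ultimately show "word_map c (drop i v) x \<le> Q" by linarith
  qed
  have traj_1: "traj d v p i = X i" if "i \<le> M" for i
    using that
  proof (induction i)
    case (Suc i)
    obtain j b where jb: "step_letter v (int i) = (j, b)" by fastforce
    have Xi: "X (Suc i) = letter_map c (j, b) (X i)" by (simp add: X_def jb)
    have "letter_map d (j, b) (X i) = X (Suc i)"
    proof (cases "i = m")
      case True
      then have "s = (j, b)" using jb by (simp add: s_def)
      then show ?thesis
        unfolding d.letter_eq_iff using d_pos d_neg True m by simp
    next
      case False
      then have "X i \<le> Q" "X (Suc i) \<le> Q" using less_M Suc.prems m by auto
      then show ?thesis
        unfolding d.letter_eq_iff using Xi d_c c.letter_eq_iff[of "(j, b)" "X i" "X (Suc i)"] by auto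
    qed
    with Suc jb show ?case by simp
  qed (simp add: X_def)
  have traj_2: "traj d v p (M + i) = A (real (M + i))" for i
  proof (induction i)
    case 0
    show ?case using traj_1[of M] A_vals by simp
  next
    case (Suc i)
    obtain j b where jb: "step_letter v (int (M + i)) = (j, b)" by fastforce
    have AM: "A (real (M + i)) \<ge> X M" "A (real (Suc (M + i))) \<ge> A (real (Suc M))"
      unfolding A_vals(1)[symmetric] A_le by simp_all
    have "letter_map L (j, b) (A (real (M + i))) = A (real (Suc (M + i)))"
      using L_step[of "M + i"] jb by simp
    then have "letter_map d (j, b) (A (real (M + i))) = A (real (Suc (M + i)))"
      unfolding L.letter_eq_iff d.letter_eq_iff
    proof (cases b)
      case True
      have "d j (A (real (M + i))) = L j (A (real (M + i)))"
      proof (cases "i = 0")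
        case i: True
        then have "s \<noteq> (j, False)" using sM jb True by (auto simp: flip_def)
        then show ?thesis using d_L AM by simp
      next
        case False
        then have "A (real (M + i)) \<ge> A (real (Suc M))" unfolding A_le by simp
        then show ?thesis by (rule d_L')
      qed
      with True show "if snd (j, b) then L (fst (j, b)) (A (real (M + i))) = A (real (Suc (M + i)))
          else L (fst (j, b)) (A (real (Suc (M + i)))) = A (real (M + i))
        \<Longrightarrow> if snd (j, b) then d (fst (j, b)) (A (real (M + i))) = A (real (Suc (M + i)))
          else d (fst (j, b)) (A (real (Suc (M + i)))) = A (real (M + i))" by simp
    qed (use d_L'[OF AM(2)] in simp)
    with Suc jb show ?case by simp
  qed
  define q where "q k = traj d v p (k * l)" for k
  have q_step: "word_map d v (q k) = q (Suc k)" for k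
  proof -
    have "traj d v (traj d v p (k * l)) i = traj d v p (k * l + i)" for i
    proof (induction k arbitrary: i)
      case (Suc k)
      show ?case using Suc[of i] Suc[of l] Suc[of "l + i"] traj_add_period[of d v _ i]
        by (simp add: l_def ac_simps)
    qed simp
    then show ?thesis by (simp add: word_X q_def add.commute)
  qed
  have q_large: "\<exists>k. x < q k" for x
  proof -
    obtain n where n: "(x - X M) / \<mu> + real M < real n" using reals_Archimedean2 by blast
    have "x = A ((x - X M) / \<mu> + real M)" using mu by (simp add: A_def)
    also have "\<dots> < A (real n)" unfolding A_less by (rule n)
    also have "\<dots> \<le> A (real ((M + n) * l))" unfolding A_le using l0
      by (metis Suc_leI add_leD2 le_add2 mult.right_neutral mult_le_mono2 of_nat_mono One_nat_def le_trans)
    also have "\<dots> = q (M + n)"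
    proof -
      have "M \<le> (M + n) * l" using l0 by (metis Suc_leI mult.right_neutral mult_le_mono2 One_nat_def le_add1 le_trans)
      then show ?thesis using traj_2[of "(M + n) * l - M"] by (simp add: q_def)
    qed
    finally show ?thesis by blast
  qed
  have "x < word_map d v x" if "p \<le> x" for x
  proof -
    define k where "k = (LEAST k. x < q k)"
    have k: "x < q k" unfolding k_def using q_large[of x] by (rule LeastI_ex)
    have "q 0 = p" by (simp add: q_def)
    then have "k \<noteq> 0" using k that by (metis not_le)
    then obtain k' where k': "k = Suc k'" by (cases k) auto
    then have "q k' \<le> x" using not_less_Least[of k' "\<lambda>k. x < q k"] by (simp add: k_def)
    then have "word_map d v (q k') \<le> word_map d v x" by (simp add: incr_homeo_le[OF d.word])
    then show ?thesis using k q_step k' by simp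
  qed
  moreover have "d j x = c j x" if "x \<le> p" "c j x \<le> p" for j x
    using that d_c Q[of 0] by (simp add: X_def)
  ultimately show ?thesis using below d.homeo_family_axioms by blast
qed


lemma word_map_cong_on:
  assumes c: "homeo_family c" and d: "homeo_family d"
    and inv: "\<And>j x. c j x \<in> X \<longleftrightarrow> x \<in> X" and eq: "\<And>j x. x \<in> X \<Longrightarrow> d j x = c j x"
    and x: "x \<in> X"
  shows "word_map d w x = word_map c w x" and "word_map c w x \<in> X"
proof -
  interpret c: homeo_family c by (rule c)
  interpret d: homeo_family d by (rule d)
  have "word_map d w x = word_map c w x \<and> word_map c w x \<in> X"
  proof (induction w)
    case (Cons l w)
    let ?y = "word_map c w x"
    have in_X: "letter_map c l ?y \<in> X"
    proof (cases "snd l")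
      case True
      then show ?thesis using Cons inv by (simp add: letter_map_def)
    next
      case False
      have "c (fst l) (finv (c (fst l)) ?y) \<in> X" using Cons by (simp add: incr_homeo_inv_inv(1)[OF c.homeo])
      then show ?thesis using False inv by (simp add: letter_map_def)
    qed
    moreover have "letter_map d l ?y = letter_map c l ?y"
      unfolding d.letter_eq_iff using Cons in_X eq c.letter_eq_iff[of l ?y "letter_map c l ?y"] by auto
    ultimately show ?case using Cons by simp
  qed (use x in simp)
  then show "word_map d w x = word_map c w x" and "word_map c w x \<in> X" by auto
qed

text \<open>The interesting case is that \<open>range h\<close> is a lower half-line preserved by \<open>r\<close>; then \<open>e\<close> acts, through
  \<open>h\<close>, below the end of the half-line, and \<open>r\<close> above.\<close>

definition transplant :: "(real \<Rightarrow> real) \<Rightarrow> (real \<Rightarrow> real) \<Rightarrow> (real \<Rightarrow> real) \<Rightarrow> real \<Rightarrow> real" where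
  "transplant h e r y = (if y \<in> range h then h (e (inv_into UNIV h y)) else r y)"

lemma transplant_range: "strict_mono h \<Longrightarrow> transplant h e r (h x) = h (e x)"
  by (simp add: transplant_def strict_mono_imp_inj_on)

lemma incr_homeo_transplant:
  assumes h: "strict_mono h" and down: "\<And>x y. y \<in> range h \<Longrightarrow> x \<le> y \<Longrightarrow> x \<in> range h"
    and e: "incr_homeo e" and r: "incr_homeo r" and inv: "\<And>y. r y \<in> range h \<longleftrightarrow> y \<in> range h"
  shows "incr_homeo (transplant h e r)"
proof (rule incr_homeoI)
  show "strict_mono (transplant h e r)"
  proof (rule strict_monoI)
    fix x y :: real assume xy: "x < y"
    consider "y \<in> range h" | "x \<in> range h" "y \<notin> range h" | "x \<notin> range h" "y \<notin> range h" by blast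
    then show "transplant h e r x < transplant h e r y"
    proof cases
      case 1
      moreover from this have "x \<in> range h" using down xy by fastforce
      ultimately obtain s t where "x = h s" "y = h t" by blast
      then show ?thesis using xy h e by (simp add: transplant_range strict_mono_less incr_homeo_less)
    next
      case 2
      then obtain s where s: "x = h s" by blast
      have "\<not> r y \<le> h (e s)" using 2 inv down by blast
      then show ?thesis using 2 h s by (simp add: transplant_range) (simp add: transplant_def)
    next
      case 3
      then show ?thesis using xy r by (simp add: transplant_def incr_homeo_less)
    qed
  qed
  show "\<exists>x. transplant h e r x = y" for y
  proof (cases "y \<in> range h")
    case True
    then obtain t where "y = h t" by blast
    then have "transplant h e r (h (finv e t)) = y" using h e by (simp add: transplant_range incr_homeo_inv_inv)
    then show ?thesis by blast
  next
    case False
    then have "finv r y \<notin> range h" using inv[of "finv r y"] r by (simp add: incr_homeo_inv_inv)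
    then have "transplant h e r (finv r y) = y" using r by (simp add: transplant_def incr_homeo_inv_inv)
    then show ?thesis by blast
  qed
qed

text \<open>From \<open>p\<close> upward, the charts \<open>abel f p\<close> and \<open>abel g p\<close> conjugate the unit translation to \<open>f\<close> and
  to \<open>g\<close>. They coincide on \<open>[0, 1]\<close> because \<open>f p = g p\<close>, so that the passage from one to the other
  is the identity between \<open>p\<close> and \<open>f p\<close> and extends the identity below \<open>p\<close>. The range of \<open>h\<close> ends at
  the first fixed point of \<open>f\<close> above \<open>p\<close>, if there is one.\<close>

lemma one_sided_conjugacy:
  assumes f: "incr_homeo f" and g: "incr_homeo g" and fg: "\<And>x. x \<le> p \<Longrightarrow> f x = g x"
    and up: "p < f p" and moved: "\<And>x. p \<le> x \<Longrightarrow> x < g x"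
  shows "\<exists>h. strict_mono h \<and> range h = {y. \<exists>j. y \<le> iter f j p} \<and> (\<forall>x\<le>p. h x = x)
    \<and> (\<forall>x. h (g x) = f (h x))"
proof -
  let ?\<alpha> = "abel g p" and ?\<beta> = "abel f p"
  have fgp: "f p = g p" using fg by simp
  note chart_f = abel_chart[OF f up]
  have upg: "p < g p" using up fgp by simp
  note chart_g = abel_chart[OF g upg]
  have a0: "?\<alpha> 0 = p" "?\<beta> 0 = p" "?\<alpha> 1 = g p"
    using abel_unit[OF g] abel_unit[OF f] by simp_all
  have same: "?\<alpha> t = ?\<beta> t" if "0 \<le> t" "t \<le> 1" for t
    using that abel_unit[OF g] abel_unit[OF f] fgp by simp
  have inj: "?\<alpha> s = ?\<alpha> t \<longleftrightarrow> s = t" for s t using chart_g(1) by (simp add: strict_mono_eq)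
  have "\<exists>t. ?\<alpha> t = x" if x: "p \<le> x" for x
  proof -
    have "iter g 0 p \<le> x" using x by (simp add: iter_0[OF g])
    moreover have "\<exists>j. x \<le> iter g j p"
      using fixed_point_above_orbit[OF g, of p x] moved by (metis less_irrefl linear)
    ultimately have "x \<in> orbit_hull g p" unfolding orbit_hull_def by blast
    then show ?thesis unfolding chart_g(2)[symmetric] by blast
  qed
  then obtain T where T: "\<And>x. p \<le> x \<Longrightarrow> ?\<alpha> (T x) = x" by metis
  have T_le: "T x \<le> t \<longleftrightarrow> x \<le> ?\<alpha> t" if "p \<le> x" for x t
    using strict_mono_less_eq[OF chart_g(1), of "T x" t] T[OF that] by simp
  have T_less: "t < T x \<longleftrightarrow> ?\<alpha> t < x" if "p \<le> x" for x t
    using strict_mono_less[OF chart_g(1), of t "T x"] T[OF that] by simp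
  define h where "h x = (if x \<le> p then x else ?\<beta> (T x))" for x
  \<comment> \<open>The identity reaches up to \<open>g p\<close>, one fundamental domain beyond \<open>p\<close>; this makes the two parts of \<open>h\<close> fit.\<close>
  have h_unit: "h x = x" if "x \<le> g p" for x
  proof (cases "x \<le> p")
    case False
    then have "0 \<le> T x" "T x \<le> 1"
      using T_less[of x 0] T_le[of x 1] that a0 by auto
    then show ?thesis using same[of "T x"] T[of x] False by (simp add: h_def)
  qed (simp add: h_def)
  have h_above: "h x = ?\<beta> (T x)" "0 \<le> T x" if "p \<le> x" for x
  proof -
    have "T p = 0" using T[of p] a0 inj[of "T p" 0] by simp
    then show "h x = ?\<beta> (T x)" using that a0 by (cases "x = p") (auto simp: h_def)
    show "0 \<le> T x" using T_le[of x 0] T_less[of x 0] T_le[OF that, of "T x"] a0 that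
      by (metis T inj leI linorder_not_le strict_mono_less[OF chart_g(1)])
  qed
  have h_mono: "h x < h y" if "x < y" for x y
  proof -
    consider "y \<le> p" | "x \<le> p" "p < y" | "p < x" by linarith
    then show ?thesis
    proof cases
      case 2
      then have "0 < T y" using T_less[of y 0] a0 by simp
      then have "p < ?\<beta> (T y)" using strict_mono_less[OF chart_f(1), of 0 "T y"] a0 by simp
      then show ?thesis using 2 by (simp add: h_def)
    next
      case 3
      then have "T x < T y" using that T_less[of y "T x"] T[of x] by simp
      then show ?thesis using 3 that chart_f(1) by (simp add: h_def strict_mono_less)
    qed (use that in \<open>simp add: h_def\<close>)
  qed
  have "h (g x) = f (h x)" for x
  proof (cases "x \<le> p")
    case True
    then have "g x \<le> g p" using g by (simp add: incr_homeo_le)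
    then show ?thesis using True h_unit fg by (simp add: h_def)
  next
    case False
    then have gx: "p \<le> g x" using moved[of x] by simp
    have "?\<alpha> (T x + 1) = ?\<alpha> (T (g x))" using T[OF gx] T[of x] False by (simp add: abel_Suc[OF g])
    then have "T (g x) = T x + 1" using inj by simp
    then show ?thesis using False h_above(1)[OF gx] by (simp add: h_def abel_Suc[OF f])
  qed
  moreover have "range h = {y. \<exists>j. y \<le> iter f j p}"
  proof (intro equalityI subsetI)
    fix y assume "y \<in> range h"
    then obtain x where x: "y = h x" by blast
    show "y \<in> {y. \<exists>j. y \<le> iter f j p}"
    proof (cases "x \<le> p")
      case True
      then show ?thesis using x by (auto simp: h_def iter_0[OF f] intro!: exI[of _ 0])
    next
      case False
      then have "y \<in> orbit_hull f p" unfolding chart_f(2)[symmetric] using x by (simp add: h_def)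
      then show ?thesis by (auto simp: orbit_hull_def)
    qed
  next
    fix y assume y: "y \<in> {y. \<exists>j. y \<le> iter f j p}"
    show "y \<in> range h"
    proof (cases "y \<le> p")
      case True
      then have "y = h y" by (simp add: h_def)
      then show ?thesis by (rule range_eqI)
    next
      case False
      then have "iter f 0 p \<le> y" by (simp add: iter_0[OF f])
      with y have "y \<in> orbit_hull f p" unfolding orbit_hull_def by blast
      then obtain s where s: "y = ?\<beta> s" unfolding chart_f(2)[symmetric] by blast
      have "0 < s" using False s strict_mono_less[OF chart_f(1), of 0 s] a0 by simp
      then have "p < ?\<alpha> s" using strict_mono_less[OF chart_g(1), of 0 s] a0 by simp
      moreover from this have "T (?\<alpha> s) = s" using T[of "?\<alpha> s"] inj by simp
      ultimately have "y = h (?\<alpha> s)" using s by (simp add: h_def)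
      then show ?thesis by (rule range_eqI)
    qed
  qed
  ultimately show ?thesis
    using h_mono by (intro exI[of _ h]) (auto simp: h_def strict_mono_def)
qed

text \<open>By \<open>escaping_path\<close> the action can be modified so that the value of \<open>v\<close> has no fixed point
  above \<open>p\<close>. This value is then conjugate to \<open>f\<close> up to the next fixed point of \<open>f\<close>, by a conjugacy
  that is the identity below \<open>p\<close>; above that fixed point \<open>word_realization\<close> applies.\<close>

lemma word_extension_up:
  assumes b: "homeo_family b" and v: "cyclically_reduced v" and f: "incr_homeo f"
    and agree: "\<And>x. x \<le> p \<Longrightarrow> word_map b v x = f x" and up: "p < f p"
  shows "\<exists>d. homeo_family d \<and> word_map d v = f \<and> (\<forall>j x. x \<le> p \<longrightarrow> b j x \<le> p \<longrightarrow> d j x = b j x)"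
proof -
  have "p < word_map b v p" using agree up by simp
  then obtain e where e: "homeo_family e"
    and e_b: "\<And>j x. x \<le> p \<Longrightarrow> b j x \<le> p \<Longrightarrow> e j x = b j x"
    and e_v: "\<And>x. x \<le> p \<Longrightarrow> word_map e v x = word_map b v x"
    and e_up: "\<And>x. p \<le> x \<Longrightarrow> x < word_map e v x"
    using escaping_path[OF b v] by blast
  interpret e: homeo_family e by (rule e)
  obtain h where h: "strict_mono h" and S: "range h = {y. \<exists>j. y \<le> iter f j p}"
    and h_id: "\<And>x. x \<le> p \<Longrightarrow> h x = x" and h_eq: "\<And>x. h (word_map e v x) = f (h x)"
    using one_sided_conjugacy[OF f e.word[of v], of p] e_v agree up e_up by auto
  obtain r where r: "homeo_family r" and r_v: "word_map r v = f"
    and r_fix: "\<And>j x. f x = x \<Longrightarrow> r j x = x"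
    using word_realization[OF v f] by blast
  interpret r: homeo_family r by (rule r)
  have down: "x \<in> range h" if "y \<in> range h" "x \<le> y" for x y
    using that unfolding S by (auto intro: order_trans)
  have fixed_below: "\<exists>t. t \<notin> range h \<and> t \<le> y \<and> f t = t" if "y \<notin> range h" for y
  proof -
    have "iter f j p \<le> y" for j using that unfolding S by (metis (mono_tags) linear mem_Collect_eq)
    then obtain t where t: "p \<le> t" "t \<le> y" "f t = t" using fixed_point_above_orbit[OF f, of p y] by blast
    have "t \<notin> range h"
    proof
      assume "t \<in> range h"
      then obtain j where "t \<le> iter f j p" unfolding S by blast
      then have "iter f (- j) t \<le> iter f (- j) (iter f j p)"
        by (simp add: incr_homeo_le[OF incr_homeo_iter[OF f]])
      then have "t \<le> p" by (simp add: iter_fixed[OF f t(3)] iter_0[OF f] flip: iter_add[OF f])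
      then show False using t up by simp
    qed
    with t show ?thesis by blast
  qed
  \<comment> \<open>The fixed points of \<open>f\<close> outside \<open>range h\<close> are fixed by \<open>r j\<close> and keep it from entering \<open>range h\<close>.\<close>
  have inv: "r j y \<in> range h \<longleftrightarrow> y \<in> range h" for j y
  proof -
    have "t \<le> r j y \<longleftrightarrow> t \<le> y" if "f t = t" for t
      using incr_homeo_le[OF r.homeo, of j t y] r_fix[OF that] by simp
    then show ?thesis using fixed_below down by metis
  qed
  define d where "d j = transplant h (e j) (r j)" for j
  have d: "homeo_family d"
    by standard (simp add: d_def incr_homeo_transplant[OF h down e.homeo r.homeo inv])
  have "word_map d v y = f y" for y
  proof (cases "y \<in> range h")
    case True
    then obtain x where x: "y = h x" by blast
    have "word_map d v (h x) = h (word_map e v x)"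
      by (rule word_map_equivariant[OF e d]) (simp add: d_def transplant_range[OF h])
    then show ?thesis using x h_eq by simp
  next
    case False
    then have "word_map d v y = word_map r v y"
      by (intro word_map_cong_on(1)[OF r d, of "- range h"]) (auto simp: inv d_def transplant_def)
    then show ?thesis by (simp add: r_v)
  qed
  moreover have "d j x = b j x" if "x \<le> p" "b j x \<le> p" for j x
    using transplant_range[OF h, of "e j" "r j" x] that e_b h_id by (simp add: d_def)
  ultimately show ?thesis using d by (intro exI[of _ d]) auto
qed

lemma step_letter_inv_word:
  assumes "v \<noteq> []" shows "step_letter (inv_word v) i = flip (step_letter v (- i - 1))"
proof -
  let ?l = "int (length v)"
  define k where "k = (- i - 1) mod ?l"
  have k: "0 \<le> k" "k < ?l" using assms by (simp_all add: k_def)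
  define q where "q = (- i - 1) div ?l"
  have "- i - 1 = k + q * ?l" using mod_div_mult_eq[of "- i - 1" ?l] by (simp add: k_def q_def)
  then have "i = (?l - 1 - k) + (- q - 1) * ?l" by (simp add: algebra_simps)
  then have "i mod ?l = (?l - 1 - k) mod ?l" by (metis mod_mult_self1)
  then have i: "i mod ?l = ?l - 1 - k" using k by simp
  have "nat k < length v" using k by linarith
  then have "inv_word v ! nat k = flip (v ! (length v - Suc (nat k)))"
    by (simp add: inv_word_def rev_nth)
  moreover have "length v - Suc (nat k) = nat (i mod ?l)" using i k by linarith
  ultimately show ?thesis using k by (simp add: step_letter_def inv_word_def k_def)
qed

lemma cyclically_reduced_inv_word:
  assumes "cyclically_reduced v" shows "cyclically_reduced (inv_word v)"
proof -
  have v0: "v \<noteq> []" using assms by (simp add: cyclically_reduced_def)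
  have "step_letter (inv_word v) (i + 1) \<noteq> flip (step_letter (inv_word v) i)" for i
  proof -
    have "- (i + 1) - 1 = - i - 2" by simp
    then have 1: "step_letter (inv_word v) (i + 1) = flip (step_letter v (- i - 2))"
      by (metis step_letter_inv_word[OF v0])
    have "- i - 2 + 1 = - i - 1" by simp
    then have 2: "step_letter v (- i - 1) \<noteq> flip (step_letter v (- i - 2))"
      using assms unfolding cyclically_reduced_def by metis
    show ?thesis unfolding 1 step_letter_inv_word[OF v0, of i] using 2 by simp
  qed
  then show ?thesis using v0 by (simp add: cyclically_reduced_def inv_word_def)
qed

text \<open>If \<open>f\<close> moves \<open>p\<close> downward, the extension is made for the inverse word and the inverse map from
  the point \<open>f p\<close>, which the inverse map moves upward; this accounts for the minimum. If all
  generators fix \<open>p\<close>, the two sides of \<open>p\<close> are independent of each other.\<close>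

lemma word_extension:
  assumes b: "homeo_family b" and v: "cyclically_reduced v" and f: "incr_homeo f"
    and agree: "\<And>x. x \<le> p \<Longrightarrow> word_map b v x = f x"
    and base: "f p \<noteq> p \<or> (\<forall>j. b j p = p)"
  shows "\<exists>d. homeo_family d \<and> word_map d v = f
    \<and> (\<forall>j x. x \<le> min p (f p) \<longrightarrow> b j x \<le> min p (f p) \<longrightarrow> d j x = b j x)"
proof -
  interpret b: homeo_family b by (rule b)
  consider "p < f p" | "f p < p" | "f p = p" "\<forall>j. b j p = p" using base by fastforce
  then show ?thesis
  proof cases
    case 1
    then show ?thesis using word_extension_up[OF b v f agree 1] by (simp add: min_def)
  next
    case 2
    define p' where "p' = f p"
    have inv_agree: "word_map b (inv_word v) x = finv f x" if "x \<le> p'" for x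
    proof -
      have "finv f x \<le> p" using that f by (simp add: p'_def incr_homeo_inv_le)
      then have "word_map b v (finv f x) = x" using agree f by (simp add: incr_homeo_inv_inv)
      then show ?thesis by (metis b.word_inv)
    qed
    have "p' < finv f p'" using 2 f by (simp add: p'_def incr_homeo_inv_le incr_homeo_inv_inv incr_homeo_less)
    then obtain d where d: "homeo_family d" and dv: "word_map d (inv_word v) = finv f"
      and d_b: "\<forall>j x. x \<le> p' \<longrightarrow> b j x \<le> p' \<longrightarrow> d j x = b j x"
      using word_extension_up[OF b cyclically_reduced_inv_word[OF v] incr_homeo_inv[OF f] inv_agree] by blast
    interpret d: homeo_family d by (rule d)
    have "word_map d v x = f x" for x
    proof -
      have "finv f (word_map d v x) = x" using d.word_inv[of v x] dv by simp
      then show ?thesis using f by (simp add: incr_homeo_inv_le)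
    qed
    then show ?thesis using d d_b 2 by (intro exI[of _ d]) (auto simp: p'_def min_def)
  next
    case 3
    obtain r where r: "homeo_family r" and r_v: "word_map r v = f"
      and r_fix: "\<And>j x. f x = x \<Longrightarrow> r j x = x"
      using word_realization[OF v f] by blast
    interpret r: homeo_family r by (rule r)
    define d where "d j x = (if x \<le> p then b j x else r j x)" for j x
    have bp: "b j p = p" for j using 3 by simp
    have rp: "r j p = p" for j using r_fix 3 by simp
    have d: "homeo_family d"
    proof
      show "incr_homeo (d j)" for j
        using incr_homeo_glue_at[OF b.homeo r.homeo, of j p j] bp rp by (simp add: d_def[abs_def])
    qed
    have "word_map d v x = f x" for x
    proof (cases "x \<le> p")
      case True
      have "b j y \<le> p \<longleftrightarrow> y \<le> p" for j y using incr_homeo_le[OF b.homeo, of j y p] bp by simp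
      then have "word_map d v x = word_map b v x"
        using True by (intro word_map_cong_on(1)[OF b d, of "{..p}"]) (auto simp: d_def)
      then show ?thesis using agree True by simp
    next
      case False
      have "p < r j y \<longleftrightarrow> p < y" for j y using incr_homeo_less[OF r.homeo, of j p y] rp by simp
      then have "word_map d v x = word_map r v x"
        using False by (intro word_map_cong_on(1)[OF r d, of "{p<..}"]) (auto simp: d_def)
      then show ?thesis by (simp add: r_v)
    qed
    then show ?thesis using d 3 by (intro exI[of _ d]) (auto simp: d_def)
  qed
qed


section \<open>Two perturbations that move the end of the line in opposite directions\<close>

definition moves_end :: "bool \<Rightarrow> (real \<Rightarrow> real) \<Rightarrow> bool" where
  "moves_end up g \<longleftrightarrow> (\<forall>\<^sub>F x in at_top. if up then x < g x else g x < x)"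

definition no_common_fixed_point ::
    "'i set \<Rightarrow> ('i \<Rightarrow> real \<Rightarrow> real) \<Rightarrow> 'j set \<Rightarrow> ('j \<Rightarrow> real \<Rightarrow> real) \<Rightarrow> real set \<Rightarrow> bool" where
  "no_common_fixed_point J a I b X \<longleftrightarrow> (\<forall>x\<in>X. \<not> ((\<forall>j\<in>J. a j x = x) \<and> (\<forall>i\<in>I. b i x = x)))"

text \<open>The family \<open>a\<close> is kept up to the largest point \<open>Q\<close> on the trajectory of \<open>p\<close> under the letters of
  \<open>w\<close>, so that the value of \<open>w\<close> is kept up to \<open>p\<close>. Some prefix of the trajectory takes \<open>p\<close> to \<open>Q\<close>,
  hence \<open>Q\<close> is not fixed by all of \<open>a\<close>, as \<open>p\<close> is not. A generator \<open>j0\<close> that moves \<open>Q\<close> is continued as a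
  translation beyond \<open>Q\<close>, which excludes common fixed points there. Between \<open>p\<close> and \<open>Q\<close> there are none
  because the trajectory cannot jump over a common fixed point. Another generator \<open>j1\<close> may move
  the end of the line in either direction, and \<open>word_extension\<close> adapts the second family to the new
  value of \<open>w\<close>.\<close>

lemma perturb_pair:
  assumes a: "homeo_family a" and b: "homeo_family b"
    and w: "fst ` set w \<subseteq> J" and v: "cyclically_reduced v"
    and agree: "\<And>x. x \<le> p \<Longrightarrow> word_map a w x = word_map b v x"
    and moved: "\<exists>j\<in>J. a j p \<noteq> p" and two: "\<And>j. j \<in> J \<Longrightarrow> \<exists>j'\<in>J. j' \<noteq> j"
    and base: "word_map b v p \<noteq> p \<or> (\<forall>i. b i p = p)"
    and no_fix: "no_common_fixed_point J a I b {..p}"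
  shows "\<exists>j\<in>J. \<forall>up. \<exists>a' b'. homeo_family a' \<and> homeo_family b' \<and> word_map a' w = word_map b' v
    \<and> (\<forall>j x. x \<le> p \<longrightarrow> a' j x = a j x)
    \<and> (\<forall>i x. x \<le> min p (word_map b v p) \<longrightarrow> b i x \<le> min p (word_map b v p) \<longrightarrow> b' i x = b i x)
    \<and> no_common_fixed_point J a' I b' UNIV \<and> moves_end up (a' j)"
proof -
  interpret a: homeo_family a by (rule a)
  interpret b: homeo_family b by (rule b)
  define Q where "Q = Max ((\<lambda>i. word_map a (drop i w) p) ` {..length w})"
  have Q: "word_map a (drop i w) p \<le> Q" if "i \<le> length w" for i
    using that by (auto simp: Q_def intro: Max_ge)
  have pQ: "p \<le> Q" using Q[of "length w"] by simp
  have "Q \<in> (\<lambda>i. word_map a (drop i w) p) ` {..length w}" unfolding Q_def by (rule Max_in) auto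
  then obtain u where u: "set u \<subseteq> set w" "Q = word_map a u p" by (auto dest: in_set_dropD)
  have fixed_le_p: "x \<le> p" if "\<forall>j\<in>J. a j x = x" "x \<le> Q" for x
  proof -
    have "word_map a u x = x" using that u w by (intro a.word_fixed) force
    then show ?thesis using that u incr_homeo_le[OF a.word, of u x p] by simp
  qed
  have "\<not> (\<forall>j\<in>J. a j Q = Q)"
  proof
    assume fix_Q: "\<forall>j\<in>J. a j Q = Q"
    then have "Q = p" using fixed_le_p pQ by fastforce
    with fix_Q moved show False by auto
  qed
  then obtain j0 where j0: "j0 \<in> J" "a j0 Q \<noteq> Q" by blast
  then obtain j1 where j1: "j1 \<in> J" "j1 \<noteq> j0" using two by blast
  show ?thesis
  proof (intro bexI[OF _ j1(1)] allI)
    fix up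
    define A0 where "A0 x = (if x \<le> Q then a j0 x else x + (a j0 Q - Q))" for x
    have A0: "incr_homeo A0"
      unfolding A0_def by (rule incr_homeo_glue_at[OF a.homeo incr_homeo_translation]) simp
    have A0_moves: "A0 x \<noteq> x" if "Q \<le> x" for x using that j0 by (auto simp: A0_def)
    define \<sigma> where "\<sigma> = (if up then 1 else - 1 :: real)"
    define T where "T = max (Q + 1) (a j1 Q + 2)"
    have "Q < T" "a j1 Q < T + \<sigma>" by (auto simp: T_def \<sigma>_def)
    then obtain A1 where A1: "incr_homeo A1" and A1_below: "\<And>x. x \<le> Q \<Longrightarrow> A1 x = a j1 x"
      and A1_above: "\<And>x. x \<ge> T \<Longrightarrow> A1 x = x + \<sigma>"
      using incr_homeo_glue[OF a.homeo[of j1] incr_homeo_translation[of \<sigma>], of Q T] by auto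
    define a' where "a' = a(j0 := A0, j1 := A1)"
    have a': "homeo_family a'" by standard (simp add: a'_def A0 A1 a.homeo)
    interpret a': homeo_family a' by (rule a')
    have a'_below: "a' j x = a j x" if "x \<le> Q" for j x
      using that A1_below by (simp add: a'_def A0_def)
    have word_below: "word_map a' w x = word_map a w x" if "x \<le> p" for x
    proof (rule word_map_cong_below[OF a a', of Q])
      fix i assume "i \<le> length w"
      moreover have "word_map a (drop i w) x \<le> word_map a (drop i w) p"
        using that by (simp add: incr_homeo_le[OF a.word])
      ultimately show "word_map a (drop i w) x \<le> Q" using Q by (meson order_trans)
    qed (rule a'_below)
    have f_below: "word_map b v x = word_map a' w x" if "x \<le> p" for x
      using agree word_below that by simp
    define f where "f = word_map a' w"
    have f: "incr_homeo f" unfolding f_def by (rule a'.word)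
    have fb: "word_map b v x = f x" if "x \<le> p" for x using f_below that by (simp add: f_def)
    define P where "P = min p (f p)"
    obtain b' where b': "homeo_family b'" and b'_v: "word_map b' v = f"
      and b'_below: "\<And>i x. x \<le> P \<Longrightarrow> b i x \<le> P \<Longrightarrow> b' i x = b i x"
    proof -
      have "f p \<noteq> p \<or> (\<forall>j. b j p = p)" using base fb[of p] by simp
      from word_extension[OF b v f fb this] show thesis using that unfolding P_def by blast
    qed
    interpret b': homeo_family b' by (rule b')
    \<comment> \<open>If \<open>b i x\<close> lies above \<open>P\<close>, then so does \<open>b' i x\<close>, since both maps take the same point to \<open>P\<close>.\<close>
    have b'_fixed: "b i x = x" if "b' i x = x" "x \<le> P" for i x
    proof (rule ccontr)
      assume neq: "b i x \<noteq> x"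
      show False
      proof (cases "b i x \<le> P")
        case True
        then show False using b'_below[OF that(2)] that(1) neq by simp
      next
        case False
        define y where "y = finv (b i) P"
        have y: "b i y = P" by (simp add: y_def incr_homeo_inv_inv(1)[OF b.homeo])
        have "y < x" using False by (simp add: y_def incr_homeo_inv_le[OF b.homeo])
        then have "b' i y < b' i x" by (simp only: incr_homeo_less[OF b'.homeo])
        moreover have "b' i y = P" using b'_below[of y i] y that(2) \<open>y < x\<close> by simp
        ultimately show False using that by simp
      qed
    qed
    have "no_common_fixed_point J a' I b' UNIV"
      unfolding no_common_fixed_point_def
    proof (intro ballI notI, elim conjE)
      fix x assume fix_a: "\<forall>j\<in>J. a' j x = x" and fix_b: "\<forall>i\<in>I. b' i x = x"
      have "a' j0 x \<noteq> x" if "Q \<le> x" using A0_moves[OF that] j1 by (simp add: a'_def)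
      then have xQ: "x \<le> Q" using fix_a j0 by fastforce
      then have fix_a0: "\<forall>j\<in>J. a j x = x" using fix_a a'_below by simp
      then have xp: "x \<le> p" using fixed_le_p xQ by blast
      have "f x = x" unfolding f_def using fix_a w by (intro a'.word_fixed) force
      then have "x \<le> P" using xp incr_homeo_le[OF f, of x p] by (simp add: P_def)
      then have "\<forall>i\<in>I. b i x = x" using b'_fixed fix_b by blast
      then show False using no_fix fix_a0 xp by (auto simp: no_common_fixed_point_def)
    qed
    moreover have "moves_end up (a' j1)"
      unfolding moves_end_def eventually_at_top_linorder
      using A1_above by (intro exI[of _ T]) (auto simp: a'_def \<sigma>_def)
    moreover have "word_map b v p = f p" using fb by simp
    ultimately show "\<exists>a' b'. homeo_family a' \<and> homeo_family b' \<and> word_map a' w = word_map b' v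
      \<and> (\<forall>j x. x \<le> p \<longrightarrow> a' j x = a j x)
      \<and> (\<forall>i x. x \<le> min p (word_map b v p) \<longrightarrow> b i x \<le> min p (word_map b v p) \<longrightarrow> b' i x = b i x)
      \<and> no_common_fixed_point J a' I b' UNIV \<and> moves_end up (a' j1)"
      using a' b' b'_v b'_below a'_below pQ
      by (intro exI[of _ a'] exI[of _ b']) (simp add: f_def P_def)
  qed
qed

text \<open>Such a word is a power of the generator or of its inverse, since neighbouring letters do not
  cancel.\<close>

lemma single_generator_word_moves:
  assumes b: "homeo_family b" and v: "cyclically_reduced v" and one: "fst ` set v \<subseteq> {j}"
    and moved: "b j p \<noteq> p"
  shows "word_map b v p \<noteq> p"
proof -
  interpret homeo_family b by (rule b)
  have v0: "v \<noteq> []" using v by (simp add: cyclically_reduced_def)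
  define l where "l = step_letter v 0"
  have fst_j: "fst (step_letter v i) = j" for i using step_letter_in[OF v0, of i] one by auto
  have same: "step_letter v (int i) = l" for i
  proof (induction i)
    case (Suc i)
    have "step_letter v (int (Suc i)) \<noteq> flip (step_letter v (int i))"
      using v unfolding cyclically_reduced_def by (metis of_nat_Suc add.commute)
    then show ?case using Suc fst_j[of "int (Suc i)"] fst_j[of "int i"]
      by (cases "step_letter v (int (Suc i))"; cases l) (auto simp: flip_def)
  qed (simp add: l_def)
  have "letter_map b l p \<noteq> p"
    using moved fst_j[of 0] unfolding letter_eq_iff l_def by auto
  then have "traj b v p (Suc i) \<noteq> p" for i
  proof (cases "p < letter_map b l p")
    case True
    have "p < traj b v p (Suc i)"
    proof (induction i)
      case (Suc i)
      then have "letter_map b l p < letter_map b l (traj b v p (Suc i))"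
        by (simp only: incr_homeo_less[OF letter])
      then show ?case using True same[of "Suc i"] by (simp del: of_nat_Suc)
    qed (use True same[of 0] in simp)
    then show ?thesis by simp
  next
    case False
    then have less: "letter_map b l p < p" using \<open>letter_map b l p \<noteq> p\<close> by simp
    have "traj b v p (Suc i) < p"
    proof (induction i)
      case (Suc i)
      then have "letter_map b l (traj b v p (Suc i)) < letter_map b l p"
        by (simp only: incr_homeo_less[OF letter])
      then show ?case using less same[of "Suc i"] by (simp del: of_nat_Suc)
    qed (use less same[of 0] in simp)
    then show ?thesis by simp
  qed
  from this[of "length v - 1"] show ?thesis
    using word_map_drop_traj[OF v0, of "length v" b p] v0 by simp
qed

text \<open>Conjugation by \<open>h\<close> pushes a family into the half-line below \<open>N\<close>, where \<open>N\<close> becomes a common fixed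
  point, and does not affect the family where arguments and values are below \<open>N - 1\<close>.\<close>

lemma compression:
  "\<exists>h :: real \<Rightarrow> real. strict_mono h \<and> range h = {..<N} \<and> (\<forall>x\<le>N - 1. h x = x)"
proof -
  define h where "h x = (if x \<le> N - 1 then x else N - 1 / (x - N + 2))" for x :: real
  have "h x < h y" if "x < y" for x y
  proof (cases "x \<le> N - 1")
    case True
    then have hx: "h x = x" by (simp add: h_def)
    show ?thesis
    proof (cases "y \<le> N - 1")
      case True
      then show ?thesis using hx that by (simp add: h_def)
    next
      case False
      then have "N - 1 < h y" by (simp add: h_def)
      then show ?thesis using hx True by linarith
    qed
  next
    case False
    then have "1 / (y - N + 2) < 1 / (x - N + 2)" using that by (intro divide_strict_left_mono) auto
    then show ?thesis using False that by (simp add: h_def)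
  qed
  moreover have "range h = {..<N}"
  proof (intro equalityI subsetI)
    fix y assume "y \<in> range h"
    then show "y \<in> {..<N}" by (auto simp: h_def split: if_splits)
  next
    fix y assume y: "y \<in> {..<N}"
    show "y \<in> range h"
    proof (cases "y \<le> N - 1")
      case True
      then have "y = h y" by (simp add: h_def)
      then show ?thesis by (rule range_eqI)
    next
      case False
      define x where "x = N - 2 + 1 / (N - y)"
      have "1 < 1 / (N - y)" using False y by simp
      then have "x > N - 1" by (simp add: x_def)
      moreover have "x - N + 2 = 1 / (N - y)" by (simp add: x_def)
      ultimately have "y = h x" by (simp add: h_def)
      then show ?thesis by (rule range_eqI)
    qed
  qed
  ultimately show ?thesis by (intro exI[of _ h]) (auto simp: strict_mono_def h_def)
qed

text \<open>Equality of the values of the two words makes such a pair a representation of the amalgam.\<close>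

definition perturbations ::
  "nat set \<Rightarrow> (nat \<times> bool) list \<Rightarrow> (nat \<Rightarrow> real \<Rightarrow> real) \<Rightarrow> nat set \<Rightarrow> (nat \<times> bool) list
    \<Rightarrow> (nat \<Rightarrow> real \<Rightarrow> real) \<Rightarrow> real \<Rightarrow> ((nat \<Rightarrow> real \<Rightarrow> real) \<times> (nat \<Rightarrow> real \<Rightarrow> real)) set" where
  "perturbations J v a I w b K = {(a', b'). homeo_family a' \<and> homeo_family b'
    \<and> word_map a' v = word_map b' w \<and> no_common_fixed_point J a' I b' UNIV
    \<and> (\<forall>j\<in>J. \<forall>x. \<bar>x\<bar> \<le> K \<longrightarrow> a' j x = a j x) \<and> (\<forall>i\<in>I. \<forall>x. \<bar>x\<bar> \<le> K \<longrightarrow> b' i x = b i x)}"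

lemma no_common_fixed_point_commute:
  "no_common_fixed_point J a I b X \<longleftrightarrow> no_common_fixed_point I b J a X"
  by (auto simp: no_common_fixed_point_def)

text \<open>Let \<open>f\<close> be the common value of the two words; the point is to find a base point \<open>p\<close> for
  \<open>perturb_pair\<close> far to the right. A point moved by \<open>f\<close> will do. If \<open>f\<close> is the identity near the end
  and \<open>b\<close> is trivial there, any point will do, since no point is fixed by both families. If \<open>b\<close> is not
  trivial near the end, then \<open>m \<ge> 2\<close>, for otherwise \<open>f\<close> would be a power of the only generator, and the
  two families exchange their roles. The base point is then a common fixed point of \<open>a\<close>; if there is
  none far to the right, \<open>compression\<close> creates one, which leaves \<open>f\<close> unchanged because \<open>f\<close> is the
  identity near the end.\<close>

lemma perturbations_exist:
  assumes a: "homeo_family a" and b: "homeo_family b"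
    and a_id: "\<And>j. j \<ge> n \<Longrightarrow> a j = id" and b_id: "\<And>i. i \<ge> m \<Longrightarrow> b i = id"
    and n: "n \<ge> 2"
    and v: "cyclically_reduced v" "fst ` set v \<subseteq> {..<n}"
    and w: "cyclically_reduced w" "fst ` set w \<subseteq> {..<m}"
    and eq: "word_map a v = word_map b w"
    and no_fix: "no_common_fixed_point {..<n} a {..<m} b UNIV"
  shows "\<exists>k\<in>{..<n} <+> {..<m}. \<forall>up. \<exists>(a', b') \<in> perturbations {..<n} v a {..<m} w b K.
    moves_end up (case_sum a' b' k)"
proof -
  interpret a: homeo_family a by (rule a)
  interpret b: homeo_family b by (rule b)
  define f where "f = word_map a v"
  have f: "incr_homeo f" unfolding f_def by (rule a.word)
  have fb: "word_map b w = f" using eq by (simp add: f_def)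
  \<comment> \<open>The interval \<open>[- K, K]\<close> and its images under the generators lie below \<open>B\<close>, so that changes beyond \<open>B\<close> are harmless.\<close>
  define B where "B = Max (insert K ((\<lambda>j. a j K) ` {..<n} \<union> (\<lambda>j. b j K) ` {..<m}))"
  have B: "K \<le> B" "\<And>j. j < n \<Longrightarrow> a j K \<le> B" "\<And>j. j < m \<Longrightarrow> b j K \<le> B"
    unfolding B_def by (auto intro: Max_ge)
  have Ba: "x \<le> B" "a j x \<le> B" if "\<bar>x\<bar> \<le> K" "j < n" for x j
  proof -
    have "x \<le> K" using that by simp
    then show "x \<le> B" "a j x \<le> B" using B(1) B(2)[OF that(2)] incr_homeo_le[OF a.homeo, of j x K] by linarith+
  qed
  have Bb: "x \<le> B" "b j x \<le> B" if "\<bar>x\<bar> \<le> K" "j < m" for x j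
  proof -
    have "x \<le> K" using that by simp
    then show "x \<le> B" "b j x \<le> B" using B(1) B(3)[OF that(2)] incr_homeo_le[OF b.homeo, of j x K] by linarith+
  qed
  have all_fixed_a: "(\<forall>j. a j x = x) \<longleftrightarrow> (\<forall>j\<in>{..<n}. a j x = x)" for x
    using a_id by (metis id_apply lessThan_iff not_le)
  have all_fixed_b: "(\<forall>j. b j x = x) \<longleftrightarrow> (\<forall>j\<in>{..<m}. b j x = x)" for x
    using b_id by (metis id_apply lessThan_iff not_le)
  have f_fixed: "f x = x" if "\<forall>j\<in>{..<n}. a j x = x" for x
    unfolding f_def using that all_fixed_a by (intro a.word_fixed) blast
  have two_n: "\<exists>j'\<in>{..<n}. j' \<noteq> j" for j
    using n by (intro bexI[of _ "if j = 0 then 1 else 0"]) auto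
  \<comment> \<open>The case in which the first side is redesigned and the second one is extended.\<close>
  have left: ?thesis
    if moved: "\<exists>j\<in>{..<n}. a j p \<noteq> p" and base: "f p \<noteq> p \<or> (\<forall>i. b i p = p)"
      and pB: "B \<le> p" "B \<le> f p" for p
  proof -
    have "\<exists>j\<in>{..<n}. \<forall>up. \<exists>a' b'. homeo_family a' \<and> homeo_family b' \<and> word_map a' v = word_map b' w
      \<and> (\<forall>j x. x \<le> p \<longrightarrow> a' j x = a j x)
      \<and> (\<forall>i x. x \<le> min p (word_map b w p) \<longrightarrow> b i x \<le> min p (word_map b w p) \<longrightarrow> b' i x = b i x)
      \<and> no_common_fixed_point {..<n} a' {..<m} b' UNIV \<and> moves_end up (a' j)"
      by (rule perturb_pair[OF a b v(2) w(1) _ moved two_n])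
        (use eq base fb no_fix in \<open>auto simp: no_common_fixed_point_def\<close>)
    then obtain j where j: "j < n" and *: "\<And>up. \<exists>a' b'. homeo_family a' \<and> homeo_family b'
      \<and> word_map a' v = word_map b' w \<and> (\<forall>j x. x \<le> p \<longrightarrow> a' j x = a j x)
      \<and> (\<forall>i x. x \<le> min p (f p) \<longrightarrow> b i x \<le> min p (f p) \<longrightarrow> b' i x = b i x)
      \<and> no_common_fixed_point {..<n} a' {..<m} b' UNIV \<and> moves_end up (a' j)"
      unfolding fb by blast
    show ?thesis
    proof (intro bexI[of _ "Inl j"] allI)
      fix up
      obtain a' b' where h: "homeo_family a'" "homeo_family b'" "word_map a' v = word_map b' w"
        "\<And>j x. x \<le> p \<Longrightarrow> a' j x = a j x"
        "\<And>i x. x \<le> min p (f p) \<Longrightarrow> b i x \<le> min p (f p) \<Longrightarrow> b' i x = b i x"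
        "no_common_fixed_point {..<n} a' {..<m} b' UNIV" "moves_end up (a' j)"
        using *[of up] by blast
      have "a' j x = a j x" if "\<bar>x\<bar> \<le> K" "j < n" for j x
        using h(4) Ba[OF that] pB by simp
      moreover have "b' j x = b j x" if "\<bar>x\<bar> \<le> K" "j < m" for j x
        using h(5) Bb[OF that] pB by simp
      ultimately show "\<exists>(a', b') \<in> perturbations {..<n} v a {..<m} w b K. moves_end up (case_sum a' b' (Inl j))"
        using h by (intro bexI[of _ "(a', b')"]) (auto simp: perturbations_def)
    qed (use j in auto)
  qed
  \<comment> \<open>The case in which the second side is redesigned.\<close>
  have right: ?thesis
    if m: "m \<ge> 2" and c: "homeo_family c" and cp: "\<And>j. c j p = p" and moved: "\<exists>j\<in>{..<m}. b j p \<noteq> p"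
      and agree: "\<And>x. x \<le> p \<Longrightarrow> word_map c v x = f x"
      and no_fix': "no_common_fixed_point {..<m} b {..<n} c {..p}"
      and pB: "B \<le> p" and c_a: "\<And>j x. \<bar>x\<bar> \<le> K \<Longrightarrow> j < n \<Longrightarrow> c j x = a j x" for c p
  proof -
    have two_m: "\<exists>j'\<in>{..<m}. j' \<noteq> j" for j
      using m by (intro bexI[of _ "if j = 0 then 1 else 0"]) auto
    have cvp: "word_map c v p = p" using cp by (intro homeo_family.word_fixed[OF c])
    have "\<exists>j\<in>{..<m}. \<forall>up. \<exists>b' a'. homeo_family b' \<and> homeo_family a' \<and> word_map b' w = word_map a' v
      \<and> (\<forall>j x. x \<le> p \<longrightarrow> b' j x = b j x)
      \<and> (\<forall>i x. x \<le> min p (word_map c v p) \<longrightarrow> c i x \<le> min p (word_map c v p) \<longrightarrow> a' i x = c i x)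
      \<and> no_common_fixed_point {..<m} b' {..<n} a' UNIV \<and> moves_end up (b' j)"
      by (rule perturb_pair[OF b c w(2) v(1) _ moved two_m _ no_fix'])
        (use agree fb cp in auto)
    then obtain j where j: "j < m" and *: "\<And>up. \<exists>b' a'. homeo_family b' \<and> homeo_family a'
      \<and> word_map b' w = word_map a' v \<and> (\<forall>j x. x \<le> p \<longrightarrow> b' j x = b j x)
      \<and> (\<forall>i x. x \<le> p \<longrightarrow> c i x \<le> p \<longrightarrow> a' i x = c i x)
      \<and> no_common_fixed_point {..<m} b' {..<n} a' UNIV \<and> moves_end up (b' j)"
      unfolding cvp min.idem by blast
    show ?thesis
    proof (intro bexI[of _ "Inr j"] allI)
      fix up
      obtain b' a' where h: "homeo_family b'" "homeo_family a'" "word_map b' w = word_map a' v"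
        "\<And>j x. x \<le> p \<Longrightarrow> b' j x = b j x" "\<And>i x. x \<le> p \<Longrightarrow> c i x \<le> p \<Longrightarrow> a' i x = c i x"
        "no_common_fixed_point {..<m} b' {..<n} a' UNIV" "moves_end up (b' j)"
        using *[of up] by blast
      have "a' j x = a j x" if "\<bar>x\<bar> \<le> K" "j < n" for j x
        using h(5)[of x j] Ba[OF that] pB c_a[OF that] by simp
      moreover have "b' j x = b j x" if "\<bar>x\<bar> \<le> K" "j < m" for j x
        using h(4) Bb[OF that] pB by simp
      ultimately show "\<exists>(a', b') \<in> perturbations {..<n} v a {..<m} w b K. moves_end up (case_sum a' b' (Inr j))"
        using h by (intro bexI[of _ "(a', b')"])
          (auto simp: perturbations_def no_common_fixed_point_commute[of "{..<m}"])
    qed (use j in auto)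
  qed
  show ?thesis
  proof (cases "\<forall>y. \<exists>p\<ge>y. f p \<noteq> p")
    case True
    then obtain p where p: "max B (finv f B) \<le> p" "f p \<noteq> p" by blast
    have "B \<le> f p" using p f by (simp add: incr_homeo_inv_le)
    moreover have "\<exists>j\<in>{..<n}. a j p \<noteq> p" using f_fixed p by blast
    ultimately show ?thesis using left[of p] p by auto
  next
    case False
    then obtain z where z: "\<And>p. z \<le> p \<Longrightarrow> f p = p" by blast
    show ?thesis
    proof (cases "\<forall>y. \<exists>p\<ge>y. \<exists>j\<in>{..<m}. b j p \<noteq> p")
      case False
      then obtain y where y: "\<And>p. y \<le> p \<Longrightarrow> \<forall>j\<in>{..<m}. b j p = p" by blast
      define p where "p = max z (max y B)"
      have p: "z \<le> p" "y \<le> p" "B \<le> p" by (auto simp: p_def)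
      have "\<exists>j\<in>{..<n}. a j p \<noteq> p" using no_fix y[OF p(2)] by (auto simp: no_common_fixed_point_def)
      then show ?thesis using left[of p] all_fixed_b y p z[OF p(1)] by auto
    next
      case b_moves: True
      have m: "m \<ge> 2"
      proof (rule ccontr)
        assume "\<not> m \<ge> 2"
        then have "m = 0 \<or> m = 1" by auto
        moreover obtain p j where p: "z \<le> p" "j < m" "b j p \<noteq> p" using b_moves by blast
        ultimately have "m = 1" "j = 0" by auto
        moreover from \<open>m = 1\<close> have "fst ` set w \<subseteq> {0}" using w(2) by (simp add: lessThan_Suc)
        ultimately have "word_map b w p \<noteq> p" using single_generator_word_moves[OF b w(1), of 0 p] p by simp
        then show False using z[OF p(1)] fb by simp
      qed
      show ?thesis
      proof (cases "\<forall>y. \<exists>p\<ge>y. \<forall>j\<in>{..<n}. a j p = p")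
        case True
        then obtain p where p: "max z B \<le> p" "\<forall>j\<in>{..<n}. a j p = p" by blast
        have "\<exists>j\<in>{..<m}. b j p \<noteq> p" using no_fix p by (auto simp: no_common_fixed_point_def)
        moreover have "a j p = p" for j using all_fixed_a p by blast
        moreover have "no_common_fixed_point {..<m} b {..<n} a {..p}"
          using no_fix by (auto simp: no_common_fixed_point_def)
        ultimately show ?thesis using right[OF m a, of p] p by (simp add: f_def)
      next
        case False
        then obtain y0 where y0: "\<And>p. y0 \<le> p \<Longrightarrow> \<exists>j\<in>{..<n}. a j p \<noteq> p" by blast
        obtain N where N: "max z (max B y0) + 1 \<le> N" "\<exists>j\<in>{..<m}. b j N \<noteq> N" using b_moves by blast
        then have N1: "z \<le> N - 1" "B \<le> N - 1" "y0 \<le> N - 1" by linarith+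
        obtain h where h: "strict_mono h" and h_range: "range h = {..<N}"
          and h_id: "\<And>x. x \<le> N - 1 \<Longrightarrow> h x = x"
          using compression[of N] by blast
        define c where "c j = transplant h (a j) id" for j
        have c_h: "c j (h x) = h (a j x)" for j x by (simp add: c_def transplant_range[OF h])
        have c_N: "c j N = N" for j by (simp add: c_def transplant_def h_range)
        have c: "homeo_family c"
        proof
          show "incr_homeo (c j)" for j
            unfolding c_def
            by (rule incr_homeo_transplant[OF h _ a.homeo incr_homeo_id]) (auto simp: h_range)
        qed
        have h_eq: "h s = h t \<longleftrightarrow> s = t" for s t using h by (simp add: strict_mono_eq)
        have h_large: "N - 1 < h t" if "N - 1 < t" for t
          using strict_mono_less[OF h, of "N - 1" t] that h_id[of "N - 1"] by simp
        have c_f: "word_map c v x = f x" if "x \<le> N" for x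
        proof (cases "x = N")
          case True
          have "f N = N" using z N1 by simp
          then show ?thesis using True homeo_family.word_fixed[OF c, of v N] c_N by simp
        next
          case False
          then have "x \<in> range h" using that h_range by simp
          then obtain t where t: "x = h t" by blast
          have ch: "word_map c v (h t) = h (f t)"
            unfolding f_def by (rule word_map_equivariant[OF a c]) (rule c_h)
          show ?thesis
          proof (cases "t \<le> N - 1")
            case True
            then have "f t \<le> N - 1" using incr_homeo_le[OF f, of t "N - 1"] z[OF N1(1)] by simp
            then show ?thesis using t ch True h_id by simp
          next
            case False
            then have "N - 1 < h t" "f t = t" using h_large z N1 by auto
            then show ?thesis using t ch z[of "h t"] N1 by simp
          qed
        qed
        have "no_common_fixed_point {..<m} b {..<n} c {..N}"
          unfolding no_common_fixed_point_def
        proof (intro ballI notI, elim conjE)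
          fix x assume x: "x \<in> {..N}" "\<forall>j\<in>{..<m}. b j x = x" "\<forall>j\<in>{..<n}. c j x = x"
          then have "x \<in> range h" using N(2) h_range by force
          then obtain t where t: "x = h t" by blast
          then have a_t: "\<forall>j\<in>{..<n}. a j t = t" using x(3) by (simp add: c_h h_eq)
          then have "t \<le> N - 1" using y0[of t] N1 by force
          then have "x = t" using t h_id by simp
          then show False using a_t x(2) no_fix by (auto simp: no_common_fixed_point_def)
        qed
        moreover have "c j x = a j x" if "\<bar>x\<bar> \<le> K" "j < n" for j x
          using c_h[of j x] h_id[of x] h_id[of "a j x"] Ba[OF that] N1 by simp
        ultimately show ?thesis using right[OF m c c_N N(2) c_f] N1 by simp
      qed
    qed
  qed
qed


section \<open>Homomorphisms from presented groups to the homeomorphism group\<close>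

primrec eval_word :: "('x \<Rightarrow> real \<Rightarrow> real) \<Rightarrow> 'x list \<Rightarrow> real \<Rightarrow> real" where
  "eval_word \<phi> [] = id"
| "eval_word \<phi> (x # u) = \<phi> x \<circ> eval_word \<phi> u"

lemma eval_word_append: "eval_word \<phi> (u @ v) = eval_word \<phi> u \<circ> eval_word \<phi> v"
  by (induction u) (auto simp: comp_assoc)

lemma eval_word_letter_map: "eval_word (letter_map c) u = word_map c u"
  by (induction u) auto

lemma eval_word_cong: "(\<And>x. x \<in> set u \<Longrightarrow> \<phi> x = \<psi> x) \<Longrightarrow> eval_word \<phi> u = eval_word \<psi> u"
  by (induction u) auto

lemma incr_homeo_eval_word: "(\<And>x. x \<in> set u \<Longrightarrow> incr_homeo (\<phi> x)) \<Longrightarrow> incr_homeo (eval_word \<phi> u)"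
  by (induction u) (simp_all add: incr_homeo_id incr_homeo_comp)

lemma word_map_cong:
  assumes "\<And>j. j \<in> fst ` set w \<Longrightarrow> c j = d j" shows "word_map c w = word_map d w"
  using assms by (induction w) (auto simp: letter_map_def)

lemma class_in_carrier: "u \<in> lists X \<Longrightarrow> word_cong X R `` {u} \<in> carrier (presented_monoid X R)"
  unfolding carrier_presented_monoid by (rule imageI)

lemma class_eqI:
  assumes "R \<subseteq> lists X \<times> lists X" "(u, v) \<in> word_cong X R"
  shows "word_cong X R `` {u} = word_cong X R `` {v}"
  by (rule equiv_class_eq[OF equiv_word_cong[OF assms(1)] assms(2)])

lemma presented_monoid_lift:
  assumes R: "R \<subseteq> lists X \<times> lists X"
    and \<phi>: "\<And>x. x \<in> X \<Longrightarrow> incr_homeo (\<phi> x)"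
    and rel: "\<And>u v. (u, v) \<in> R \<Longrightarrow> eval_word \<phi> u = eval_word \<phi> v"
  shows "\<exists>h \<in> hom (presented_monoid X R) homeo_plus.
    \<forall>u\<in>lists X. h (word_cong X R `` {u}) = eval_word \<phi> u"
proof -
  have cong: "eval_word \<phi> u = eval_word \<phi> v" if "(u, v) \<in> word_cong X R" for u v
    using that by induction (auto simp: rel eval_word_append)
  define h where "h A = eval_word \<phi> (SOME u. u \<in> A)" for A
  have h: "h (word_cong X R `` {u}) = eval_word \<phi> u" if "u \<in> lists X" for u
  proof -
    have "u \<in> word_cong X R `` {u}" using word_cong.refl[OF that] by auto
    then have "(SOME v. v \<in> word_cong X R `` {u}) \<in> word_cong X R `` {u}" by (rule someI)
    then show ?thesis unfolding h_def using cong by auto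
  qed
  have "h \<in> hom (presented_monoid X R) homeo_plus"
  proof (rule homI)
    fix a assume "a \<in> carrier (presented_monoid X R)"
    then obtain u where u: "u \<in> lists X" "a = word_cong X R `` {u}"
      unfolding carrier_presented_monoid by blast
    then show "h a \<in> carrier homeo_plus"
      using h[OF u(1)] \<phi> by (auto simp: carrier_homeo_plus intro!: incr_homeo_eval_word)
  next
    fix a b assume "a \<in> carrier (presented_monoid X R)" "b \<in> carrier (presented_monoid X R)"
    then obtain u v where uv: "u \<in> lists X" "a = word_cong X R `` {u}"
      "v \<in> lists X" "b = word_cong X R `` {v}"
      unfolding carrier_presented_monoid by blast
    moreover from uv have "u @ v \<in> lists X" by simp
    ultimately show "h (a \<otimes>\<^bsub>presented_monoid X R\<^esub> b) = h a \<otimes>\<^bsub>homeo_plus\<^esub> h b"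
      by (simp only: presented_monoid_mult[OF R] h eval_word_append homeo_plus_simps)
  qed
  with h show ?thesis by blast
qed

lemma hom_eval_word:
  assumes R: "R \<subseteq> lists X \<times> lists X" and G: "group (presented_monoid X R)"
    and h: "h \<in> hom (presented_monoid X R) homeo_plus" and u: "u \<in> lists X"
  shows "h (word_cong X R `` {u}) = eval_word (\<lambda>x. h (word_cong X R `` {[x]})) u"
  using u
proof (induction u rule: list.induct)
  case Nil
  show ?case using hom_one[OF h G group_homeo_plus] by (simp add: one_presented_monoid)
next
  case (Cons x u)
  then have x: "[x] \<in> lists X" and u: "u \<in> lists X" by auto
  have "h (word_cong X R `` {[x]} \<otimes>\<^bsub>presented_monoid X R\<^esub> word_cong X R `` {u})
      = h (word_cong X R `` {[x]}) \<circ> h (word_cong X R `` {u})"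
    using hom_mult[OF h class_in_carrier[OF x] class_in_carrier[OF u]] by simp
  then show ?case using Cons.IH[OF u] by (simp add: presented_monoid_mult[OF R x u])
qed

section \<open>Free groups\<close>

abbreviation free_class :: "'i set \<Rightarrow> ('i \<times> bool) list \<Rightarrow> ('i \<times> bool) list set" where
  "free_class X u \<equiv> word_cong (X \<times> UNIV) (free_group_rels X) `` {u}"

lemma free_group_rels_lists: "free_group_rels X \<subseteq> lists (X \<times> UNIV) \<times> lists (X \<times> UNIV)"
  by (auto simp: free_group_rels_def)

lemma carrier_free_group: "carrier (free_group X) = free_class X ` lists (X \<times> UNIV)"
  by (simp add: free_group_def carrier_presented_monoid)

lemma one_free_group: "\<one>\<^bsub>free_group X\<^esub> = free_class X []"
  by (simp add: free_group_def one_presented_monoid)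

lemma free_class_cancel:
  assumes "p \<in> lists (X \<times> UNIV)" "q \<in> lists (X \<times> UNIV)" "l \<in> X \<times> UNIV"
  shows "free_class X (p @ [l, flip l] @ q) = free_class X (p @ q)"
proof (rule class_eqI[OF free_group_rels_lists])
  have "([l, flip l], []) \<in> free_group_rels X"
    using assms(3) by (cases l) (auto simp: free_group_rels_def flip_def)
  then have "(p @ [l, flip l] @ q, p @ [] @ q) \<in> word_cong (X \<times> UNIV) (free_group_rels X)"
    using assms by (intro word_cong.append word_cong.refl word_cong.rel)
  then show "(p @ [l, flip l] @ q, p @ q) \<in> word_cong (X \<times> UNIV) (free_group_rels X)" by simp
qed

lemma inv_word_in_lists: "u \<in> lists (X \<times> UNIV) \<Longrightarrow> inv_word u \<in> lists (X \<times> UNIV)"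
  by (auto simp: inv_word_def flip_def in_lists_conv_set mem_Times_iff)

lemma free_class_inv_word:
  "u \<in> lists (X \<times> UNIV) \<Longrightarrow> free_class X (u @ inv_word u) = free_class X []"
proof (induction u rule: rev_induct)
  case (snoc l u)
  then have u: "u \<in> lists (X \<times> UNIV)" "l \<in> X \<times> UNIV" by auto
  have "(u @ [l]) @ inv_word (u @ [l]) = u @ [l, flip l] @ inv_word u" by (simp add: inv_word_def)
  then show ?case using free_class_cancel[OF u(1) inv_word_in_lists[OF u(1)] u(2)] snoc u by simp
qed (simp add: inv_word_def)

lemma free_group_lift:
  assumes c: "homeo_family c"
  shows "\<exists>h \<in> hom (free_group X) homeo_plus. \<forall>u\<in>lists (X \<times> UNIV). h (free_class X u) = word_map c u"
proof -
  interpret c: homeo_family c by (rule c)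
  have "eval_word (letter_map c) u = eval_word (letter_map c) v" if "(u, v) \<in> free_group_rels X" for u v
  proof -
    from that obtain l where l: "u = [l, flip l]" "v = []"
      by (auto simp: free_group_rels_def flip_def)
    have "letter_map c l (letter_map c (flip l) x) = x" for x using c.letter_flip[of "flip l"] by simp
    then show ?thesis using l by (simp add: fun_eq_iff)
  qed
  then show ?thesis
    using presented_monoid_lift[OF free_group_rels_lists, of X "letter_map c"] c.letter
    unfolding free_group_def eval_word_letter_map by blast
qed

text \<open>The value \<open>id\<close> outside \<open>X\<close> makes this a family over the whole index type without moving any
  point.\<close>

definition generator_images :: "'i set \<Rightarrow> ('i \<Rightarrow> 'g) \<Rightarrow> ('g \<Rightarrow> real \<Rightarrow> real) \<Rightarrow> 'i \<Rightarrow> real \<Rightarrow> real" where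
  "generator_images X B h j = (if j \<in> X then h (B j) else id)"

lemma generator_images_homeo:
  assumes "h \<in> hom G homeo_plus" "\<And>j. j \<in> X \<Longrightarrow> B j \<in> carrier G"
  shows "homeo_family (generator_images X B h)"
proof
  fix j
  show "incr_homeo (generator_images X B h j)"
    using hom_in_carrier[OF assms(1) assms(2)] incr_homeo_id
    by (cases "j \<in> X") (auto simp: generator_images_def carrier_homeo_plus)
qed

lemma hom_free_group_word_map:
  assumes h: "h \<in> hom (free_group X) homeo_plus" and u: "u \<in> lists (X \<times> UNIV)"
  shows "h (free_class X u) = word_map (generator_images X (\<lambda>j. free_class X [(j, True)]) h) u"
proof -
  let ?c = "generator_images X (\<lambda>j. free_class X [(j, True)]) h"
  have ev: "h (free_class X u) = eval_word (\<lambda>x. h (free_class X [x])) u" if "u \<in> lists (X \<times> UNIV)" for u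
    using hom_eval_word[OF free_group_rels_lists group_free_group[unfolded free_group_def]
        h[unfolded free_group_def] that] .
  have gen: "free_class X [(j, b)] \<in> carrier (free_group X)" if "j \<in> X" for j b
    unfolding carrier_free_group using that by (intro imageI) auto
  have gen_homeo: "incr_homeo (h (free_class X [(j, b)]))" if "j \<in> X" for j b
    using hom_in_carrier[OF h gen[OF that]] by (simp add: carrier_homeo_plus)
  have "h (free_class X [l]) = letter_map ?c l" if l: "l \<in> X \<times> UNIV" for l
  proof -
    obtain j b where jb: "l = (j, b)" "j \<in> X" using l by auto
    show ?thesis
    proof (cases b)
      case True
      then show ?thesis using jb by (simp add: generator_images_def)
    next
      case False
      have "free_class X [(j, True), (j, False)] = free_class X []"
        using free_class_cancel[of "[]" X "[]" "(j, True)"] jb by (simp add: flip_def)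
      then have "h (free_class X [(j, True)]) \<circ> h (free_class X [(j, False)]) = id"
        using ev[of "[(j, True), (j, False)]"] ev[of "[]"] jb by simp
      then have "h (free_class X [(j, True)]) (h (free_class X [(j, False)]) x) = x" for x
        by (simp add: fun_eq_iff)
      then have "h (free_class X [(j, False)]) x = finv (h (free_class X [(j, True)])) x" for x
        using incr_homeo_inv_le(6)[OF gen_homeo[OF jb(2)]] by blast
      then show ?thesis using False jb by (simp add: generator_images_def fun_eq_iff)
    qed
  qed
  then have "eval_word (\<lambda>x. h (free_class X [x])) u = eval_word (letter_map ?c) u"
    using u by (intro eval_word_cong) auto
  then show ?thesis using ev[OF u] by (simp add: eval_word_letter_map)
qed

text \<open>Choose \<open>v\<close> as short as possible. A cancellation inside \<open>v\<close> would make it shorter, and so would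
  moving a cancelling pair of end letters into the conjugating word.\<close>

lemma cyclic_reduction:
  assumes w: "w \<in> carrier (free_group X)" "w \<noteq> \<one>\<^bsub>free_group X\<^esub>"
  shows "\<exists>u v. u \<in> lists (X \<times> UNIV) \<and> v \<in> lists (X \<times> UNIV)
    \<and> w = free_class X (u @ v @ inv_word u) \<and> cyclically_reduced v"
proof -
  define P where "P v \<longleftrightarrow> v \<in> lists (X \<times> UNIV)
    \<and> (\<exists>u\<in>lists (X \<times> UNIV). w = free_class X (u @ v @ inv_word u))" for v
  obtain v0 where "v0 \<in> lists (X \<times> UNIV)" "w = free_class X v0"
    using w unfolding carrier_free_group by blast
  then have "P v0" unfolding P_def by (intro conjI bexI[of _ "[]"]) (auto simp: inv_word_def)
  then obtain v where v: "P v" and min: "\<And>v'. length v' < length v \<Longrightarrow> \<not> P v'"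
    using ex_has_least_nat[of P v0 length] by (metis not_le)
  obtain u where u: "u \<in> lists (X \<times> UNIV)" and vX: "v \<in> lists (X \<times> UNIV)"
    and wuv: "w = free_class X (u @ v @ inv_word u)"
    using v unfolding P_def by blast
  have v0: "v \<noteq> []"
  proof
    assume "v = []"
    then have "w = free_class X []" using wuv free_class_inv_word[OF u] by simp
    then show False using w by (simp add: one_free_group)
  qed
  have "step_letter v (i + 1) \<noteq> flip (step_letter v i)" for i
  proof
    assume cancel: "step_letter v (i + 1) = flip (step_letter v i)"
    define k where "k = nat ((- i - 1) mod int (length v))"
    have k: "k < length v" "step_letter v i = v ! k"
      using v0 by (simp_all add: k_def step_letter_def nat_less_iff)
    have mod_k: "(- i - 1) mod int (length v) = int k" using v0 by (simp add: k_def)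
    have "(- (i + 1) - 1) mod int (length v) = (int k - 1) mod int (length v)"
      unfolding mod_k[symmetric] by (simp add: mod_diff_left_eq)
    then have next_k: "step_letter v (i + 1) = v ! nat ((int k - 1) mod int (length v))"
      by (simp add: step_letter_def)
    show False
    proof (cases k)
      case (Suc k')
      then have "step_letter v (i + 1) = v ! k'" using next_k k by simp
      then have flip_k: "v ! k = flip (v ! k')" using cancel k(2) by (metis flip_flip)
      define p q where "p = take k' v" and "q = drop (Suc k) v"
      have split: "v = p @ [v ! k', flip (v ! k')] @ q"
        using k Suc flip_k id_take_nth_drop[of k' v] Cons_nth_drop_Suc[of k v] by (simp add: p_def q_def)
      have sets: "set p \<subseteq> set v" "set q \<subseteq> set v"
        by (auto simp: p_def q_def dest: in_set_takeD in_set_dropD)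
      then have pq: "p \<in> lists (X \<times> UNIV)" "q \<in> lists (X \<times> UNIV)"
        using vX by (auto simp: in_lists_conv_set)
      have l: "v ! k' \<in> X \<times> UNIV" using vX k Suc by (simp add: in_lists_conv_set)
      have "free_class X ((u @ p) @ [v ! k', flip (v ! k')] @ (q @ inv_word u))
          = free_class X ((u @ p) @ (q @ inv_word u))"
        using u pq inv_word_in_lists[OF u] l by (intro free_class_cancel) auto
      then have "w = free_class X (u @ (p @ q) @ inv_word u)"
        using wuv split by (metis append.assoc)
      then have "P (p @ q)" using u pq unfolding P_def by auto
      moreover have "length (p @ q) < length v" using k Suc by (simp add: p_def q_def)
      ultimately show False using min by blast
    next
      case 0
      have "(- 1) mod int (length v) = int (length v) - 1" using v0 by (simp add: zmod_minus1)
      moreover have "nat (int (length v) - 1) = length v - 1" by arith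
      ultimately have last_v: "step_letter v (i + 1) = v ! (length v - 1)"
        using next_k 0 by simp
      then have flip_0: "v ! (length v - 1) = flip (v ! 0)" using cancel k 0 by simp
      obtain l v1 where v1: "v = l # v1" using v0 by (cases v) auto
      have "v1 \<noteq> []" using flip_0 v1 by (auto simp: flip_def prod_eq_iff)
      then obtain v' l' where v': "v1 = v' @ [l']" by (cases v1 rule: rev_cases) auto
      have "l' = flip l" using flip_0 v1 v' by (simp add: nth_append)
      then have v_split: "v = [l] @ v' @ [flip l]" using v1 v' by simp
      then have "u @ v @ inv_word u = (u @ [l]) @ v' @ inv_word (u @ [l])" by (simp add: inv_word_def)
      then have "P v'" using wuv u vX v_split unfolding P_def
        by (intro conjI bexI[of _ "u @ [l]"]) auto
      then show False using min[of v'] v_split by simp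
    qed
  qed
  then show ?thesis using u vX wuv v0 by (auto simp: cyclically_reduced_def)
qed

text \<open>Conjugation of the standard basis by \<open>u\<close> yields a basis in which \<open>u @ v @ inv_word u\<close> is spelled
  \<open>v\<close>. The word \<open>u\<close> denotes the same element in both bases, as \<open>u\<close> commutes with itself; this allows
  to go back and forth. Only what is used of a basis is stated: every element is a word in it, and its
  images under a homomorphism to the homeomorphism group can be prescribed.\<close>

lemma adapted_basis:
  assumes w: "w \<in> carrier (free_group X)" "w \<noteq> \<one>\<^bsub>free_group X\<^esub>"
  obtains B v where "\<forall>j\<in>X. B j \<in> carrier (free_group X)"
    and "cyclically_reduced v" and "fst ` set v \<subseteq> X"
    and "\<forall>h\<in>hom (free_group X) homeo_plus. h w = word_map (generator_images X B h) v"
    and "\<forall>g\<in>carrier (free_group X). \<exists>L. fst ` set L \<subseteq> X \<and>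
      (\<forall>h\<in>hom (free_group X) homeo_plus. h g = word_map (generator_images X B h) L)"
    and "\<forall>c. homeo_family c \<longrightarrow> (\<exists>h\<in>hom (free_group X) homeo_plus. \<forall>j\<in>X. h (B j) = c j)"
proof -
  obtain u v where u: "u \<in> lists (X \<times> UNIV)" and v: "v \<in> lists (X \<times> UNIV)"
    and wuv: "w = free_class X (u @ v @ inv_word u)" and red: "cyclically_reduced v"
    using cyclic_reduction[OF w] by blast
  have u': "inv_word u \<in> lists (X \<times> UNIV)" by (rule inv_word_in_lists[OF u])
  define B where "B j = free_class X (u @ [(j, True)] @ inv_word u)" for j
  have B_lists: "u @ [(j, True)] @ inv_word u \<in> lists (X \<times> UNIV)" if "j \<in> X" for j
    using u u' that by simp
  have B: "B j \<in> carrier (free_group X)" if "j \<in> X" for j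
    unfolding carrier_free_group B_def using B_lists[OF that] by blast
  \<comment> \<open>The images of the basis \<open>B\<close> are conjugate to those of the standard one.\<close>
  have images: "\<exists>W d. incr_homeo W \<and> homeo_family d \<and> W = word_map d u
      \<and> (\<forall>z\<in>lists (X \<times> UNIV). h (free_class X z) = word_map d z)
      \<and> (\<forall>z. word_map (generator_images X B h) z = W \<circ> word_map d z \<circ> finv W)"
    if h: "h \<in> hom (free_group X) homeo_plus" for h
  proof -
    define d where "d = generator_images X (\<lambda>j. free_class X [(j, True)]) h"
    have d: "homeo_family d"
      unfolding d_def by (rule generator_images_homeo[OF h]) (auto simp: carrier_free_group)
    interpret d: homeo_family d by (rule d)
    define W where "W = word_map d u"
    have W: "incr_homeo W" unfolding W_def by (rule d.word)
    have finv_finv: "finv (finv W) = W"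
      using incr_homeo_inv_le(5)[OF incr_homeo_inv[OF W]] incr_homeo_inv_inv(2)[OF W] by (auto simp: fun_eq_iff)
    have h_d: "h (free_class X z) = word_map d z" if "z \<in> lists (X \<times> UNIV)" for z
      unfolding d_def by (rule hom_free_group_word_map[OF h that])
    have "generator_images X B h j = finv (finv W) \<circ> d j \<circ> finv W" for j
    proof (cases "j \<in> X")
      case True
      then have "h (B j) = word_map d (u @ [(j, True)] @ inv_word u)"
        unfolding B_def using B_lists by (intro h_d)
      also have "\<dots> = W \<circ> d j \<circ> finv W"
        by (simp add: word_map_append d.inv_word_map W_def comp_assoc)
      finally show ?thesis using True by (simp add: generator_images_def finv_finv)
    next
      case False
      then show ?thesis
        using W by (simp add: generator_images_def finv_finv d_def fun_eq_iff incr_homeo_inv_inv)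
    qed
    then have "generator_images X B h = (\<lambda>j. finv (finv W) \<circ> d j \<circ> finv W)" by (rule ext)
    then have "word_map (generator_images X B h) z = W \<circ> word_map d z \<circ> finv W" for z
      using word_map_conjugate(2)[OF d incr_homeo_inv[OF W]] by (simp add: finv_finv)
    then show ?thesis using W d h_d W_def by blast
  qed
  have w_v: "h w = word_map (generator_images X B h) v" if h: "h \<in> hom (free_group X) homeo_plus" for h
  proof -
    obtain W d where W: "incr_homeo W" "homeo_family d" "W = word_map d u"
      "\<And>z. z \<in> lists (X \<times> UNIV) \<Longrightarrow> h (free_class X z) = word_map d z"
      "\<And>z. word_map (generator_images X B h) z = W \<circ> word_map d z \<circ> finv W"
      using images[OF h] by blast
    have "h w = word_map d (u @ v @ inv_word u)" unfolding wuv using u v u' by (intro W(4)) simp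
    then show ?thesis unfolding W(5)
      by (simp add: word_map_append homeo_family.inv_word_map[OF W(2)] W(3) comp_assoc)
  qed
  have words: "\<exists>L. fst ` set L \<subseteq> X \<and>
      (\<forall>h\<in>hom (free_group X) homeo_plus. h g = word_map (generator_images X B h) L)"
    if g: "g \<in> carrier (free_group X)" for g
  proof -
    obtain z where z: "z \<in> lists (X \<times> UNIV)" "g = free_class X z"
      using g unfolding carrier_free_group by blast
    have "h g = word_map (generator_images X B h) (inv_word u @ z @ u)"
      if h: "h \<in> hom (free_group X) homeo_plus" for h
    proof -
      obtain W d where W: "incr_homeo W" "homeo_family d" "W = word_map d u"
        "\<And>z. z \<in> lists (X \<times> UNIV) \<Longrightarrow> h (free_class X z) = word_map d z"
        "\<And>z. word_map (generator_images X B h) z = W \<circ> word_map d z \<circ> finv W"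
        using images[OF h] by blast
      have "word_map d (inv_word u) = finv W" using homeo_family.inv_word_map[OF W(2)] W(3) by simp
      then show ?thesis unfolding W(5) using W(4)[OF z(1)] z(2) incr_homeo_inv_inv[OF W(1)]
        by (simp add: word_map_append W(3)[symmetric] fun_eq_iff)
    qed
    moreover have "fst ` set (inv_word u @ z @ u) \<subseteq> X" using u u' z by (auto simp: in_lists_conv_set)
    ultimately show ?thesis by blast
  qed
  have lift: "\<exists>h\<in>hom (free_group X) homeo_plus. \<forall>j\<in>X. h (B j) = c j" if c: "homeo_family c" for c
  proof -
    interpret c: homeo_family c by (rule c)
    define V where "V = word_map c u"
    have V: "incr_homeo V" unfolding V_def by (rule c.word)
    define d where "d j = finv V \<circ> c j \<circ> V" for j
    have d: "homeo_family d" "word_map d z = finv V \<circ> word_map c z \<circ> V" for z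
      unfolding d_def using word_map_conjugate[OF c V] by auto
    obtain h where h: "h \<in> hom (free_group X) homeo_plus"
      "\<And>z. z \<in> lists (X \<times> UNIV) \<Longrightarrow> h (free_class X z) = word_map d z"
      using free_group_lift[OF d(1)] by blast
    have "h (B j) = c j" if "j \<in> X" for j
      unfolding B_def h(2)[OF B_lists[OF that]] d(2)
      by (simp add: word_map_append c.inv_word_map V_def[symmetric] fun_eq_iff incr_homeo_inv_inv[OF V])
    then show ?thesis using h(1) by blast
  qed
  have "fst ` set v \<subseteq> X" using v by (auto simp: in_lists_conv_set)
  then show thesis using that[of B v] B red w_v words lift by simp
qed


section \<open>Representations of an amalgam\<close>

locale cyclic_amalgam_pair =
  fixes A :: "('a, 'k) monoid_scheme" and a :: 'a
    and B :: "('b, 'l) monoid_scheme" and b :: 'b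
  assumes A: "group A" and B: "group B" and a: "a \<in> carrier A" and b: "b \<in> carrier B"
begin

abbreviation "G \<equiv> cyclic_amalgam A a B b"
abbreviation "\<Sigma> \<equiv> carrier A <+> carrier B"
abbreviation "rels \<equiv> amalgam_rels integer_group A B
  (\<lambda>k::int. a [^]\<^bsub>A\<^esub> k) (\<lambda>k::int. b [^]\<^bsub>B\<^esub> k)"
abbreviation "cls u \<equiv> word_cong \<Sigma> rels `` {u}"

lemma G_def: "G = presented_monoid \<Sigma> rels"
  by (simp add: cyclic_amalgam_def amalgamated_product_def)

lemma group_G: "group G"
  by (rule group_cyclic_amalgam[OF A B a b])

lemma rels_lists: "rels \<subseteq> lists \<Sigma> \<times> lists \<Sigma>"
proof -
  interpret A: group A by (rule A)
  interpret B: group B by (rule B)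
  show ?thesis using a b by (auto simp: amalgam_rels_def)
qed

lemma cls_mult: "u \<in> lists \<Sigma> \<Longrightarrow> v \<in> lists \<Sigma> \<Longrightarrow> cls u \<otimes>\<^bsub>G\<^esub> cls v = cls (u @ v)"
  unfolding G_def by (rule presented_monoid_mult[OF rels_lists])

lemma rel_eq: "(u, v) \<in> rels \<Longrightarrow> cls u = cls v"
  by (rule class_eqI[OF rels_lists word_cong.rel])

lemma inl_hom: "(\<lambda>x. cls [Inl x]) \<in> hom A G"
proof (rule homI)
  fix x assume "x \<in> carrier A"
  then have "[Inl x] \<in> lists \<Sigma>" by auto
  then show "cls [Inl x] \<in> carrier G" unfolding G_def by (rule class_in_carrier)
next
  fix x y assume xy: "x \<in> carrier A" "y \<in> carrier A"
  then have "([Inl x, Inl y], [Inl (x \<otimes>\<^bsub>A\<^esub> y)]) \<in> rels" unfolding amalgam_rels_def by blast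
  from rel_eq[OF this] show "cls [Inl (x \<otimes>\<^bsub>A\<^esub> y)] = cls [Inl x] \<otimes>\<^bsub>G\<^esub> cls [Inl y]"
    using xy cls_mult[of "[Inl x]" "[Inl y]"] by auto
qed

lemma inr_hom: "(\<lambda>y. cls [Inr y]) \<in> hom B G"
proof (rule homI)
  fix x assume "x \<in> carrier B"
  then have "[Inr x] \<in> lists \<Sigma>" by auto
  then show "cls [Inr x] \<in> carrier G" unfolding G_def by (rule class_in_carrier)
next
  fix x y assume xy: "x \<in> carrier B" "y \<in> carrier B"
  then have "([Inr x, Inr y], [Inr (x \<otimes>\<^bsub>B\<^esub> y)]) \<in> rels" unfolding amalgam_rels_def by blast
  from rel_eq[OF this] show "cls [Inr (x \<otimes>\<^bsub>B\<^esub> y)] = cls [Inr x] \<otimes>\<^bsub>G\<^esub> cls [Inr y]"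
    using xy cls_mult[of "[Inr x]" "[Inr y]"] by auto
qed

lemma amalgamated: "cls [Inl a] = cls [Inr b]"
proof (rule rel_eq)
  interpret A: group A by (rule A)
  interpret B: group B by (rule B)
  have "([Inl (a [^]\<^bsub>A\<^esub> (1::int))], [Inr (b [^]\<^bsub>B\<^esub> (1::int))]) \<in> rels"
    unfolding amalgam_rels_def by auto
  then show "([Inl a], [Inr b]) \<in> rels" using a b by (simp add: A.int_pow_1 B.int_pow_1)
qed

lemma Rep_restrict:
  assumes "\<rho> \<in> Rep G"
  shows "(\<lambda>x. \<rho> (cls [Inl x])) \<in> hom A homeo_plus" and "(\<lambda>y. \<rho> (cls [Inr y])) \<in> hom B homeo_plus"
    and "\<rho> (cls [Inl a]) = \<rho> (cls [Inr b])"
proof -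
  have "\<rho> \<in> hom G homeo_plus" using assms by (simp add: Rep_def)
  from hom_compose[OF inl_hom this] hom_compose[OF inr_hom this]
  show "(\<lambda>x. \<rho> (cls [Inl x])) \<in> hom A homeo_plus" and "(\<lambda>y. \<rho> (cls [Inr y])) \<in> hom B homeo_plus"
    by (simp_all add: comp_def)
  show "\<rho> (cls [Inl a]) = \<rho> (cls [Inr b])" by (simp only: amalgamated)
qed

lemma Rep_eval:
  assumes "\<rho> \<in> Rep G" "z \<in> lists \<Sigma>"
  shows "\<rho> (cls z) = eval_word (\<lambda>s. \<rho> (cls [s])) z"
  by (rule hom_eval_word[OF rels_lists group_G[unfolded G_def] _ assms(2)])
    (use assms(1) in \<open>simp add: Rep_def G_def\<close>)

lemma Rep_lift:
  assumes h: "h \<in> hom A homeo_plus" and k: "k \<in> hom B homeo_plus" and hk: "h a = k b"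
  shows "\<exists>\<rho>\<in>Rep G. (\<forall>x\<in>carrier A. \<rho> (cls [Inl x]) = h x) \<and> (\<forall>y\<in>carrier B. \<rho> (cls [Inr y]) = k y)"
proof -
  let ?\<phi> = "case_sum h k"
  have homeo: "incr_homeo (?\<phi> s)" if "s \<in> \<Sigma>" for s
    using that hom_in_carrier[OF h] hom_in_carrier[OF k] by (auto simp: carrier_homeo_plus)
  have pow: "h (a [^]\<^bsub>A\<^esub> i) = k (b [^]\<^bsub>B\<^esub> i)" for i :: int
    using hom_int_pow[OF h a A group_homeo_plus] hom_int_pow[OF k b B group_homeo_plus] hk by simp
  have rel: "eval_word ?\<phi> u = eval_word ?\<phi> v" if "(u, v) \<in> rels" for u v
    using that hom_mult[OF h] hom_mult[OF k] pow
      hom_one[OF h A group_homeo_plus] hom_one[OF k B group_homeo_plus]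
    by (auto simp: amalgam_rels_def)
  obtain g where g: "g \<in> hom G homeo_plus" "\<And>z. z \<in> lists \<Sigma> \<Longrightarrow> g (cls z) = eval_word ?\<phi> z"
    using presented_monoid_lift[OF rels_lists homeo rel] unfolding G_def by blast
  define \<rho> where "\<rho> = restrict g (carrier G)"
  have \<rho>: "\<rho> \<in> Rep G"
    using group.hom_restrict[OF group_G g(1), of \<rho>] by (simp add: Rep_def \<rho>_def)
  moreover have "\<rho> (cls [Inl x]) = h x" if "x \<in> carrier A" for x
    proof -
    have "[Inl x] \<in> lists \<Sigma>" using that by auto
    then show ?thesis using g(2)[of "[Inl x]"] hom_in_carrier[OF inl_hom that] by (simp add: \<rho>_def)
  qed
  moreover have "\<rho> (cls [Inr y]) = k y" if "y \<in> carrier B" for y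
    proof -
    have "[Inr y] \<in> lists \<Sigma>" using that by auto
    then show ?thesis using g(2)[of "[Inr y]"] hom_in_carrier[OF inr_hom that] by (simp add: \<rho>_def)
  qed
  ultimately show ?thesis by blast
qed

end

lemma word_map_reindex: "word_map (\<lambda>j. c (\<iota> j)) w = word_map c (map (apfst \<iota>) w)"
  by (induction w) (auto simp: letter_map_def)

section \<open>Neighbourhoods of a representation\<close>

text \<open>If \<open>g\<close> agrees with \<open>f\<close> on an interval around a compact set, both maps have the same image of
  that set.\<close>

lemma homeo_plus_topology_nbhd:
  assumes "openin homeo_plus_topology V" "f \<in> V"
  shows "\<exists>K. \<forall>g\<in>carrier homeo_plus. (\<forall>x. \<bar>x\<bar> \<le> K \<longrightarrow> g x = f x) \<longrightarrow> g \<in> V"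
proof -
  have "generate_topology_on {{f \<in> carrier homeo_plus. f ` K \<subseteq> U} | K U. compact K \<and> open U} V"
    using assms(1) unfolding homeo_plus_topology_def openin_topology_generated_by_iff .
  then show ?thesis
    using assms(2)
  proof (induction V)
    case Empty
    then show ?case by simp
  next
    case (Int V W)
    then obtain K L where KL: "\<forall>g\<in>carrier homeo_plus. (\<forall>x. \<bar>x\<bar> \<le> K \<longrightarrow> g x = f x) \<longrightarrow> g \<in> V"
      "\<forall>g\<in>carrier homeo_plus. (\<forall>x. \<bar>x\<bar> \<le> L \<longrightarrow> g x = f x) \<longrightarrow> g \<in> W" by blast
    show ?case by (rule exI[of _ "max K L"]) (use KL in force)
  next
    case (UN \<V>)
    then show ?case by (meson UnionE UnionI)
  next
    case (Basis V)
    then obtain C U where C: "compact C" "V = {f \<in> carrier homeo_plus. f ` C \<subseteq> U}" by blast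
    obtain K where K: "\<And>x. x \<in> C \<Longrightarrow> norm x \<le> K"
      using compact_imp_bounded[OF C(1)] unfolding bounded_iff by blast
    show ?case
    proof (intro exI[of _ K] ballI impI)
      fix g assume g: "g \<in> carrier homeo_plus" "\<forall>x. \<bar>x\<bar> \<le> K \<longrightarrow> g x = f x"
      then have "g ` C = f ` C" using K by (intro image_cong) auto
      then show "g \<in> V" using g Basis.prems C by simp
    qed
  qed
qed

lemma Rep_topology_nbhd:
  assumes U: "openin (Rep_topology G) U" and \<rho>: "\<rho> \<in> U"
  shows "\<exists>S K. finite S \<and> S \<subseteq> carrier G
    \<and> (\<forall>\<rho>'\<in>Rep G. (\<forall>g\<in>S. \<forall>x. \<bar>x\<bar> \<le> K \<longrightarrow> \<rho>' g x = \<rho> g x) \<longrightarrow> \<rho>' \<in> U)"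
proof -
  obtain T where T: "openin (product_topology (\<lambda>_. homeo_plus_topology) (carrier G)) T" "U = T \<inter> Rep G"
    using U unfolding Rep_topology_def openin_subtopology by blast
  then obtain V where V: "finite {g \<in> carrier G. V g \<noteq> topspace homeo_plus_topology}"
    "\<And>g. g \<in> carrier G \<Longrightarrow> openin homeo_plus_topology (V g)"
    "\<rho> \<in> PiE (carrier G) V" "PiE (carrier G) V \<subseteq> T"
  proof -
    have "\<rho> \<in> T" using \<rho> T(2) by simp
    from bspec[OF T(1)[unfolded openin_product_topology_alt] this] show thesis
      by (elim exE conjE) (rule that, assumption, erule bspec, assumption+)
  qed
  define S where "S = {g \<in> carrier G. V g \<noteq> topspace homeo_plus_topology}"
  have "\<exists>K. \<forall>h\<in>carrier homeo_plus. (\<forall>x. \<bar>x\<bar> \<le> K \<longrightarrow> h x = \<rho> g x) \<longrightarrow> h \<in> V g" if "g \<in> carrier G" for g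
    using homeo_plus_topology_nbhd[OF V(2)[OF that]] V(3) that by blast
  then obtain \<kappa> where \<kappa>: "\<And>g h. g \<in> carrier G \<Longrightarrow> h \<in> carrier homeo_plus
      \<Longrightarrow> (\<And>x. \<bar>x\<bar> \<le> \<kappa> g \<Longrightarrow> h x = \<rho> g x) \<Longrightarrow> h \<in> V g"
    by metis
  define K where "K = Max (insert 0 (\<kappa> ` S))"
  have S: "finite S" using V(1) by (simp add: S_def)
  have K: "\<kappa> g \<le> K" if "g \<in> S" for g using that S by (simp add: K_def)
  have "\<rho>' \<in> U" if \<rho>': "\<rho>' \<in> Rep G" and near: "\<forall>g\<in>S. \<forall>x. \<bar>x\<bar> \<le> K \<longrightarrow> \<rho>' g x = \<rho> g x" for \<rho>'
  proof -
    have "\<rho>' g \<in> V g" if g: "g \<in> carrier G" for g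
    proof -
      have \<rho>'g: "\<rho>' g \<in> carrier homeo_plus" using \<rho>' g by (auto simp: Rep_def hom_def)
      show ?thesis
      proof (cases "g \<in> S")
        case True
        then show ?thesis using near K[OF True] by (intro \<kappa>[OF g \<rho>'g]) force
      next
        case False
        then show ?thesis using g \<rho>'g by (auto simp: S_def topspace_homeo_plus_topology)
      qed
    qed
    then have "\<rho>' \<in> PiE (carrier G) V" using \<rho>' by (auto simp: Rep_def PiE_def)
    then show ?thesis using V(4) T(2) \<rho>' by blast
  qed
  then show ?thesis using S by (intro exI[of _ S] exI[of _ K]) (auto simp: S_def)
qed

text \<open>A letter of the word has to be controlled only on an interval that contains the images of
  \<open>[- K, K]\<close> under the rest of the word, before and after the letter acts.\<close>

lemma word_map_near:
  assumes c: "homeo_family c"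
  shows "\<exists>K'. \<forall>d. homeo_family d \<longrightarrow> (\<forall>j\<in>fst ` set w. \<forall>x. \<bar>x\<bar> \<le> K' \<longrightarrow> d j x = c j x)
    \<longrightarrow> (\<forall>x. \<bar>x\<bar> \<le> K \<longrightarrow> word_map d w x = word_map c w x)"
proof (induction w)
  case (Cons l w)
  interpret c: homeo_family c by (rule c)
  obtain K1 where K1: "\<And>d x. homeo_family d \<Longrightarrow> (\<And>j x. j \<in> fst ` set w \<Longrightarrow> \<bar>x\<bar> \<le> K1 \<Longrightarrow> d j x = c j x)
      \<Longrightarrow> \<bar>x\<bar> \<le> K \<Longrightarrow> word_map d w x = word_map c w x"
    using Cons.IH by metis
  have bound: "\<bar>g x\<bar> \<le> max \<bar>g K\<bar> \<bar>g (- K)\<bar>" if "incr_homeo g" "\<bar>x\<bar> \<le> K" for g x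
    using incr_homeo_le[OF that(1), of x K] incr_homeo_le[OF that(1), of "- K" x] that(2) by auto
  define M where "M w = max \<bar>word_map c w K\<bar> \<bar>word_map c w (- K)\<bar>" for w
  define K' where "K' = max K1 (max (M w) (M (l # w)))"
  show ?case
  proof (intro exI[of _ K'] allI impI)
    fix d x assume d: "homeo_family d"
      and near: "\<forall>j\<in>fst ` set (l # w). \<forall>x. \<bar>x\<bar> \<le> K' \<longrightarrow> d j x = c j x" and x: "\<bar>x\<bar> \<le> K"
    interpret d: homeo_family d by (rule d)
    have 1: "word_map d w x = word_map c w x"
    proof (rule K1[OF d _ x])
      fix j y assume "j \<in> fst ` set w" "\<bar>y\<bar> \<le> K1"
      then have "j \<in> fst ` set (l # w)" "\<bar>y\<bar> \<le> K'" by (auto simp: K'_def)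
      then show "d j y = c j y" using near by blast
    qed
    define y z where "y = word_map c w x" and "z = word_map c (l # w) x"
    have "\<bar>y\<bar> \<le> M w" "\<bar>z\<bar> \<le> M (l # w)"
      unfolding M_def y_def z_def by (rule bound[OF c.word x])+
    then have "\<bar>y\<bar> \<le> K'" "\<bar>z\<bar> \<le> K'" by (auto simp: K'_def)
    then have "d (fst l) y = c (fst l) y" "d (fst l) z = c (fst l) z" using near by auto
    moreover have "letter_map c l y = z" by (simp add: y_def z_def)
    ultimately have "letter_map d l y = z" unfolding d.letter_eq_iff c.letter_eq_iff by simp
    then have "letter_map d l (word_map c w x) = letter_map c l (word_map c w x)"
      by (simp add: y_def z_def)
    with 1 show "word_map d (l # w) x = word_map c (l # w) x" by simp
  qed
qed simp

section \<open>Motion near the end is invariant under semi-conjugacy\<close>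

lemma moves_end_finv: "incr_homeo f \<Longrightarrow> moves_end up (finv f) \<longleftrightarrow> moves_end (\<not> up) f"
  by (cases up) (simp_all add: moves_end_def incr_homeo_inv_le)

text \<open>Suppose that \<open>h\<close> does not move \<open>y\<close> upward, where \<open>y\<close> is far enough to the right. The points \<open>x\<close>
  to the right of \<open>X\<close> with \<open>c x \<le> y\<close> then form a set that is invariant under \<open>f\<close>, and bounded because \<open>c\<close> is
  proper. This is absurd, since \<open>f\<close> moves the supremum of the set upward.\<close>

lemma moves_end_up_semiconjugate:
  assumes c: "mono c" "proper_map_real c" and f: "incr_homeo f" and h: "incr_homeo h"
    and eq: "\<And>x. c (f x) = h (c x)" and up: "moves_end True f"
  shows "moves_end True h"
proof -
  obtain X where X: "\<And>x. X \<le> x \<Longrightarrow> x < f x"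
    using up unfolding moves_end_def eventually_at_top_linorder by auto
  have "y < h y" if y: "c X \<le> y" for y
  proof (rule ccontr)
    assume not_up: "\<not> y < h y"
    define S where "S = {x. X \<le> x \<and> c x \<le> y}"
    have "S \<subseteq> c -` {c X..y}" using c(1) by (auto simp: S_def mono_def)
    moreover have "bounded (c -` {c X..y})" using c(2) by (simp add: proper_map_real_def)
    ultimately have "bounded S" using bounded_subset by metis
    then have bdd: "bdd_above S" by (rule bounded_imp_bdd_above)
    have XS: "X \<in> S" using y by (simp add: S_def)
    have f_S: "f x \<in> S" if "x \<in> S" for x
    proof -
      have "h (c x) \<le> h y" using that h by (simp add: S_def incr_homeo_le)
      then show ?thesis using that not_up X[of x] by (simp add: S_def eq)
    qed
    define s where "s = Sup S"
    have "X \<le> s" unfolding s_def by (rule cSup_upper[OF XS bdd])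
    then have "finv f s < s" using X f by (simp add: incr_homeo_inv_le)
    then obtain x where "x \<in> S" "finv f s < x" using less_cSupD[of S "finv f s"] XS by (auto simp: s_def)
    then have "f x \<in> S" "s < f x" using f_S f by (auto simp: incr_homeo_inv_le)
    then show False using cSup_upper[OF _ bdd, of "f x"] by (simp add: s_def)
  qed
  then show ?thesis unfolding moves_end_def eventually_at_top_linorder by auto
qed

lemma moves_end_semiconjugate:
  assumes c: "mono c" "proper_map_real c" and f: "incr_homeo f" and h: "incr_homeo h"
    and eq: "\<And>x. c (f x) = h (c x)" and up: "moves_end up f"
  shows "moves_end up h"
proof (cases up)
  case True
  then show ?thesis using moves_end_up_semiconjugate[OF c f h eq] up by simp
next
  case False
  have "h (c (finv f x)) = c x" for x using eq[of "finv f x"] f by (simp add: incr_homeo_inv_inv)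
  then have "c (finv f x) = finv h (c x)" for x using h by (simp add: incr_homeo_inv_le)
  then have "moves_end True (finv h)"
    using moves_end_up_semiconjugate[OF c incr_homeo_inv[OF f] incr_homeo_inv[OF h]] up False
    by (simp add: moves_end_finv[OF f])
  then show ?thesis using False by (simp add: moves_end_finv[OF h])
qed

lemma moves_end_exclusive: "\<not> (moves_end True f \<and> moves_end False f)"
proof
  assume "moves_end True f \<and> moves_end False f"
  then have "\<forall>\<^sub>F x in at_top. x < f x \<and> f x < x" by (simp add: moves_end_def eventually_conj_iff)
  then have "\<forall>\<^sub>F x in (at_top :: real filter). False" by (rule eventually_mono) linarith
  then show False by simp
qed

lemma semi_conjugated_moves_end:
  assumes "\<rho>' \<in> Rep G" "\<rho> \<in> Rep G" "semi_conjugated G \<rho>' \<rho>" "g \<in> carrier G" "moves_end up (\<rho>' g)"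
  shows "moves_end up (\<rho> g)"
proof -
  obtain c where c: "mono c" "proper_map_real c" "c \<circ> \<rho>' g = \<rho> g \<circ> c"
    using assms(3,4) unfolding semi_conjugated_def by blast
  have "incr_homeo (\<rho>' g)" "incr_homeo (\<rho> g)"
    using assms by (auto simp: Rep_def hom_def carrier_homeo_plus)
  then show ?thesis using moves_end_semiconjugate[OF c(1,2) _ _ _ assms(5)] c(3)
    by (metis comp_apply)
qed


lemma homeo_family_case_sum:
  "homeo_family a \<Longrightarrow> homeo_family b \<Longrightarrow> homeo_family (case_sum a b)"
  by (auto simp: homeo_family_def split: sum.split)

context cyclic_amalgam_pair
begin

definition generators :: "'i set \<Rightarrow> ('i \<Rightarrow> 'a) \<Rightarrow> 'j set \<Rightarrow> ('j \<Rightarrow> 'b)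
    \<Rightarrow> (('a + 'b) list set \<Rightarrow> real \<Rightarrow> real) \<Rightarrow> 'i + 'j \<Rightarrow> real \<Rightarrow> real" where
  "generators J C I D \<rho> = case_sum (generator_images J C (\<lambda>x. \<rho> (cls [Inl x])))
     (generator_images I D (\<lambda>y. \<rho> (cls [Inr y])))"

text \<open>The same word serves for all representations, so that representations that are close on the
  generators are close at \<open>g\<close>.\<close>

lemma Rep_words:
  assumes C: "\<And>x. x \<in> carrier A \<Longrightarrow> \<exists>L. fst ` set L \<subseteq> J \<and>
      (\<forall>h\<in>hom A homeo_plus. h x = word_map (generator_images J C h) L)"
    and D: "\<And>y. y \<in> carrier B \<Longrightarrow> \<exists>L. fst ` set L \<subseteq> I \<and>
      (\<forall>h\<in>hom B homeo_plus. h y = word_map (generator_images I D h) L)"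
    and g: "g \<in> carrier G"
  shows "\<exists>L. fst ` set L \<subseteq> J <+> I \<and> (\<forall>\<rho>\<in>Rep G. \<rho> g = word_map (generators J C I D \<rho>) L)"
proof -
  have "\<exists>L. fst ` set L \<subseteq> J <+> I \<and>
      (\<forall>\<rho>\<in>Rep G. eval_word (\<lambda>s. \<rho> (cls [s])) z = word_map (generators J C I D \<rho>) L)"
    if "set z \<subseteq> \<Sigma>" for z
    using that
  proof (induction z)
    case Nil
    show ?case by (rule exI[of _ "[]"]) simp
  next
    case (Cons s z)
    then obtain L where L: "fst ` set L \<subseteq> J <+> I"
      "\<And>\<rho>. \<rho> \<in> Rep G \<Longrightarrow> eval_word (\<lambda>s. \<rho> (cls [s])) z = word_map (generators J C I D \<rho>) L"
      by auto
    have "\<exists>L'. fst ` set L' \<subseteq> J <+> I \<and> (\<forall>\<rho>\<in>Rep G. \<rho> (cls [s]) = word_map (generators J C I D \<rho>) L')"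
    proof (cases s)
      case (Inl x)
      then obtain L' where L': "fst ` set L' \<subseteq> J"
        "\<And>h. h \<in> hom A homeo_plus \<Longrightarrow> h x = word_map (generator_images J C h) L'"
        using C[of x] Cons.prems by auto
      have "\<rho> (cls [s]) = word_map (generators J C I D \<rho>) (map (apfst Inl) L')" if "\<rho> \<in> Rep G" for \<rho>
      proof -
        have "\<rho> (cls [s]) = word_map (\<lambda>j. generators J C I D \<rho> (Inl j)) L'"
          unfolding Inl generators_def sum.case by (rule L'(2)[OF Rep_restrict(1)[OF that]])
        then show ?thesis by (simp only: word_map_reindex)
      qed
      then show ?thesis using L'(1) by (intro exI[of _ "map (apfst Inl) L'"]) force
    next
      case (Inr y)
      then obtain L' where L': "fst ` set L' \<subseteq> I"
        "\<And>h. h \<in> hom B homeo_plus \<Longrightarrow> h y = word_map (generator_images I D h) L'"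
        using D[of y] Cons.prems by auto
      have "\<rho> (cls [s]) = word_map (generators J C I D \<rho>) (map (apfst Inr) L')" if "\<rho> \<in> Rep G" for \<rho>
      proof -
        have "\<rho> (cls [s]) = word_map (\<lambda>i. generators J C I D \<rho> (Inr i)) L'"
          unfolding Inr generators_def sum.case by (rule L'(2)[OF Rep_restrict(2)[OF that]])
        then show ?thesis by (simp only: word_map_reindex)
      qed
      then show ?thesis using L'(1) by (intro exI[of _ "map (apfst Inr) L'"]) force
    qed
    then obtain L' where "fst ` set L' \<subseteq> J <+> I"
      "\<forall>\<rho>\<in>Rep G. \<rho> (cls [s]) = word_map (generators J C I D \<rho>) L'" by blast
    then show ?case using L by (intro exI[of _ "L' @ L"]) (auto simp: word_map_append)
  qed
  moreover obtain z where "z \<in> lists \<Sigma>" "g = cls z"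
    using g unfolding G_def carrier_presented_monoid by blast
  ultimately show ?thesis using Rep_eval[of _ z] by (auto simp: in_lists_conv_set subset_iff)
qed

end

theorem theorem1p1:
  fixes n m :: nat
    and w1 w2 :: "(nat \<times> bool) list set"
    and \<rho> :: "((nat \<times> bool) list set + (nat \<times> bool) list set) list set \<Rightarrow> real \<Rightarrow> real"
  assumes "n \<ge> 2" and "m \<ge> 1"
    and "w1 \<in> carrier (free_group {..<n})" and "w1 \<noteq> \<one>\<^bsub>free_group {..<n}\<^esub>"
    and "w2 \<in> carrier (free_group {..<m})" and "w2 \<noteq> \<one>\<^bsub>free_group {..<m}\<^esub>"
    and "\<rho> \<in> Rep_sharp (cyclic_amalgam (free_group {..<n}) w1 (free_group {..<m}) w2)"
  shows "flexible (cyclic_amalgam (free_group {..<n}) w1 (free_group {..<m}) w2) \<rho>"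
proof -
  interpret cyclic_amalgam_pair "free_group {..<n}" w1 "free_group {..<m}" w2
    by (rule cyclic_amalgam_pair.intro[OF group_free_group group_free_group assms(3,5)])
  obtain C v where C_ball: "\<forall>j\<in>{..<n}. C j \<in> carrier (free_group {..<n})"
    and v: "cyclically_reduced v" "fst ` set v \<subseteq> {..<n}"
    and C_v_ball: "\<forall>h\<in>hom (free_group {..<n}) homeo_plus. h w1 = word_map (generator_images {..<n} C h) v"
    and C_words_ball: "\<forall>g\<in>carrier (free_group {..<n}). \<exists>L. fst ` set L \<subseteq> {..<n} \<and>
      (\<forall>h\<in>hom (free_group {..<n}) homeo_plus. h g = word_map (generator_images {..<n} C h) L)"
    and C_lift_all: "\<forall>c. homeo_family c \<longrightarrow>
      (\<exists>h\<in>hom (free_group {..<n}) homeo_plus. \<forall>j\<in>{..<n}. h (C j) = c j)"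
    by (rule adapted_basis[OF assms(3,4)])
  note C = bspec[OF C_ball] and C_v = bspec[OF C_v_ball]
    and C_words = bspec[OF C_words_ball] and C_lift = C_lift_all[rule_format]
  obtain D w where D_ball: "\<forall>j\<in>{..<m}. D j \<in> carrier (free_group {..<m})"
    and w: "cyclically_reduced w" "fst ` set w \<subseteq> {..<m}"
    and D_w_ball: "\<forall>h\<in>hom (free_group {..<m}) homeo_plus. h w2 = word_map (generator_images {..<m} D h) w"
    and D_words_ball: "\<forall>g\<in>carrier (free_group {..<m}). \<exists>L. fst ` set L \<subseteq> {..<m} \<and>
      (\<forall>h\<in>hom (free_group {..<m}) homeo_plus. h g = word_map (generator_images {..<m} D h) L)"
    and D_lift_all: "\<forall>c. homeo_family c \<longrightarrow>
      (\<exists>h\<in>hom (free_group {..<m}) homeo_plus. \<forall>j\<in>{..<m}. h (D j) = c j)"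
    by (rule adapted_basis[OF assms(5,6)])
  note D = bspec[OF D_ball] and D_w = bspec[OF D_w_ball]
    and D_words = bspec[OF D_words_ball] and D_lift = D_lift_all[rule_format]
  define gens where "gens = generators {..<n} C {..<m} D"
  define left where "left \<rho>' = generator_images {..<n} C (\<lambda>x. \<rho>' (cls [Inl x]))" for \<rho>'
  define right where "right \<rho>' = generator_images {..<m} D (\<lambda>y. \<rho>' (cls [Inr y]))" for \<rho>'
  have gens: "gens \<rho>' = case_sum (left \<rho>') (right \<rho>')" for \<rho>'
    by (simp add: gens_def generators_def left_def right_def)
  have left: "homeo_family (left \<rho>')" and right: "homeo_family (right \<rho>')" if "\<rho>' \<in> Rep G" for \<rho>'
    unfolding left_def right_def
    by (rule generator_images_homeo[OF Rep_restrict(1)[OF that] C], assumption)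
      (rule generator_images_homeo[OF Rep_restrict(2)[OF that] D])
  have gens_homeo: "homeo_family (gens \<rho>')" if "\<rho>' \<in> Rep G" for \<rho>'
    unfolding gens by (rule homeo_family_case_sum[OF left[OF that] right[OF that]])
  have words: "\<exists>L. fst ` set L \<subseteq> {..<n} <+> {..<m} \<and> (\<forall>\<rho>'\<in>Rep G. \<rho>' g = word_map (gens \<rho>') L)"
    if "g \<in> carrier G" for g
    unfolding gens_def by (rule Rep_words[OF C_words D_words that])
  have \<rho>: "\<rho> \<in> Rep G" and no_global: "\<nexists>x. global_fixed_point G \<rho> x"
    using assms(7) by (auto simp: Rep_sharp_def)
  have no_common: "no_common_fixed_point {..<n} (left \<rho>) {..<m} (right \<rho>) UNIV"
    unfolding no_common_fixed_point_def
  proof (intro ballI notI, elim conjE)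
    fix x assume x: "\<forall>j\<in>{..<n}. left \<rho> j x = x" "\<forall>j\<in>{..<m}. right \<rho> j x = x"
    have "\<rho> g x = x" if g: "g \<in> carrier G" for g
    proof -
      obtain L where L: "fst ` set L \<subseteq> {..<n} <+> {..<m}" "\<rho> g = word_map (gens \<rho>) L"
        using words[OF g] \<rho> by blast
      have "gens \<rho> k x = x" if "(k, b) \<in> set L" for k b
      proof -
        have "k \<in> {..<n} <+> {..<m}" using L(1) that by force
        then show ?thesis using x by (auto simp: gens)
      qed
      then show ?thesis unfolding L(2) by (intro homeo_family.word_fixed[OF gens_homeo[OF \<rho>]])
    qed
    then show False using no_global by (auto simp: global_fixed_point_def)
  qed
  have eq: "word_map (left \<rho>) v = word_map (right \<rho>) w"
    using C_v[OF Rep_restrict(1)[OF \<rho>]] D_w[OF Rep_restrict(2)[OF \<rho>]] Rep_restrict(3)[OF \<rho>]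
    by (simp add: left_def right_def)
  have "\<not> locally_rigid G \<rho>"
  proof
    assume "locally_rigid G \<rho>"
    then obtain U where U: "openin (Rep_topology G) U" "\<rho> \<in> U"
      and rigid: "\<And>\<rho>'. \<rho>' \<in> U \<Longrightarrow> \<rho>' \<in> Rep_sharp G \<Longrightarrow> semi_conjugated G \<rho>' \<rho>"
      unfolding locally_rigid_def by blast
    obtain S K where S: "finite S" "S \<subseteq> carrier G"
      and near: "\<And>\<rho>'. \<rho>' \<in> Rep G \<Longrightarrow> (\<And>g x. g \<in> S \<Longrightarrow> \<bar>x\<bar> \<le> K \<Longrightarrow> \<rho>' g x = \<rho> g x) \<Longrightarrow> \<rho>' \<in> U"
      using Rep_topology_nbhd[OF U] by metis
    have "\<exists>K'. \<forall>\<rho>'\<in>Rep G. (\<forall>k\<in>{..<n} <+> {..<m}. \<forall>x. \<bar>x\<bar> \<le> K' \<longrightarrow> gens \<rho>' k x = gens \<rho> k x)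
        \<longrightarrow> (\<forall>x. \<bar>x\<bar> \<le> K \<longrightarrow> \<rho>' g x = \<rho> g x)" if g: "g \<in> carrier G" for g
    proof -
      obtain L where L: "fst ` set L \<subseteq> {..<n} <+> {..<m}" "\<And>\<rho>'. \<rho>' \<in> Rep G \<Longrightarrow> \<rho>' g = word_map (gens \<rho>') L"
        using words[OF g] by blast
      obtain K' where "\<And>d. homeo_family d \<Longrightarrow> (\<forall>k\<in>fst ` set L. \<forall>x. \<bar>x\<bar> \<le> K' \<longrightarrow> d k x = gens \<rho> k x)
          \<Longrightarrow> (\<forall>x. \<bar>x\<bar> \<le> K \<longrightarrow> word_map d L x = word_map (gens \<rho>) L x)"
        using word_map_near[OF gens_homeo[OF \<rho>], of L K] by blast
      note K' = this
      show ?thesis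
      proof (intro exI[of _ K'] ballI impI allI)
        fix \<rho>' x
        assume \<rho>': "\<rho>' \<in> Rep G" and x: "\<bar>x\<bar> \<le> K"
          and close: "\<forall>k\<in>{..<n} <+> {..<m}. \<forall>x. \<bar>x\<bar> \<le> K' \<longrightarrow> gens \<rho>' k x = gens \<rho> k x"
        have "\<forall>k\<in>fst ` set L. \<forall>x. \<bar>x\<bar> \<le> K' \<longrightarrow> gens \<rho>' k x = gens \<rho> k x"
          by (rule ballI, rule bspec[OF close], rule subsetD[OF L(1)])
        from K'[OF gens_homeo[OF \<rho>'] this] x show "\<rho>' g x = \<rho> g x"
          unfolding L(2)[OF \<rho>'] L(2)[OF \<rho>] by blast
      qed
    qed
    then obtain \<kappa> where \<kappa>: "\<And>g \<rho>' x. g \<in> carrier G \<Longrightarrow> \<rho>' \<in> Rep G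
        \<Longrightarrow> (\<forall>k\<in>{..<n} <+> {..<m}. \<forall>x. \<bar>x\<bar> \<le> \<kappa> g \<longrightarrow> gens \<rho>' k x = gens \<rho> k x)
        \<Longrightarrow> \<bar>x\<bar> \<le> K \<Longrightarrow> \<rho>' g x = \<rho> g x"
      by metis
    \<comment> \<open>Agreement of the generators on \<open>[- R, R]\<close> puts a representation into \<open>U\<close>.\<close>
    define R where "R = Max (insert 0 (\<kappa> ` S))"
    have R: "\<kappa> g \<le> R" if "g \<in> S" for g using that S(1) by (simp add: R_def)
    obtain k where k: "k \<in> {..<n} <+> {..<m}"
      and pert: "\<And>up. \<exists>(a', b') \<in> perturbations {..<n} v (left \<rho>) {..<m} w (right \<rho>) R.
        moves_end up (case_sum a' b' k)"
      using perturbations_exist[OF left[OF \<rho>] right[OF \<rho>] _ _ assms(1) v w eq no_common, of R]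
      by (auto simp: left_def right_def generator_images_def)
    define g where "g = (case k of Inl j \<Rightarrow> cls [Inl (C j)] | Inr i \<Rightarrow> cls [Inr (D i)])"
    have g: "g \<in> carrier G"
      using k C D hom_in_carrier[OF inl_hom] hom_in_carrier[OF inr_hom] by (auto simp: g_def)
    have gens_k: "\<rho>' g = gens \<rho>' k" for \<rho>'
      using k by (auto simp: g_def gens left_def right_def generator_images_def)
    have "moves_end up (\<rho> g)" for up
    proof -
      obtain a' b' where "(a', b') \<in> perturbations {..<n} v (left \<rho>) {..<m} w (right \<rho>) R"
        and up: "moves_end up (case_sum a' b' k)"
        using pert[of up] by blast
      then have a': "homeo_family a'" and b': "homeo_family b'"
        and a'b': "word_map a' v = word_map b' w" "no_common_fixed_point {..<n} a' {..<m} b' UNIV"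
        and close: "\<And>j x. j < n \<Longrightarrow> \<bar>x\<bar> \<le> R \<Longrightarrow> a' j x = left \<rho> j x"
          "\<And>i x. i < m \<Longrightarrow> \<bar>x\<bar> \<le> R \<Longrightarrow> b' i x = right \<rho> i x"
        by (auto simp: perturbations_def)
      obtain h where h: "h \<in> hom (free_group {..<n}) homeo_plus" "\<And>j. j \<in> {..<n} \<Longrightarrow> h (C j) = a' j"
        using C_lift[OF a'] by blast
      obtain l where l: "l \<in> hom (free_group {..<m}) homeo_plus" "\<And>i. i \<in> {..<m} \<Longrightarrow> l (D i) = b' i"
        using D_lift[OF b'] by blast
      have "h w1 = word_map a' v"
        unfolding C_v[OF h(1)] using v(2) h(2) by (intro word_map_cong) (auto simp: generator_images_def)
      moreover have "l w2 = word_map b' w"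
        unfolding D_w[OF l(1)] using w(2) l(2) by (intro word_map_cong) (auto simp: generator_images_def)
      ultimately have "h w1 = l w2" using a'b' by simp
      then obtain \<rho>' where \<rho>': "\<rho>' \<in> Rep G"
        and \<rho>'_h: "\<And>x. x \<in> carrier (free_group {..<n}) \<Longrightarrow> \<rho>' (cls [Inl x]) = h x"
        and \<rho>'_l: "\<And>y. y \<in> carrier (free_group {..<m}) \<Longrightarrow> \<rho>' (cls [Inr y]) = l y"
        using Rep_lift[OF h(1) l(1)] by blast
      have gens': "gens \<rho>' i = case_sum a' b' i" if "i \<in> {..<n} <+> {..<m}" for i
        using that \<rho>'_h[OF C] \<rho>'_l[OF D] h(2) l(2)
        by (auto simp: gens left_def right_def generator_images_def)
      have "\<rho>' \<in> U"
      proof (rule near[OF \<rho>'])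
        fix g x assume gx: "g \<in> S" "\<bar>x\<bar> \<le> K"
        have "gens \<rho>' i y = gens \<rho> i y" if "i \<in> {..<n} <+> {..<m}" "\<bar>y\<bar> \<le> \<kappa> g" for i y
          using gens'[OF that(1)] close that R[OF gx(1)] by (auto simp: gens)
        then show "\<rho>' g x = \<rho> g x" using \<kappa>[OF _ \<rho>' _ gx(2)] gx(1) S(2) by blast
      qed
      moreover have "\<rho>' \<in> Rep_sharp G"
      proof -
        have "\<not> global_fixed_point G \<rho>' x" for x
        proof
          assume fixed: "global_fixed_point G \<rho>' x"
          have "a' j x = x" if "j \<in> {..<n}" for j
            using fixed hom_in_carrier[OF inl_hom C[OF that]] \<rho>'_h[OF C[OF that]] h(2)[OF that]
            by (auto simp: global_fixed_point_def)
          moreover have "b' i x = x" if "i \<in> {..<m}" for i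
            using fixed hom_in_carrier[OF inr_hom D[OF that]] \<rho>'_l[OF D[OF that]] l(2)[OF that]
            by (auto simp: global_fixed_point_def)
          ultimately show False using a'b'(2) unfolding no_common_fixed_point_def by blast
        qed
        then show ?thesis using \<rho>' by (auto simp: Rep_sharp_def)
      qed
      ultimately have "semi_conjugated G \<rho>' \<rho>" by (rule rigid)
      moreover have "moves_end up (\<rho>' g)" using up by (simp add: gens_k gens'[OF k])
      ultimately show ?thesis using semi_conjugated_moves_end[OF \<rho>' \<rho> _ g] by blast
    qed
    then show False using moves_end_exclusive by blast
  qed
  then show ?thesis using assms(7) by (simp add: flexible_def)
qed

end
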